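(* Let $G$ and $H$ be Lie groups (possibly infinite-dimensional) with Lie algebras $\mathfrak g$ and $\mathfrak h$, each carrying the right invariant metric determined by a positive definite bounded inner product $\langle\,,\rangle$ on its Lie algebra. Let $B:G\times H\to H$ be a smooth action of $G$ on $H$ by group homomorphisms, with induced Lie algebra action $b:\mathfrak g\to\operatorname{Der}\mathfrak h$, and equip the semidirect product group $G\ltimes H$ with the right invariant metric determined by $\langle(X_1,Y_1),(X_2,Y_2)\rangle=\langle X_1,X_2\rangle+\langle Y_1,Y_2\rangle$ on $\mathfrak g\ltimes\mathfrak h$. Assume that for all $X\in\mathfrak g$ and $Y\in\mathfrak h$ the transposes $\operatorname{ad}(X)^\top$ on $\mathfrak g$, $\operatorname{ad}(Y)^\top$ on $\mathfrak h$ and $b(X)^\top$ on $\mathfrak h$ exist, and that there exists a bilinear map $h:\mathfrak h\times\mathfrak h\to\mathfrak g$ with $$\langle b(X)Y_1,Y_2\rangle=\langle h(Y_1,Y_2),X\rangle\quad\text{for all }X\in\mathfrak g,\ Y_1,Y_2\in\mathfrak h.$$ Then the geodesic equation on $G\ltimes H$, for a smooth curve in $G\ltimes H$ with right logarithmic derivative $(u,\alpha):I\to\mathfrak g\ltimes\mathfrak h$, is $$u_t=-\operatorname{ad}(u)^\top u+h(\alpha,\alpha),\qquad \alpha_t=-\operatorname{ad}(\alpha)^\top\alpha-b(u)^\top\alpha .$$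
   Context: Semidirect product: the group operation on $G\ltimes H$ is $(g_1,h_1)(g_2,h_2)=(g_1g_2,\,h_1B(g_1)h_2)$. With $\beta(g)=T_eB(g)\in\operatorname{Aut}\mathfrak h$, the map $b:\mathfrak g\to\operatorname{Der}\mathfrak h$ is the differential of $\beta$ at the identity, and the Lie algebra of $G\ltimes H$ is $\mathfrak g\ltimes\mathfrak h$ with bracket $[(X_1,Y_1),(X_2,Y_2)]=([X_1,X_2],[Y_1,Y_2]+b(X_1)Y_2-b(X_2)Y_1)$. Conventions: $\operatorname{ad}(X)Y=[X,Y]$ is the usual Lie algebra bracket (from left invariant vector fields). $T^\top$ denotes the adjoint (transpose) of a linear operator $T$ with respect to the relevant inner product, i.e. $\langle T^\top a,c\rangle=\langle a,Tc\rangle$ for all $a,c$. For a Lie group $K$ with Lie algebra $\mathfrak k$, $\rho_x$ denotes right translation by $x$; the right logarithmic derivative of a smooth curve $k:I\to K$ is $t\mapsto T\rho_{k(t)^{-1}}.k'(t)\in\mathfrak k$, and $u_t=du/dt$. The right invariant metric determined by an inner product on $\mathfrak k$ is the (weak) Riemannian metric for which all right translations are isometries and whose value at the identity is that inner product. Geodesics are taken with respect to its Levi-Civita covariant derivative. *)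

theory Defs
  imports "HOL-Analysis.Analysis" "HOL-Algebra.Group"
begin

section \<open>Calculus in locally convex spaces\<close>

text \<open>
  Manifolds are modelled on arbitrary real Hausdorff locally convex spaces, with smoothness in the
  sense of Michal--Bastiani (Milnor, Hamilton, Neeb). This contains Banach and Frechet Lie groups
  such as diffeomorphism groups. No completeness is required.
\<close>

class locally_convex_space = real_vector + t2_space +
  assumes tendsto_plus_nhds:
    "((\<lambda>z. fst z + snd z) \<longlongrightarrow> x + y) (nhds x \<times>\<^sub>F nhds y)"
  and tendsto_scaleR_nhds:
    "((\<lambda>z. fst z *\<^sub>R snd z) \<longlongrightarrow> r *\<^sub>R x) (nhds r \<times>\<^sub>F nhds x)"
  and convex_nhds_base:
    "open S \<Longrightarrow> x \<in> S \<Longrightarrow>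
      \<exists>V. open V \<and> x \<in> V \<and> V \<subseteq> S \<and>
        (\<forall>y\<in>V. \<forall>z\<in>V. \<forall>s\<in>{0..1}. (1 - s) *\<^sub>R y + s *\<^sub>R z \<in> V)"

instance real :: locally_convex_space
proof
  fix r x y :: real
  show "((\<lambda>z. fst z + snd z) \<longlongrightarrow> x + y) (nhds x \<times>\<^sub>F nhds y)"
    by (intro tendsto_add filterlim_fst filterlim_snd)
  show "((\<lambda>z. fst z *\<^sub>R snd z) \<longlongrightarrow> r *\<^sub>R x) (nhds r \<times>\<^sub>F nhds x)"
    by (intro tendsto_scaleR filterlim_fst filterlim_snd)
next
  fix S :: "real set" and x :: real
  assume "open S" "x \<in> S"
  then obtain e where e: "e > 0" "ball x e \<subseteq> S"
    using open_contains_ball by blast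
  have "\<forall>y\<in>ball x e. \<forall>z\<in>ball x e. \<forall>s\<in>{0..1}. (1 - s) *\<^sub>R y + s *\<^sub>R z \<in> ball x e"
    using convex_ball[of x e] unfolding convex_alt by auto
  with e show "\<exists>V. open V \<and> x \<in> V \<and> V \<subseteq> S \<and>
        (\<forall>y\<in>V. \<forall>z\<in>V. \<forall>s\<in>{0..1}. (1 - s) *\<^sub>R y + s *\<^sub>R z \<in> V)"
    by (intro exI[of _ "ball x e"]) auto
qed

instance prod :: (locally_convex_space, locally_convex_space) locally_convex_space
proof
  show "((\<lambda>z. fst z + snd z) \<longlongrightarrow> a + b) (nhds a \<times>\<^sub>F nhds b)" for a b :: "'a \<times> 'b"
  proof -
    have 1: "((\<lambda>z. fst z) \<longlongrightarrow> a) (nhds a \<times>\<^sub>F nhds b)"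
      and 2: "((\<lambda>z. snd z) \<longlongrightarrow> b) (nhds a \<times>\<^sub>F nhds b)"
      by (intro filterlim_fst filterlim_snd)+
    have f: "((\<lambda>z. fst (fst z) + fst (snd z)) \<longlongrightarrow> fst a + fst b) (nhds a \<times>\<^sub>F nhds b)"
      using filterlim_compose[OF tendsto_plus_nhds filterlim_Pair[OF tendsto_fst[OF 1] tendsto_fst[OF 2]]]
      by simp
    have s: "((\<lambda>z. snd (fst z) + snd (snd z)) \<longlongrightarrow> snd a + snd b) (nhds a \<times>\<^sub>F nhds b)"
      using filterlim_compose[OF tendsto_plus_nhds filterlim_Pair[OF tendsto_snd[OF 1] tendsto_snd[OF 2]]]
      by simp
    show ?thesis using tendsto_Pair[OF f s] by (simp add: plus_prod_def)
  qed
  show "((\<lambda>z. fst z *\<^sub>R snd z) \<longlongrightarrow> r *\<^sub>R x) (nhds r \<times>\<^sub>F nhds x)" for r and x :: "'a \<times> 'b"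
  proof -
    have 1: "((\<lambda>z. fst z) \<longlongrightarrow> r) (nhds r \<times>\<^sub>F nhds x)"
      and 2: "((\<lambda>z. snd z) \<longlongrightarrow> x) (nhds r \<times>\<^sub>F nhds x)"
      by (intro filterlim_fst filterlim_snd)+
    have a: "((\<lambda>z. fst z *\<^sub>R fst (snd z)) \<longlongrightarrow> r *\<^sub>R fst x) (nhds r \<times>\<^sub>F nhds x)"
      using filterlim_compose[OF tendsto_scaleR_nhds filterlim_Pair[OF 1 tendsto_fst[OF 2]]]
      by simp
    have b: "((\<lambda>z. fst z *\<^sub>R snd (snd z)) \<longlongrightarrow> r *\<^sub>R snd x) (nhds r \<times>\<^sub>F nhds x)"
      using filterlim_compose[OF tendsto_scaleR_nhds filterlim_Pair[OF 1 tendsto_snd[OF 2]]]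
      by simp
    show ?thesis using tendsto_Pair[OF a b] by (simp add: scaleR_prod_def)
  qed
  fix S :: "('a \<times> 'b) set" and x
  assume "open S" "x \<in> S"
  then obtain A B where AB: "open A" "open B" "x \<in> A \<times> B" "A \<times> B \<subseteq> S"
    by (rule open_prod_elim)
  obtain V where V: "open V" "fst x \<in> V" "V \<subseteq> A"
    "\<forall>y\<in>V. \<forall>z\<in>V. \<forall>s\<in>{0..1}. (1 - s) *\<^sub>R y + s *\<^sub>R z \<in> V"
    using convex_nhds_base[of A "fst x"] AB by auto
  obtain W where W: "open W" "snd x \<in> W" "W \<subseteq> B"
    "\<forall>y\<in>W. \<forall>z\<in>W. \<forall>s\<in>{0..1}. (1 - s) *\<^sub>R y + s *\<^sub>R z \<in> W"
    using convex_nhds_base[of B "snd x"] AB by auto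
  show "\<exists>V. open V \<and> x \<in> V \<and> V \<subseteq> S \<and>
        (\<forall>y\<in>V. \<forall>z\<in>V. \<forall>s\<in>{0..1}. (1 - s) *\<^sub>R y + s *\<^sub>R z \<in> V)"
    using V W AB by (intro exI[of _ "V \<times> W"]) (auto simp: open_Times mem_Times_iff)
qed

definition has_dir_deriv ::
  "('e::locally_convex_space \<Rightarrow> 'f::locally_convex_space) \<Rightarrow> 'f \<Rightarrow> 'e \<Rightarrow> 'e \<Rightarrow> bool" where
  "has_dir_deriv f D x v \<longleftrightarrow> ((\<lambda>s::real. (f (x + s *\<^sub>R v) - f x) /\<^sub>R s) \<longlongrightarrow> D) (at 0)"

definition dir_deriv ::
  "('e::locally_convex_space \<Rightarrow> 'f::locally_convex_space) \<Rightarrow> 'e \<Rightarrow> 'e \<Rightarrow> 'f" where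
  "dir_deriv f x v = Lim (at 0) (\<lambda>s::real. (f (x + s *\<^sub>R v) - f x) /\<^sub>R s)"

primrec iter_deriv ::
  "('e::locally_convex_space \<Rightarrow> 'f::locally_convex_space) \<Rightarrow> 'e list \<Rightarrow> 'e \<Rightarrow> 'f" where
  "iter_deriv f [] x = f x"
| "iter_deriv f (v # vs) x = dir_deriv (iter_deriv f vs) x v"

text \<open>
  Smoothness: all iterated directional derivatives \<open>d\<^sup>nf(x)(v\<^sub>0,\<dots>,v\<^sub>n\<^sub>-\<^sub>1)\<close> exist on \<open>U\<close> and are jointly
  continuous on \<open>U \<times> E\<^sup>n\<close>. The tuple of directions is coded by a sequence \<open>v :: nat \<Rightarrow> 'e\<close> (with the
  product topology), of which only the first \<open>n\<close> entries matter.
\<close>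

definition smooth_on ::
  "'e::locally_convex_space set \<Rightarrow> ('e \<Rightarrow> 'f::locally_convex_space) \<Rightarrow> bool" where
  "smooth_on U f \<longleftrightarrow> open U \<and>
    (\<forall>vs v. \<forall>x\<in>U. \<exists>D. has_dir_deriv (iter_deriv f vs) D x v) \<and>
    (\<forall>n. continuous_on (U \<times> UNIV) (\<lambda>(x, v::nat \<Rightarrow> 'e). iter_deriv f (map v [0..<n]) x))"

text \<open>Curves are defined on arbitrary nondegenerate intervals, with one-sided derivatives at end points.\<close>

definition has_curve_deriv ::
  "(real \<Rightarrow> 'e::locally_convex_space) \<Rightarrow> 'e \<Rightarrow> real \<Rightarrow> real set \<Rightarrow> bool" where
  "has_curve_deriv c D t I \<longleftrightarrow> ((\<lambda>s. (c s - c t) /\<^sub>R (s - t)) \<longlongrightarrow> D) (at t within I)"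

definition curve_deriv :: "real set \<Rightarrow> (real \<Rightarrow> 'e::locally_convex_space) \<Rightarrow> real \<Rightarrow> 'e" where
  "curve_deriv I c t = Lim (at t within I) (\<lambda>s. (c s - c t) /\<^sub>R (s - t))"

definition smooth_curve_on :: "real set \<Rightarrow> (real \<Rightarrow> 'e::locally_convex_space) \<Rightarrow> bool" where
  "smooth_curve_on I c \<longleftrightarrow>
    (\<forall>n. \<forall>t\<in>I. \<exists>D. has_curve_deriv ((curve_deriv I ^^ n) c) D t I)"

section \<open>Smooth manifolds\<close>

text \<open>A chart is given by its domain and its coordinate map.\<close>

type_synonym ('m, 'e) chart = "'m set \<times> ('m \<Rightarrow> 'e)"

abbreviation chart_dom :: "('m, 'e) chart \<Rightarrow> 'm set" where
  "chart_dom \<equiv> fst"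

abbreviation coord :: "('m, 'e) chart \<Rightarrow> 'm \<Rightarrow> 'e" where
  "coord \<equiv> snd"

definition chart_inv :: "('m, 'e) chart \<Rightarrow> 'e \<Rightarrow> 'm" where
  "chart_inv c = inv_into (chart_dom c) (coord c)"

abbreviation chart_image :: "('m, 'e) chart \<Rightarrow> 'e set" where
  "chart_image c \<equiv> coord c ` chart_dom c"

text \<open>
  Each point \<open>x\<close> carries a preferred chart \<open>chart_at M x\<close>. Through it the tangent space at \<open>x\<close> is
  identified, as a topological vector space, with the model space \<open>'e\<close>; in particular the
  Lie algebra of a Lie group is the model space, identified with the tangent space at the identity
  through the preferred chart there. The choice of preferred charts is arbitrary.
\<close>

record ('m, 'e) manifold =
  points :: "'m set"
  atlas :: "('m, 'e) chart set"
  chart_at :: "'m \<Rightarrow> ('m, 'e) chart"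

definition manifold_open :: "('m, 'e::locally_convex_space) manifold \<Rightarrow> 'm set \<Rightarrow> bool" where
  "manifold_open M W \<longleftrightarrow> W \<subseteq> points M \<and> (\<forall>c\<in>atlas M. open (coord c ` (W \<inter> chart_dom c)))"

definition smooth_manifold :: "('m, 'e::locally_convex_space) manifold \<Rightarrow> bool" where
  "smooth_manifold M \<longleftrightarrow>
    (\<Union>c\<in>atlas M. chart_dom c) = points M \<and>
    (\<forall>c\<in>atlas M. inj_on (coord c) (chart_dom c) \<and> open (chart_image c)) \<and>
    (\<forall>c\<in>atlas M. \<forall>d\<in>atlas M.
      smooth_on (coord c ` (chart_dom c \<inter> chart_dom d)) (coord d \<circ> chart_inv c)) \<and>
    (\<forall>x\<in>points M. chart_at M x \<in> atlas M \<and> x \<in> chart_dom (chart_at M x)) \<and>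
    (\<forall>x\<in>points M. \<forall>y\<in>points M. x \<noteq> y \<longrightarrow>
      (\<exists>V W. manifold_open M V \<and> manifold_open M W \<and> x \<in> V \<and> y \<in> W \<and> V \<inter> W = {}))"

definition smooth_map ::
  "('m, 'e::locally_convex_space) manifold \<Rightarrow> ('n, 'f::locally_convex_space) manifold \<Rightarrow>
    ('m \<Rightarrow> 'n) \<Rightarrow> bool" where
  "smooth_map M N f \<longleftrightarrow> f ` points M \<subseteq> points N \<and>
    (\<forall>c\<in>atlas M. \<forall>d\<in>atlas N.
      smooth_on (coord c ` {x \<in> chart_dom c. f x \<in> chart_dom d}) (coord d \<circ> f \<circ> chart_inv c))"

definition prod_chart :: "('m, 'e) chart \<Rightarrow> ('n, 'f) chart \<Rightarrow> ('m \<times> 'n, 'e \<times> 'f) chart" where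
  "prod_chart c d = (chart_dom c \<times> chart_dom d, map_prod (coord c) (coord d))"

definition prod_manifold ::
  "('m, 'e) manifold \<Rightarrow> ('n, 'f) manifold \<Rightarrow> ('m \<times> 'n, 'e \<times> 'f) manifold" where
  "prod_manifold M N =
    \<lparr>points = points M \<times> points N,
     atlas = (\<lambda>(c, d). prod_chart c d) ` (atlas M \<times> atlas N),
     chart_at = (\<lambda>(x, y). prod_chart (chart_at M x) (chart_at N y))\<rparr>"

text \<open>The tangent map of \<open>f\<close> at \<open>x\<close> in charts \<open>c\<close> at \<open>x\<close> and \<open>d\<close> at \<open>f x\<close>, and in the preferred charts.\<close>

definition tangent_map_in ::
  "('m, 'e::locally_convex_space) chart \<Rightarrow> ('n, 'f::locally_convex_space) chart \<Rightarrow>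
    ('m \<Rightarrow> 'n) \<Rightarrow> 'm \<Rightarrow> 'e \<Rightarrow> 'f" where
  "tangent_map_in c d f x v = dir_deriv (coord d \<circ> f \<circ> chart_inv c) (coord c x) v"

definition tangent_map ::
  "('m, 'e::locally_convex_space) manifold \<Rightarrow> ('n, 'f::locally_convex_space) manifold \<Rightarrow>
    ('m \<Rightarrow> 'n) \<Rightarrow> 'm \<Rightarrow> 'e \<Rightarrow> 'f" where
  "tangent_map M N f x v = tangent_map_in (chart_at M x) (chart_at N (f x)) f x v"

text \<open>The bracket of two vector fields in a chart, i.e. the commutator of derivations \<open>XY - YX\<close>.\<close>

definition field_bracket ::
  "('e::locally_convex_space \<Rightarrow> 'e) \<Rightarrow> ('e \<Rightarrow> 'e) \<Rightarrow> 'e \<Rightarrow> 'e" where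
  "field_bracket X Y p = dir_deriv Y p (X p) - dir_deriv X p (Y p)"

definition smooth_curve_in ::
  "('m, 'e::locally_convex_space) manifold \<Rightarrow> real set \<Rightarrow> (real \<Rightarrow> 'm) \<Rightarrow> bool" where
  "smooth_curve_in M I k \<longleftrightarrow> k ` I \<subseteq> points M \<and>
    (\<forall>c\<in>atlas M. openin (top_of_set I) {t \<in> I. k t \<in> chart_dom c} \<and>
      smooth_curve_on {t \<in> I. k t \<in> chart_dom c} (coord c \<circ> k))"

definition velocity ::
  "('m, 'e::locally_convex_space) manifold \<Rightarrow> real set \<Rightarrow> (real \<Rightarrow> 'm) \<Rightarrow> real \<Rightarrow> 'e" where
  "velocity M I k t = curve_deriv I (coord (chart_at M (k t)) \<circ> k) t"

section \<open>Weak Riemannian metrics, covariant derivatives and geodesics\<close>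

definition inner_product :: "('e::real_vector \<Rightarrow> 'e \<Rightarrow> real) \<Rightarrow> bool" where
  "inner_product ip \<longleftrightarrow> bilinear ip \<and> (\<forall>v w. ip v w = ip w v) \<and> (\<forall>v. v \<noteq> 0 \<longrightarrow> ip v v > 0)"

text \<open>\<open>metric_in M g c\<close> is the expression of the metric \<open>g\<close> in the chart \<open>c\<close>.\<close>

definition metric_in ::
  "('m, 'e::locally_convex_space) manifold \<Rightarrow> ('m \<Rightarrow> 'e \<Rightarrow> 'e \<Rightarrow> real) \<Rightarrow> ('m, 'e) chart \<Rightarrow>
    'e \<Rightarrow> 'e \<Rightarrow> 'e \<Rightarrow> real" where
  "metric_in M g c p v w =
    (let x = chart_inv c p; \<tau> = tangent_map_in c (chart_at M x) id x in g x (\<tau> v) (\<tau> w))"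

text \<open>
  The inner products on the tangent spaces need not induce the topology of the model space.
  They depend smoothly on the point along smooth curves, which is the notion of smoothness for which
  bounded (rather than continuous) bilinear maps are smooth.
\<close>

definition weak_riemannian_metric ::
  "('m, 'e::locally_convex_space) manifold \<Rightarrow> ('m \<Rightarrow> 'e \<Rightarrow> 'e \<Rightarrow> real) \<Rightarrow> bool" where
  "weak_riemannian_metric M g \<longleftrightarrow>
    (\<forall>x\<in>points M. inner_product (g x)) \<and>
    (\<forall>c\<in>atlas M. \<forall>\<xi> v w.
      smooth_curve_on UNIV \<xi> \<and> range \<xi> \<subseteq> chart_image c \<and>
      smooth_curve_on UNIV v \<and> smooth_curve_on UNIV w \<longrightarrow>
      smooth_curve_on UNIV (\<lambda>t. metric_in M g c (\<xi> t) (v t) (w t)))"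

text \<open>
  A covariant derivative is given by its Christoffel maps \<open>\<Gamma> c p\<close> in the charts \<open>c\<close>, so that
  \<open>\<nabla>\<^sub>XY = dY(X) + \<Gamma>(X,Y)\<close>. The transformation law says that \<open>\<nabla>\<^sub>XY\<close> does not depend on the chart.
  No regularity of \<open>\<Gamma>\<close> in \<open>p\<close> is demanded: for a weak metric the pointwise existence of transposes
  yields the Christoffel maps but not their continuity. As the Levi-Civita covariant derivative is
  unique (by the Koszul formula), a smooth one is necessarily the one considered here.
\<close>

type_synonym ('m, 'e) christoffel = "('m, 'e) chart \<Rightarrow> 'e \<Rightarrow> 'e \<Rightarrow> 'e \<Rightarrow> 'e"

definition covariant_derivative ::
  "('m, 'e::locally_convex_space) manifold \<Rightarrow> ('m, 'e) christoffel \<Rightarrow> bool" where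
  "covariant_derivative M \<Gamma> \<longleftrightarrow>
    (\<forall>c\<in>atlas M. \<forall>p\<in>chart_image c. bilinear (\<Gamma> c p)) \<and>
    (\<forall>c\<in>atlas M. \<forall>d\<in>atlas M. \<forall>p\<in>coord c ` (chart_dom c \<inter> chart_dom d). \<forall>v w.
      let \<theta> = coord d \<circ> chart_inv c in
      dir_deriv \<theta> p (\<Gamma> c p v w) =
        dir_deriv (\<lambda>q. dir_deriv \<theta> q w) p v +
        \<Gamma> d (\<theta> p) (dir_deriv \<theta> p v) (dir_deriv \<theta> p w))"

definition nabla ::
  "('m, 'e::locally_convex_space) christoffel \<Rightarrow> ('m, 'e) chart \<Rightarrow>
    ('e \<Rightarrow> 'e) \<Rightarrow> ('e \<Rightarrow> 'e) \<Rightarrow> 'e \<Rightarrow> 'e" where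
  "nabla \<Gamma> c X Y p = dir_deriv Y p (X p) + \<Gamma> c p (X p) (Y p)"

definition levi_civita ::
  "('m, 'e::locally_convex_space) manifold \<Rightarrow> ('m \<Rightarrow> 'e \<Rightarrow> 'e \<Rightarrow> real) \<Rightarrow>
    ('m, 'e) christoffel \<Rightarrow> bool" where
  "levi_civita M g \<Gamma> \<longleftrightarrow> covariant_derivative M \<Gamma> \<and>
    (\<forall>c\<in>atlas M. \<forall>W \<subseteq> chart_image c. \<forall>X Y.
      smooth_on W X \<and> smooth_on W Y \<longrightarrow>
      (\<forall>p\<in>W. nabla \<Gamma> c X Y p - nabla \<Gamma> c Y X p = field_bracket X Y p)) \<and>
    (\<forall>c\<in>atlas M. \<forall>W \<subseteq> chart_image c. \<forall>X Y Z.
      smooth_on W X \<and> smooth_on W Y \<and> smooth_on W Z \<longrightarrow>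
      (\<forall>p\<in>W. has_dir_deriv (\<lambda>q. metric_in M g c q (Y q) (Z q))
        (metric_in M g c p (nabla \<Gamma> c X Y p) (Z p) + metric_in M g c p (Y p) (nabla \<Gamma> c X Z p))
        p (X p)))"

definition geodesic ::
  "('m, 'e::locally_convex_space) manifold \<Rightarrow> ('m \<Rightarrow> 'e \<Rightarrow> 'e \<Rightarrow> real) \<Rightarrow>
    real set \<Rightarrow> (real \<Rightarrow> 'm) \<Rightarrow> bool" where
  "geodesic M g I k \<longleftrightarrow> smooth_curve_in M I k \<and>
    (\<exists>\<Gamma>. levi_civita M g \<Gamma> \<and>
      (\<forall>c\<in>atlas M. \<forall>t\<in>I. k t \<in> chart_dom c \<longrightarrow>
        (let J = {s \<in> I. k s \<in> chart_dom c}; x = coord c \<circ> k; v = curve_deriv J x in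
          curve_deriv J v t + \<Gamma> c (x t) (v t) (v t) = 0)))"

section \<open>Lie groups with right invariant metrics\<close>

definition lie_group :: "('g, 'a) monoid_scheme \<Rightarrow> ('g, 'e::locally_convex_space) manifold \<Rightarrow> bool" where
  "lie_group G M \<longleftrightarrow> group G \<and> smooth_manifold M \<and> carrier G = points M \<and>
    smooth_map (prod_manifold M M) M (\<lambda>(x, y). x \<otimes>\<^bsub>G\<^esub> y) \<and>
    smooth_map M M (\<lambda>x. inv\<^bsub>G\<^esub> x)"

text \<open>The left invariant vector field with value \<open>X\<close> at the identity, in the preferred chart at the identity.\<close>

definition left_invariant_field ::
  "('g, 'a) monoid_scheme \<Rightarrow> ('g, 'e::locally_convex_space) manifold \<Rightarrow> 'e \<Rightarrow> 'e \<Rightarrow> 'e" where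
  "left_invariant_field G M X p =
    (let c = chart_at M \<one>\<^bsub>G\<^esub> in
      tangent_map_in c c (\<lambda>y. chart_inv c p \<otimes>\<^bsub>G\<^esub> y) \<one>\<^bsub>G\<^esub> X)"

definition ad ::
  "('g, 'a) monoid_scheme \<Rightarrow> ('g, 'e::locally_convex_space) manifold \<Rightarrow> 'e \<Rightarrow> 'e \<Rightarrow> 'e" where
  "ad G M X Y = field_bracket (left_invariant_field G M X) (left_invariant_field G M Y)
    (coord (chart_at M \<one>\<^bsub>G\<^esub>) \<one>\<^bsub>G\<^esub>)"

definition right_log_deriv ::
  "('g, 'a) monoid_scheme \<Rightarrow> ('g, 'e::locally_convex_space) manifold \<Rightarrow>
    real set \<Rightarrow> (real \<Rightarrow> 'g) \<Rightarrow> real \<Rightarrow> 'e" where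
  "right_log_deriv G M I k t =
    tangent_map M M (\<lambda>x. x \<otimes>\<^bsub>G\<^esub> inv\<^bsub>G\<^esub> (k t)) (k t) (velocity M I k t)"

definition right_invariant_metric ::
  "('g, 'a) monoid_scheme \<Rightarrow> ('g, 'e::locally_convex_space) manifold \<Rightarrow> ('e \<Rightarrow> 'e \<Rightarrow> real) \<Rightarrow>
    ('g \<Rightarrow> 'e \<Rightarrow> 'e \<Rightarrow> real) \<Rightarrow> bool" where
  "right_invariant_metric G M ip g \<longleftrightarrow> weak_riemannian_metric M g \<and>
    (\<forall>a\<in>carrier G. \<forall>x\<in>carrier G. \<forall>v w.
      let R = tangent_map M M (\<lambda>y. y \<otimes>\<^bsub>G\<^esub> a) x in
      g (x \<otimes>\<^bsub>G\<^esub> a) (R v) (R w) = g x v w) \<and>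
    g \<one>\<^bsub>G\<^esub> = ip"

text \<open>Boundedness in the sense of von Neumann (absorbed by every neighbourhood of zero).\<close>

definition vn_bounded :: "'e::locally_convex_space set \<Rightarrow> bool" where
  "vn_bounded A \<longleftrightarrow> (\<forall>V. open V \<and> 0 \<in> V \<longrightarrow> (\<exists>r>0. A \<subseteq> (\<lambda>x. r *\<^sub>R x) ` V))"

definition bounded_inner_product :: "('e::locally_convex_space \<Rightarrow> 'e \<Rightarrow> real) \<Rightarrow> bool" where
  "bounded_inner_product ip \<longleftrightarrow> inner_product ip \<and>
    (\<forall>A B. vn_bounded A \<and> vn_bounded B \<longrightarrow> bounded ((\<lambda>(a, b). ip a b) ` (A \<times> B)))"

definition is_transpose :: "('e \<Rightarrow> 'e \<Rightarrow> real) \<Rightarrow> ('e \<Rightarrow> 'e) \<Rightarrow> ('e \<Rightarrow> 'e) \<Rightarrow> bool" where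
  "is_transpose ip T S \<longleftrightarrow> (\<forall>a c. ip (S a) c = ip a (T c))"

text \<open>For an inner product a transpose is unique, and linear if the operator is.\<close>

definition has_transpose :: "('e \<Rightarrow> 'e \<Rightarrow> real) \<Rightarrow> ('e \<Rightarrow> 'e) \<Rightarrow> bool" where
  "has_transpose ip T \<longleftrightarrow> (\<exists>S. is_transpose ip T S)"

definition transpose_of :: "('e \<Rightarrow> 'e \<Rightarrow> real) \<Rightarrow> ('e \<Rightarrow> 'e) \<Rightarrow> ('e \<Rightarrow> 'e)" where
  "transpose_of ip T = (THE S. is_transpose ip T S)"

section \<open>Semidirect products\<close>

definition smooth_action_by_homs ::
  "('g, 'a) monoid_scheme \<Rightarrow> ('g, 'e::locally_convex_space) manifold \<Rightarrow>
    ('h, 'b) monoid_scheme \<Rightarrow> ('h, 'f::locally_convex_space) manifold \<Rightarrow>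
    ('g \<Rightarrow> 'h \<Rightarrow> 'h) \<Rightarrow> bool" where
  "smooth_action_by_homs G M H N B \<longleftrightarrow>
    (\<forall>g\<in>carrier G. B g \<in> hom H H) \<and>
    (\<forall>x\<in>carrier H. B \<one>\<^bsub>G\<^esub> x = x) \<and>
    (\<forall>g1\<in>carrier G. \<forall>g2\<in>carrier G. \<forall>x\<in>carrier H. B (g1 \<otimes>\<^bsub>G\<^esub> g2) x = B g1 (B g2 x)) \<and>
    smooth_map (prod_manifold M N) N (\<lambda>(g, x). B g x)"

definition semidirect ::
  "('g, 'a) monoid_scheme \<Rightarrow> ('h, 'b) monoid_scheme \<Rightarrow> ('g \<Rightarrow> 'h \<Rightarrow> 'h) \<Rightarrow> ('g \<times> 'h) monoid" where
  "semidirect G H B =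
    \<lparr>carrier = carrier G \<times> carrier H,
     mult = (\<lambda>(g1, h1) (g2, h2). (g1 \<otimes>\<^bsub>G\<^esub> g2, h1 \<otimes>\<^bsub>H\<^esub> B g1 h2)),
     one = (\<one>\<^bsub>G\<^esub>, \<one>\<^bsub>H\<^esub>)\<rparr>"

text \<open>\<open>group_deriv\<close> is \<open>\<beta>(g) = T\<^sub>eB(g)\<close>, and \<open>algebra_action\<close> is \<open>b = T\<^sub>e\<beta>\<close>.\<close>

definition group_deriv ::
  "('h, 'b) monoid_scheme \<Rightarrow> ('h, 'f::locally_convex_space) manifold \<Rightarrow>
    ('g \<Rightarrow> 'h \<Rightarrow> 'h) \<Rightarrow> 'g \<Rightarrow> 'f \<Rightarrow> 'f" where
  "group_deriv H N B g Y = tangent_map N N (B g) \<one>\<^bsub>H\<^esub> Y"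

definition algebra_action ::
  "('g, 'a) monoid_scheme \<Rightarrow> ('g, 'e::locally_convex_space) manifold \<Rightarrow>
    ('h, 'b) monoid_scheme \<Rightarrow> ('h, 'f::locally_convex_space) manifold \<Rightarrow>
    ('g \<Rightarrow> 'h \<Rightarrow> 'h) \<Rightarrow> 'e \<Rightarrow> 'f \<Rightarrow> 'f" where
  "algebra_action G M H N B X Y =
    (let c = chart_at M \<one>\<^bsub>G\<^esub> in
      dir_deriv (\<lambda>p. group_deriv H N B (chart_inv c p) Y) (coord c \<one>\<^bsub>G\<^esub>) X)"

definition sum_inner_product ::
  "('e \<Rightarrow> 'e \<Rightarrow> real) \<Rightarrow> ('f \<Rightarrow> 'f \<Rightarrow> real) \<Rightarrow> 'e \<times> 'f \<Rightarrow> 'e \<times> 'f \<Rightarrow> real" where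
  "sum_inner_product ipG ipH = (\<lambda>(X1, Y1) (X2, Y2). ipG X1 X2 + ipH Y1 Y2)"

end

(*
  Let K = G x H be the semidirect product and kappa the right Maurer-Cartan form, read in a chart. The right
  invariant metric is ip(kappa v, kappa w), the structure equation is d kappa(v,w) = [kappa v, kappa w], and
  the Levi-Civita derivative is determined by
    kappa (nabla_X Y) = d(kappa Y)(X) + A(kappa X, kappa Y),
    A(X,Y) = (ad(X)^T Y + ad(Y)^T X - [X,Y]) / 2,
  with uniqueness by the Koszul formula. Since A(X,X) = ad(X)^T X, a curve with right logarithmic derivative
  U is a geodesic iff U_t = - ad(U)^T U. On the semidirect product the transpose of ad is
    ad(X1,Y1)^T (X2,Y2) = (ad(X1)^T X2 - h(Y1,Y2), ad(Y1)^T Y2 + b(X1)^T Y2).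
  The inner product is only bounded, so ip(kappa Y, kappa Z) is differentiated with Mackey convergence of
  difference quotients. Three derivatives of the group operations suffice: kappa costs one, and its Taylor
  remainder of order two costs two more.
*)

theory Submission
  imports Defs
begin

section \<open>Calculus in locally convex spaces\<close>

text \<open>The predicate \<open>smooth_on\<close> lists iterated directional derivatives, with
  directions coded by sequences, and this form does not compose well. It is traded once, in
  \<open>smooth_on_C3_on\<close>, for classes defined through the tupled derivative
  \<open>dd\<close> on \<open>U \<times> UNIV\<close>. These pass through products and composites by
  the plain chain rule, so the semidirect product inherits class three from its factors and the
  action. The transposes are given operator by operator, so the connection is known to be bilinear
  but not to be continuous. Its laws are therefore verified at single points, either against the
  nondegenerate inner product or through the injectivity of the Maurer-Cartan form on each tangent
  space.\<close>

lemma tendsto_scaleR_lcs: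
  fixes w :: "'i \<Rightarrow> 'e::locally_convex_space"
  assumes "(s \<longlongrightarrow> r) F" "(w \<longlongrightarrow> v) F"
  shows "((\<lambda>i. s i *\<^sub>R w i) \<longlongrightarrow> r *\<^sub>R v) F"
  using filterlim_compose[OF tendsto_scaleR_nhds filterlim_Pair[OF assms]] by simp

lemma tendsto_add_lcs:
  fixes w :: "'i \<Rightarrow> 'e::locally_convex_space"
  assumes "(u \<longlongrightarrow> r) F" "(w \<longlongrightarrow> v) F"
  shows "((\<lambda>i. u i + w i) \<longlongrightarrow> r + v) F"
  using filterlim_compose[OF tendsto_plus_nhds filterlim_Pair[OF assms]] by simp

lemma tendsto_minus_lcs:
  fixes w :: "'i \<Rightarrow> 'e::locally_convex_space"
  assumes "(w \<longlongrightarrow> v) F"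
  shows "((\<lambda>i. - w i) \<longlongrightarrow> - v) F"
  using tendsto_scaleR_lcs[OF tendsto_const[of "- 1"] assms] by simp

lemma tendsto_diff_lcs:
  fixes w :: "'i \<Rightarrow> 'e::locally_convex_space"
  assumes "(u \<longlongrightarrow> r) F" "(w \<longlongrightarrow> v) F"
  shows "((\<lambda>i. u i - w i) \<longlongrightarrow> r - v) F"
  using tendsto_add_lcs[OF assms(1) tendsto_minus_lcs[OF assms(2)]] by simp

lemma continuous_on_add_lcs:
  fixes w :: "'i::topological_space \<Rightarrow> 'e::locally_convex_space"
  assumes "continuous_on S u" "continuous_on S w"
  shows "continuous_on S (\<lambda>i. u i + w i)"
  using assms unfolding continuous_on_def by (blast intro: tendsto_add_lcs)

section \<open>Convex neighbourhoods and the mean value theorem\<close>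

lemma convex_nhd:
  fixes x :: "'e::locally_convex_space"
  assumes "open S" "x \<in> S"
  obtains V where "open V" "x \<in> V" "V \<subseteq> S" "convex V"
proof -
  obtain V where V: "open V" "x \<in> V" "V \<subseteq> S"
    "\<forall>y\<in>V. \<forall>z\<in>V. \<forall>s\<in>{0..1}. (1 - s) *\<^sub>R y + s *\<^sub>R z \<in> V"
    using convex_nhds_base[OF assms] by blast
  then have "convex V" unfolding convex_alt by auto
  with V that show ?thesis by blast
qed

text \<open>The slope over two adjacent intervals is the average of the two slopes, weighted by
  length. Membership of slopes in a convex set is thus additive over intervals, which is what
  bisection needs.\<close>

lemma quotient_in_convex:
  fixes c :: "real \<Rightarrow> 'e::locally_convex_space"
  assumes "p < x" "x < r" "convex V"
    and "(c x - c p) /\<^sub>R (x - p) \<in> V" "(c r - c x) /\<^sub>R (r - x) \<in> V"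
  shows "(c r - c p) /\<^sub>R (r - p) \<in> V"
proof -
  have "((x - p) / (r - p)) *\<^sub>R ((c x - c p) /\<^sub>R (x - p)) + ((r - x) / (r - p)) *\<^sub>R ((c r - c x) /\<^sub>R (r - x)) \<in> V"
    using assms by (intro convexD[OF \<open>convex V\<close>]) (simp_all add: add_divide_distrib[symmetric])
  moreover have "((x - p) / (r - p)) *\<^sub>R ((c x - c p) /\<^sub>R (x - p)) + ((r - x) / (r - p)) *\<^sub>R ((c r - c x) /\<^sub>R (r - x))
      = (1 / (r - p)) *\<^sub>R (c x - c p) + (1 / (r - p)) *\<^sub>R (c r - c x)"
    using assms by (simp add: field_simps)
  ultimately show ?thesis
    by (simp add: scaleR_right_distrib[symmetric] inverse_eq_divide)
qed

text \<open>Bisection replaces both integration and linear functionals. Differentiability at a point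
  puts the slopes from that point to either side into the open set \<open>V\<close>, and convexity
  joins the two sides into slopes over all short intervals around the point.\<close>

lemma mean_value_convex:
  fixes c :: "real \<Rightarrow> 'e::locally_convex_space"
  assumes "a < b" "open V" "convex V"
    and d: "\<And>t. t \<in> {a..b} \<Longrightarrow> has_curve_deriv c (c' t) t {a..b}"
    and V: "\<And>t. t \<in> {a..b} \<Longrightarrow> c' t \<in> V"
  shows "(c b - c a) /\<^sub>R (b - a) \<in> V"
proof -
  \<comment> \<open>The implication makes the property vacuous for degenerate intervals and for
    intervals that leave \<open>{a..b}\<close>; the local condition of \<open>Bolzano\<close> ranges
    over both.\<close>
  define P where "P p r \<longleftrightarrow> (a \<le> p \<and> p < r \<and> r \<le> b \<longrightarrow> (c r - c p) /\<^sub>R (r - p) \<in> V)" for p r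
  have "P a b"
  proof (rule Bolzano)
    show "a \<le> b" using \<open>a < b\<close> by simp
    show "P p r" if "P p x" "P x r" "p \<le> x" "x \<le> r" for p x r
    proof (cases "p = x \<or> x = r")
      case False
      with that have "p < x" "x < r" by auto
      with that quotient_in_convex[of p x r V c] \<open>convex V\<close> show ?thesis
        unfolding P_def by (meson less_imp_le order_trans)
    qed (use that in auto)
    fix x assume x: "a \<le> x" "x \<le> b"
    then have "\<forall>\<^sub>F s in at x within {a..b}. (c s - c x) /\<^sub>R (s - x) \<in> V"
      using d[of x] V[of x] \<open>open V\<close> unfolding has_curve_deriv_def
      by (intro topological_tendstoD) auto
    then obtain e where e: "e > 0" "\<And>s. s \<in> {a..b} \<Longrightarrow> s \<noteq> x \<Longrightarrow> dist s x < e \<Longrightarrow> (c s - c x) /\<^sub>R (s - x) \<in> V"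
      unfolding eventually_at by blast
    have "P p r" if pr: "p \<le> x" "x \<le> r" "r - p < e" for p r
      unfolding P_def
    proof (intro impI)
      assume h: "a \<le> p \<and> p < r \<and> r \<le> b"
      \<comment> \<open>A slope is unchanged when its end points are swapped, so the limit at
        \<open>x\<close> also controls intervals that end at \<open>x\<close>.\<close>
      have sw: "(c x - c p) /\<^sub>R (x - p) = (c p - c x) /\<^sub>R (p - x)"
        using scaleR_minus_left[of "inverse (x - p)" "c p - c x"]
        by (metis minus_diff_eq inverse_minus_eq scaleR_minus_left scaleR_minus_right minus_minus)
      have 1: "p < x \<Longrightarrow> (c x - c p) /\<^sub>R (x - p) \<in> V"
        unfolding sw using h pr by (intro e) (auto simp: dist_real_def)
      have 2: "x < r \<Longrightarrow> (c r - c x) /\<^sub>R (r - x) \<in> V"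
        using h pr by (intro e) (auto simp: dist_real_def)
      show "(c r - c p) /\<^sub>R (r - p) \<in> V"
      proof (cases "p = x \<or> x = r")
        case False
        with pr have "p < x" "x < r" by auto
        then show ?thesis using 1 2 quotient_in_convex[of p x r V c] \<open>convex V\<close> by blast
      next
        case True
        with h pr show ?thesis using 1 2 by (metis order_le_less)
      qed
    qed
    then show "\<exists>d>0. \<forall>a b. a \<le> x \<and> x \<le> b \<and> b - a < d \<longrightarrow> P a b"
      using \<open>e > 0\<close> by blast
  qed
  then show ?thesis using \<open>a < b\<close> unfolding P_def by simp
qed

section \<open>Directional derivatives\<close>

lemma has_dir_deriv_iff_curve:
  "has_dir_deriv f D x v \<longleftrightarrow> has_curve_deriv (\<lambda>s. f (x + s *\<^sub>R v)) D 0 UNIV"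
  unfolding has_dir_deriv_def has_curve_deriv_def by simp

lemma has_dir_deriv_unique:
  "has_dir_deriv f D x v \<Longrightarrow> has_dir_deriv f D' x v \<Longrightarrow> D = D'"
  unfolding has_dir_deriv_def by (rule tendsto_unique[rotated]) auto

lemma dir_deriv_eq: "has_dir_deriv f D x v \<Longrightarrow> dir_deriv f x v = D"
  unfolding has_dir_deriv_def dir_deriv_def by (rule tendsto_Lim[rotated]) auto

lemma eventually_line_in_open:
  fixes x :: "'e::locally_convex_space"
  assumes "open U" "x \<in> U"
  shows "\<forall>\<^sub>F s in at (0::real). x + s *\<^sub>R v \<in> U"
proof -
  have "((\<lambda>s. x + s *\<^sub>R v) \<longlongrightarrow> x + 0 *\<^sub>R v) (at (0::real))"
    by (intro tendsto_add_lcs tendsto_const tendsto_scaleR_lcs tendsto_ident_at)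
  then show ?thesis using assms by (auto dest: topological_tendstoD)
qed

lemma has_dir_deriv_cong:
  assumes "open U" "x \<in> U" "\<And>y. y \<in> U \<Longrightarrow> f y = g y"
  shows "has_dir_deriv f D x v \<longleftrightarrow> has_dir_deriv g D x v"
  unfolding has_dir_deriv_def
  by (rule tendsto_cong, rule eventually_mono[OF eventually_line_in_open[OF assms(1,2), of v]])
    (use assms in auto)

lemma dir_deriv_cong:
  assumes "open U" "x \<in> U" "\<And>y. y \<in> U \<Longrightarrow> f y = g y"
  shows "dir_deriv f x v = dir_deriv g x v"
proof -
  have "\<forall>\<^sub>F s in at 0. (f (x + s *\<^sub>R v) - f x) /\<^sub>R s = (g (x + s *\<^sub>R v) - g x) /\<^sub>R s"
    by (rule eventually_mono[OF eventually_line_in_open[OF assms(1,2), of v]])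
      (use assms in auto)
  from tendsto_cong[OF this] show ?thesis
    unfolding dir_deriv_def Topological_Spaces.Lim_def by simp
qed

section \<open>Continuously differentiable maps\<close>

definition dd ::
  "('e::locally_convex_space \<Rightarrow> 'f::locally_convex_space) \<Rightarrow> 'e \<times> 'e \<Rightarrow> 'f" where
  "dd f = (\<lambda>(x, v). dir_deriv f x v)"

text \<open>Linearity in the direction is not demanded; it follows in \<open>C1_on_dd_add\<close>
  and \<open>C1_on_dd_scale\<close>. With \<open>dd\<close> as a single map on the product space,
  the derivative is again a map of the same kind and can be differentiated in turn.\<close>

definition C1_on ::
  "'e::locally_convex_space set \<Rightarrow> ('e \<Rightarrow> 'f::locally_convex_space) \<Rightarrow> bool" where
  "C1_on U f \<longleftrightarrow> open U \<and> (\<forall>x\<in>U. \<forall>v. has_dir_deriv f (dd f (x, v)) x v) \<and>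
    continuous_on (U \<times> UNIV) (dd f)"

lemma C1_onI:
  assumes "open U" "\<And>x v. x \<in> U \<Longrightarrow> has_dir_deriv f (f' (x, v)) x v"
    and "continuous_on (U \<times> UNIV) f'"
  shows "C1_on U f"
proof -
  have "dd f z = f' z" if "z \<in> U \<times> UNIV" for z
    using that assms(2) by (auto simp: dd_def dir_deriv_eq)
  then show ?thesis
    unfolding C1_on_def using assms by (auto cong: continuous_on_cong)
qed

lemma C1_on_open: "C1_on U f \<Longrightarrow> open U"
  and C1_on_deriv: "C1_on U f \<Longrightarrow> x \<in> U \<Longrightarrow> has_dir_deriv f (dd f (x, v)) x v"
  and C1_on_cont: "C1_on U f \<Longrightarrow> continuous_on (U \<times> UNIV) (dd f)"
  unfolding C1_on_def by auto

lemma dd_eq: "has_dir_deriv f D x v \<Longrightarrow> dd f (x, v) = D"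
  by (simp add: dd_def dir_deriv_eq)

lemma dd_cong:
  assumes "open U" "x \<in> U" "\<And>y. y \<in> U \<Longrightarrow> f y = g y"
  shows "dd f (x, v) = dd g (x, v)"
  unfolding dd_def using dir_deriv_cong[OF assms] by simp

lemma C1_on_cong:
  assumes "\<And>y. y \<in> U \<Longrightarrow> f y = g y" "C1_on U f"
  shows "C1_on U g"
proof (rule C1_onI[where f' = "dd f"])
  show "open U" "continuous_on (U \<times> UNIV) (dd f)" using assms by (auto simp: C1_on_def)
  then show "has_dir_deriv g (dd f (x, v)) x v" if "x \<in> U" for x v
    using has_dir_deriv_cong[of U x f g] that assms C1_on_deriv by blast
qed

lemma C1_on_subset: "C1_on U f \<Longrightarrow> open V \<Longrightarrow> V \<subseteq> U \<Longrightarrow> C1_on V f"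
  unfolding C1_on_def by (auto elim: continuous_on_subset)

lemma C1_on_local:
  assumes "\<And>x. x \<in> U \<Longrightarrow> \<exists>V. x \<in> V \<and> C1_on V f"
  shows "\<exists>W. U \<subseteq> W \<and> C1_on W f"
proof -
  define W where "W = \<Union>{V. C1_on V f}"
  have W: "\<exists>V. x \<in> V \<and> C1_on V f" if "x \<in> W" for x
    using that unfolding W_def by auto
  have "open W" unfolding W_def by (auto simp: C1_on_def)
  moreover have "continuous_on (W \<times> UNIV) (dd f)"
  proof -
    have "W \<times> UNIV = \<Union>((\<lambda>V. V \<times> UNIV) ` {V. C1_on V f})"
      unfolding W_def by auto
    show ?thesis
      unfolding \<open>W \<times> UNIV = _\<close> by (rule continuous_on_open_UN) (auto simp: open_Times C1_on_def)
  qed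
  ultimately have "C1_on W f"
    unfolding C1_on_def using W C1_on_deriv by blast
  moreover have "U \<subseteq> W" using assms unfolding W_def by blast
  ultimately show ?thesis by blast
qed

text \<open>Dividing by \<open>r\<close> makes the increment of this curve over
  \<open>{0..1}\<close> equal to the difference quotient of \<open>f\<close> with step
  \<open>r\<close>, so that \<open>mean_value_convex\<close> speaks about difference
  quotients.\<close>

lemma has_curve_deriv_along_line:
  assumes "has_dir_deriv f D (y + (\<sigma> * r) *\<^sub>R w) w" "r \<noteq> 0"
  shows "has_curve_deriv (\<lambda>\<tau>. f (y + (\<tau> * r) *\<^sub>R w) /\<^sub>R r) D \<sigma> I"
proof -
  let ?z = "y + (\<sigma> * r) *\<^sub>R w"
  have "filterlim (\<lambda>\<tau>. (\<tau> - \<sigma>) * r) (at 0) (at \<sigma> within I)"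
    unfolding filterlim_at using \<open>r \<noteq> 0\<close>
    by (auto intro!: tendsto_eq_intros simp: eventually_at_filter)
  from filterlim_compose[OF assms(1)[unfolded has_dir_deriv_def] this]
  have "((\<lambda>\<tau>. (f (?z + ((\<tau> - \<sigma>) * r) *\<^sub>R w) - f ?z) /\<^sub>R ((\<tau> - \<sigma>) * r)) \<longlongrightarrow> D) (at \<sigma> within I)" .
  moreover have "?z + ((\<tau> - \<sigma>) * r) *\<^sub>R w = y + (\<tau> * r) *\<^sub>R w" for \<tau>
    by (simp add: algebra_simps flip: scaleR_add_left)
  moreover have "(a /\<^sub>R r - b /\<^sub>R r) /\<^sub>R (\<tau> - \<sigma>) = (a - b) /\<^sub>R ((\<tau> - \<sigma>) * r)" for a b :: 'b and \<tau>
    by (simp add: scaleR_right_diff_distrib[symmetric] mult.commute)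
  ultimately show ?thesis
    unfolding has_curve_deriv_def by simp
qed

text \<open>By the mean value theorem \<open>C1_on\<close> implies strict differentiability; the chain rule and the
  linearity of the derivative follow from this.\<close>

lemma C1_on_strict:
  assumes "C1_on U f" "x \<in> U" "(y \<longlongrightarrow> x) F" "(w \<longlongrightarrow> v) F" "(s \<longlongrightarrow> 0) F" "\<forall>\<^sub>F i in F. s i \<noteq> (0::real)"
  shows "((\<lambda>i. (f (y i + s i *\<^sub>R w i) - f (y i)) /\<^sub>R s i) \<longlongrightarrow> dd f (x, v)) F"
proof (rule topological_tendstoI)
  fix S assume "open S" "dd f (x, v) \<in> S"
  then obtain V where V: "open V" "dd f (x, v) \<in> V" "V \<subseteq> S" "convex V"
    by (rule convex_nhd)
  let ?O = "dd f -` V \<inter> (U \<times> UNIV)"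
  have "open ?O"
    using continuous_open_preimage[OF C1_on_cont[OF assms(1)] _ \<open>open V\<close>] C1_on_open[OF assms(1)]
    by (simp add: open_Times Int_commute)
  let ?N = "nhds x \<times>\<^sub>F (nhds v \<times>\<^sub>F nhds (0::real))"
  \<comment> \<open>Continuity of this map at \<open>(x, v, 0)\<close> yields neighbourhoods that
    serve all nearby base points, directions and step lengths at once.\<close>
  have "((\<lambda>(a, b, r). (a + r *\<^sub>R b, b)) \<longlongrightarrow> (x + 0 *\<^sub>R v, v)) ?N"
    unfolding case_prod_beta
  proof (intro tendsto_Pair tendsto_add_lcs tendsto_scaleR_lcs)
    have 1: "filterlim snd (nhds v \<times>\<^sub>F nhds (0::real)) ?N" by (rule filterlim_snd)
    show "(fst \<longlongrightarrow> x) ?N" by (rule filterlim_fst)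
    show "((\<lambda>z. fst (snd z)) \<longlongrightarrow> v) ?N" "((\<lambda>z. fst (snd z)) \<longlongrightarrow> v) ?N"
      by (rule filterlim_compose[OF filterlim_fst 1])+
    show "((\<lambda>z. snd (snd z)) \<longlongrightarrow> 0) ?N" by (rule filterlim_compose[OF filterlim_snd 1])
  qed
  then have "\<forall>\<^sub>F z in ?N. (case z of (a, b, r) \<Rightarrow> (a + r *\<^sub>R b, b)) \<in> ?O"
    using \<open>open ?O\<close> V assms(2) by (intro topological_tendstoD) auto
  then obtain P Q R where PQR: "eventually P (nhds x)" "eventually Q (nhds v)" "eventually R (nhds (0::real))"
    and O: "\<And>a b r. P a \<Longrightarrow> Q b \<Longrightarrow> R r \<Longrightarrow> (a + r *\<^sub>R b, b) \<in> ?O"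
    unfolding eventually_prod_filter by (fastforce simp: eventually_prod_filter)
  obtain e where e: "e > 0" "\<And>r. \<bar>r\<bar> < e \<Longrightarrow> R r"
    using PQR(3) unfolding eventually_nhds_metric by (auto simp: dist_real_def)
  have "\<forall>\<^sub>F i in F. \<bar>s i\<bar> < e"
    using assms(5) \<open>e > 0\<close> unfolding tendsto_iff by (auto simp: dist_real_def)
  moreover have "\<forall>\<^sub>F i in F. P (y i)" "\<forall>\<^sub>F i in F. Q (w i)"
    using PQR assms(3,4) unfolding filterlim_iff by auto
  ultimately show "\<forall>\<^sub>F i in F. (f (y i + s i *\<^sub>R w i) - f (y i)) /\<^sub>R s i \<in> S"
    using assms(6)
  proof eventually_elim
    fix i assume i: "\<bar>s i\<bar> < e" "P (y i)" "Q (w i)" "s i \<noteq> 0"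
    \<comment> \<open>The whole segment is covered, since \<open>\<tau>\<close> only shortens the
      step.\<close>
    have O': "(y i + (\<tau> * s i) *\<^sub>R w i, w i) \<in> ?O" if "\<tau> \<in> {0..1}" for \<tau>
    proof (rule O[OF i(2,3)], rule e(2))
      have "\<bar>\<tau>\<bar> * \<bar>s i\<bar> \<le> 1 * \<bar>s i\<bar>" using that by (intro mult_right_mono) auto
      also have "\<dots> < e" using i by simp
      finally show "\<bar>\<tau> * s i\<bar> < e" by (simp add: abs_mult)
    qed
    have "(f (y i + (1 * s i) *\<^sub>R w i) /\<^sub>R s i - f (y i + (0 * s i) *\<^sub>R w i) /\<^sub>R s i) /\<^sub>R (1 - 0) \<in> V"
    proof (rule mean_value_convex[where c = "\<lambda>\<tau>. f (y i + (\<tau> * s i) *\<^sub>R w i) /\<^sub>R s i"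
          and c' = "\<lambda>\<tau>. dd f (y i + (\<tau> * s i) *\<^sub>R w i, w i)"])
      fix \<tau> :: real assume "\<tau> \<in> {0..1}"
      with O' show "dd f (y i + (\<tau> * s i) *\<^sub>R w i, w i) \<in> V"
        and "has_curve_deriv (\<lambda>\<tau>. f (y i + (\<tau> * s i) *\<^sub>R w i) /\<^sub>R s i)
            (dd f (y i + (\<tau> * s i) *\<^sub>R w i, w i)) \<tau> {0..1}"
        using assms(1) i(4) by (auto intro!: has_curve_deriv_along_line C1_on_deriv)
    qed (use V in auto)
    then show "(f (y i + s i *\<^sub>R w i) - f (y i)) /\<^sub>R s i \<in> S"
      using V(3) by (auto simp: scaleR_right_diff_distrib)
  qed
qed

text \<open>Strict differentiability is used with a moving direction: \<open>c s\<close> is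
  \<open>c t\<close> plus \<open>s - t\<close> times the slope of the curve, and that slope
  converges to \<open>D\<close>.\<close>

lemma C1_on_curve:
  assumes "C1_on U f" "c t \<in> U" "has_curve_deriv c D t I"
  shows "has_curve_deriv (\<lambda>s. f (c s)) (dd f (c t, D)) t I"
proof -
  have "((\<lambda>s. (f (c t + (s - t) *\<^sub>R ((c s - c t) /\<^sub>R (s - t))) - f (c t)) /\<^sub>R (s - t)) \<longlongrightarrow> dd f (c t, D)) (at t within I)"
  proof (rule C1_on_strict[OF assms(1,2) tendsto_const])
    show "((\<lambda>s. s - t) \<longlongrightarrow> 0) (at t within I)"
      by (rule tendsto_eq_intros refl tendsto_ident_at | simp)+
  qed (use assms(3) in \<open>simp_all add: has_curve_deriv_def eventually_at_filter\<close>)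
  moreover have "\<forall>\<^sub>F s in at t within I. (f (c t + (s - t) *\<^sub>R ((c s - c t) /\<^sub>R (s - t))) - f (c t)) /\<^sub>R (s - t)
      = (f (c s) - f (c t)) /\<^sub>R (s - t)"
    by (simp add: eventually_at_filter)
  ultimately show ?thesis unfolding has_curve_deriv_def by (rule Lim_transform_eventually)
qed

lemma C1_on_chain:
  assumes "C1_on U f" "g x \<in> U" "has_dir_deriv g D x v"
  shows "has_dir_deriv (\<lambda>x. f (g x)) (dd f (g x, D)) x v"
  using C1_on_curve[OF assms(1), of "\<lambda>s. g (x + s *\<^sub>R v)" 0 D UNIV] assms
  unfolding has_dir_deriv_iff_curve by simp

text \<open>Directional derivatives alone would not give continuity. Here \<open>dd f\<close> is
  jointly continuous and vanishes at \<open>(x, 0)\<close>, so it stays small along the segment from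
  \<open>x\<close> to a nearby \<open>y\<close> in the direction \<open>y - x\<close>, and the mean
  value theorem bounds \<open>f y - f x\<close>.\<close>

lemma C1_on_continuous:
  assumes "C1_on U f"
  shows "continuous_on U f"
  unfolding continuous_on_def
proof
  fix x assume "x \<in> U"
  have "has_dir_deriv f 0 x 0" by (simp add: has_dir_deriv_def)
  then have dd0: "dd f (x, 0) = 0" by (rule dd_eq)
  have "\<forall>\<^sub>F y in nhds x. f y - f x \<in> V" if V: "open V" "0 \<in> V" "convex V" for V
  proof -
    have "open (dd f -` V \<inter> (U \<times> UNIV))" (is "open ?O")
      using continuous_open_preimage[OF C1_on_cont[OF assms] _ \<open>open V\<close>] C1_on_open[OF assms]
      by (simp add: open_Times Int_commute)
    moreover have "(x, 0) \<in> ?O" using V dd0 \<open>x \<in> U\<close> by simp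
    ultimately obtain A B where AB: "open A" "open B" "x \<in> A" "0 \<in> B" "A \<times> B \<subseteq> ?O"
      by (metis open_prod_elim mem_Times_iff fst_conv snd_conv)
    obtain A' where A': "open A'" "x \<in> A'" "A' \<subseteq> A" "convex A'"
      using convex_nhd[OF AB(1,3)] by blast
    have "\<forall>\<^sub>F y in nhds x. y \<in> A'" using A' eventually_nhds by blast
    moreover have "((\<lambda>y. y - x) \<longlongrightarrow> x - x) (nhds x)"
      by (intro tendsto_diff_lcs filterlim_ident tendsto_const)
    then have "\<forall>\<^sub>F y in nhds x. y - x \<in> B"
      using AB by (auto dest: topological_tendstoD)
    ultimately show ?thesis
    proof eventually_elim
      fix y assume y: "y \<in> A'" "y - x \<in> B"
      have O: "(x + (\<tau> * 1) *\<^sub>R (y - x), y - x) \<in> ?O" if "\<tau> \<in> {0..1}" for \<tau>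
      proof -
        have "(1 - \<tau>) *\<^sub>R x + \<tau> *\<^sub>R y \<in> A'"
          using A' y that by (intro convexD) auto
        then show ?thesis using A'(3) AB(5) y by (auto simp: algebra_simps)
      qed
      have "(f (x + (1 * 1) *\<^sub>R (y - x)) /\<^sub>R 1 - f (x + (0 * 1) *\<^sub>R (y - x)) /\<^sub>R 1) /\<^sub>R (1 - 0) \<in> V"
      proof (rule mean_value_convex[where c = "\<lambda>\<tau>. f (x + (\<tau> * 1) *\<^sub>R (y - x)) /\<^sub>R 1"
            and c' = "\<lambda>\<tau>. dd f (x + (\<tau> * 1) *\<^sub>R (y - x), y - x)"])
        fix \<tau> :: real assume "\<tau> \<in> {0..1}"
        from O[OF this] show "dd f (x + (\<tau> * 1) *\<^sub>R (y - x), y - x) \<in> V"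
          and "has_curve_deriv (\<lambda>\<tau>. f (x + (\<tau> * 1) *\<^sub>R (y - x)) /\<^sub>R 1)
            (dd f (x + (\<tau> * 1) *\<^sub>R (y - x), y - x)) \<tau> {0..1}"
          by (auto intro!: has_curve_deriv_along_line[where r = 1, simplified] C1_on_deriv[OF assms])
      qed (use V in auto)
      then show "f y - f x \<in> V" by simp
    qed
  qed
  then have "((\<lambda>y. f y - f x) \<longlongrightarrow> 0) (nhds x)"
  proof (intro topological_tendstoI)
    fix S assume "open S" "(0::'b) \<in> S"
    then obtain V where "open V" "0 \<in> V" "V \<subseteq> S" "convex V" by (rule convex_nhd)
    then show "\<forall>\<^sub>F y in nhds x. f y - f x \<in> S"
      using \<open>\<And>V. open V \<Longrightarrow> 0 \<in> V \<Longrightarrow> convex V \<Longrightarrow> \<forall>\<^sub>F y in nhds x. f y - f x \<in> V\<close>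
      by (metis (mono_tags, lifting) eventually_mono subsetD)
  qed
  then have "((\<lambda>y. f y - f x + f x) \<longlongrightarrow> 0 + f x) (nhds x)"
    by (intro tendsto_add_lcs tendsto_const)
  then have "(f \<longlongrightarrow> f x) (nhds x)" by simp
  then show "(f \<longlongrightarrow> f x) (at x within U)"
    by (rule filterlim_mono) (auto simp: at_within_def)
qed

lemma C1_on_compose:
  assumes g: "C1_on V g" and f: "C1_on U f" and sub: "f ` U \<subseteq> V"
  shows "C1_on U (\<lambda>x. g (f x))"
proof (rule C1_onI[where f' = "\<lambda>z. dd g (f (fst z), dd f z)"])
  show "open U" using f by (rule C1_on_open)
  show "has_dir_deriv (\<lambda>x. g (f x)) (dd g (f (fst (x, v)), dd f (x, v))) x v" if "x \<in> U" for x v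
    using C1_on_chain[OF g _ C1_on_deriv[OF f that]] that sub by auto
  show "continuous_on (U \<times> UNIV) (\<lambda>z. dd g (f (fst z), dd f z))"
    by (rule continuous_on_compose2[OF C1_on_cont[OF g]])
      (use sub in \<open>auto intro!: continuous_on_Pair continuous_on_compose2[OF C1_on_continuous[OF f]]
        continuous_on_fst continuous_on_id C1_on_cont[OF f]\<close>)
qed

lemma dd_compose:
  assumes g: "C1_on V g" and f: "C1_on U f" and "x \<in> U" "f x \<in> V"
  shows "dd (\<lambda>x. g (f x)) (x, v) = dd g (f x, dd f (x, v))"
  by (rule dd_eq, rule C1_on_chain[OF g]) (use assms C1_on_deriv[OF f] in auto)

lemma has_dir_deriv_Pair:
  assumes "has_dir_deriv f D x v" "has_dir_deriv g E x v"
  shows "has_dir_deriv (\<lambda>x. (f x, g x)) (D, E) x v"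
  using tendsto_Pair[OF assms[unfolded has_dir_deriv_def]]
  by (simp add: has_dir_deriv_def scaleR_prod_def)

lemma C1_on_Pair:
  assumes f: "C1_on U f" and g: "C1_on U g"
  shows "C1_on U (\<lambda>x. (f x, g x))"
  by (rule C1_onI[where f' = "\<lambda>z. (dd f z, dd g z)"])
    (auto intro!: has_dir_deriv_Pair C1_on_deriv[OF f] C1_on_deriv[OF g] continuous_on_Pair
      C1_on_cont[OF f] C1_on_cont[OF g] C1_on_open[OF f])

lemma dd_Pair:
  assumes f: "C1_on U f" and g: "C1_on U g" and "x \<in> U"
  shows "dd (\<lambda>x. (f x, g x)) (x, v) = (dd f (x, v), dd g (x, v))"
  by (rule dd_eq) (auto intro!: has_dir_deriv_Pair C1_on_deriv[OF f] C1_on_deriv[OF g] assms)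

section \<open>Linear maps, sums and partial derivatives\<close>

definition continuous_linear ::
  "('e::locally_convex_space \<Rightarrow> 'f::locally_convex_space) \<Rightarrow> bool" where
  "continuous_linear L \<longleftrightarrow> linear L \<and> continuous_on UNIV L"

lemma continuous_linear_fst: "continuous_linear fst"
  and continuous_linear_snd: "continuous_linear snd"
  and continuous_linear_id: "continuous_linear (\<lambda>x. x)"
  and continuous_linear_zero: "continuous_linear (\<lambda>x. 0)"
  unfolding continuous_linear_def
  by (auto intro!: linearI continuous_on_fst continuous_on_snd continuous_on_id)

lemma continuous_linear_Pair:
  "continuous_linear L \<Longrightarrow> continuous_linear K \<Longrightarrow> continuous_linear (\<lambda>x. (L x, K x))"
  unfolding continuous_linear_def
  by (auto intro!: linearI continuous_on_Pair simp: linear_add linear_scale)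

lemma continuous_linear_compose:
  "continuous_linear L \<Longrightarrow> continuous_linear K \<Longrightarrow> continuous_linear (\<lambda>x. L (K x))"
  unfolding continuous_linear_def
  by (auto intro!: linearI continuous_on_compose2[of UNIV L] simp: linear_add linear_scale)

lemma continuous_linear_plus:
  "continuous_linear (\<lambda>z::'e::locally_convex_space \<times> 'e. fst z + snd z)"
  unfolding continuous_linear_def
  by (auto intro!: linearI continuous_on_add_lcs continuous_on_fst continuous_on_snd continuous_on_id
      simp: scaleR_right_distrib)

lemmas continuous_linear_intros =
  continuous_linear_fst continuous_linear_snd continuous_linear_id continuous_linear_zero
  continuous_linear_Pair continuous_linear_compose[OF continuous_linear_fst]
  continuous_linear_compose[OF continuous_linear_snd]

lemma has_dir_deriv_linear:
  assumes "linear L"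
  shows "has_dir_deriv L (L v) x v"
proof -
  have "\<forall>\<^sub>F s in at 0. L v = (L (x + s *\<^sub>R v) - L x) /\<^sub>R s"
    using assms by (auto simp: linear_add linear_scale eventually_at_filter)
  then show ?thesis
    unfolding has_dir_deriv_def by (rule Lim_transform_eventually[OF tendsto_const])
qed

lemma dd_linear: "linear L \<Longrightarrow> dd L (x, v) = L v"
  by (rule dd_eq) (rule has_dir_deriv_linear)

lemma dd_linear_fun: "linear L \<Longrightarrow> dd L = (\<lambda>z. L (snd z))"
  by (auto simp: dd_linear)

lemma C1_on_linear:
  assumes "continuous_linear L" "open U"
  shows "C1_on U L"
  using assms unfolding continuous_linear_def
  by (intro C1_onI[where f' = "\<lambda>z. L (snd z)"])
    (auto intro!: has_dir_deriv_linear continuous_on_compose2[of UNIV L] continuous_on_snd continuous_on_id)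

lemma has_dir_deriv_const: "has_dir_deriv (\<lambda>x. c) 0 x v"
  unfolding has_dir_deriv_def by simp

lemma dd_const: "dd (\<lambda>x. c) = (\<lambda>z. 0)"
  by (auto simp: dd_eq[OF has_dir_deriv_const])

lemma C1_on_const: "open U \<Longrightarrow> C1_on U (\<lambda>x. c)"
  by (rule C1_onI[where f' = "\<lambda>z. 0"]) (auto intro: has_dir_deriv_const)

lemma has_dir_deriv_add:
  assumes "has_dir_deriv f D x v" "has_dir_deriv g E x v"
  shows "has_dir_deriv (\<lambda>x. f x + g x) (D + E) x v"
proof -
  have "(f (x + s *\<^sub>R v) + g (x + s *\<^sub>R v) - (f x + g x)) /\<^sub>R s
      = (f (x + s *\<^sub>R v) - f x) /\<^sub>R s + (g (x + s *\<^sub>R v) - g x) /\<^sub>R s" for s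
    by (simp add: algebra_simps)
  then show ?thesis
    using tendsto_add_lcs[OF assms[unfolded has_dir_deriv_def]] by (simp add: has_dir_deriv_def)
qed

lemma has_dir_deriv_scaleR:
  assumes "has_dir_deriv f D x v"
  shows "has_dir_deriv (\<lambda>x. r *\<^sub>R f x) (r *\<^sub>R D) x v"
proof -
  have "(r *\<^sub>R f (x + s *\<^sub>R v) - r *\<^sub>R f x) /\<^sub>R s = r *\<^sub>R ((f (x + s *\<^sub>R v) - f x) /\<^sub>R s)" for s
    by (simp add: scaleR_right_diff_distrib[symmetric] mult.commute)
  then show ?thesis
    using tendsto_scaleR_lcs[OF tendsto_const assms[unfolded has_dir_deriv_def]]
    by (simp add: has_dir_deriv_def)
qed

lemma has_dir_deriv_diff:
  assumes "has_dir_deriv f D x v" "has_dir_deriv g E x v"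
  shows "has_dir_deriv (\<lambda>x. f x - g x) (D - E) x v"
  using has_dir_deriv_add[OF assms(1) has_dir_deriv_scaleR[OF assms(2), of "- 1"]] by simp

lemma C1_on_partial1:
  assumes "C1_on U f" "(x, y) \<in> U"
  shows "has_dir_deriv (\<lambda>x. f (x, y)) (dd f ((x, y), (v, 0))) x v"
  by (rule C1_on_chain[OF assms(1), of "\<lambda>x. (x, y)", OF assms(2)],
      rule has_dir_deriv_Pair[OF has_dir_deriv_linear[OF linear_ident] has_dir_deriv_const])

lemma C1_on_partial2:
  assumes "C1_on U f" "(x, y) \<in> U"
  shows "has_dir_deriv (\<lambda>y. f (x, y)) (dd f ((x, y), (0, w))) y w"
  by (rule C1_on_chain[OF assms(1), of "\<lambda>y. (x, y)", OF assms(2)],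
      rule has_dir_deriv_Pair[OF has_dir_deriv_const has_dir_deriv_linear[OF linear_ident]])

lemma has_dir_deriv_shift:
  "has_dir_deriv (\<lambda>x. f (x + a)) D x v \<longleftrightarrow> has_dir_deriv f D (x + a) v"
  unfolding has_dir_deriv_def by (simp add: add.assoc add.commute add.left_commute)

lemma C1_on_add:
  assumes "C1_on U f" "C1_on U g"
  shows "C1_on U (\<lambda>x. f x + g x)"
  using C1_on_compose[OF C1_on_linear[OF continuous_linear_plus open_UNIV] C1_on_Pair[OF assms]] by simp

lemma has_dir_deriv_scale_direction:
  assumes "has_dir_deriv f D x v"
  shows "has_dir_deriv f (r *\<^sub>R D) x (r *\<^sub>R v)"
proof (cases "r = 0")
  case True
  then show ?thesis by (simp add: has_dir_deriv_def)
next
  case False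
  have "filterlim (\<lambda>s. s * r) (at 0) (at 0)"
    unfolding filterlim_at using False
    by (auto intro!: tendsto_eq_intros simp: eventually_at_filter)
  from tendsto_scaleR_lcs[OF tendsto_const filterlim_compose[OF assms[unfolded has_dir_deriv_def] this], of r]
  have "((\<lambda>s. r *\<^sub>R ((f (x + (s * r) *\<^sub>R v) - f x) /\<^sub>R (s * r))) \<longlongrightarrow> r *\<^sub>R D) (at 0)" .
  moreover have "r *\<^sub>R ((f (x + (s * r) *\<^sub>R v) - f x) /\<^sub>R (s * r)) = (f (x + s *\<^sub>R r *\<^sub>R v) - f x) /\<^sub>R s" for s
    using False by simp
  ultimately show ?thesis unfolding has_dir_deriv_def by (simp only:)
qed

text \<open>The increment along \<open>v + w\<close> is split at \<open>x + s *\<^sub>R v\<close>.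
  The second piece is a difference quotient with a moving base point, which is where strict
  differentiability enters.\<close>

lemma C1_on_dd_add:
  assumes f: "C1_on U f" and x: "x \<in> U"
  shows "dd f (x, v + w) = dd f (x, v) + dd f (x, w)"
proof -
  have "((\<lambda>s. (f ((x + s *\<^sub>R v) + s *\<^sub>R w) - f (x + s *\<^sub>R v)) /\<^sub>R s) \<longlongrightarrow> dd f (x, w)) (at 0)"
  proof (rule C1_on_strict[OF f x _ tendsto_const tendsto_ident_at])
    have "((\<lambda>s. x + s *\<^sub>R v) \<longlongrightarrow> x + 0 *\<^sub>R v) (at (0::real))"
      by (intro tendsto_add_lcs tendsto_scaleR_lcs tendsto_const tendsto_ident_at)
    then show "((\<lambda>s. x + s *\<^sub>R v) \<longlongrightarrow> x) (at (0::real))" by simp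
  qed (simp add: eventually_at_filter)
  from tendsto_add_lcs[OF C1_on_deriv[OF f x, of v, unfolded has_dir_deriv_def] this]
  have "((\<lambda>s. (f (x + s *\<^sub>R (v + w)) - f x) /\<^sub>R s) \<longlongrightarrow> dd f (x, v) + dd f (x, w)) (at 0)"
    by (simp add: algebra_simps)
  then show ?thesis
    using dd_eq unfolding has_dir_deriv_def[symmetric] by blast
qed

lemma C1_on_dd_scale:
  assumes f: "C1_on U f" and x: "x \<in> U"
  shows "dd f (x, r *\<^sub>R v) = r *\<^sub>R dd f (x, v)"
  by (rule dd_eq, rule has_dir_deriv_scale_direction, rule C1_on_deriv[OF f x])

lemma C1_on_dd_linear: "C1_on U f \<Longrightarrow> x \<in> U \<Longrightarrow> linear (\<lambda>v. dd f (x, v))"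
  by (auto intro!: linearI C1_on_dd_add C1_on_dd_scale)

text \<open>Leibniz rule: in a slot where the map is linear, it is its own derivative.\<close>

lemma dd_linear_second:
  assumes F: "C1_on (U \<times> UNIV) F" and x: "x \<in> U" and lin: "linear (\<lambda>v. F (x, v))"
  shows "dd F ((x, v), (y, z)) = dd F ((x, v), (y, 0)) + F (x, z)"
proof -
  have xU: "(x, v) \<in> U \<times> UNIV" using x by simp
  have "dd F ((x, v), (0, z)) = F (x, z)"
    by (rule has_dir_deriv_unique[OF C1_on_partial2[OF F xU] has_dir_deriv_linear[OF lin]])
  then show ?thesis using C1_on_dd_add[OF F xU, of "(y, 0)" "(0, z)"] by simp
qed

lemma C1_on_locally:
  assumes "open U" "\<And>x. x \<in> U \<Longrightarrow> \<exists>V. x \<in> V \<and> C1_on V f"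
  shows "C1_on U f"
  using C1_on_local[of U f] assms C1_on_subset by blast

section \<open>Maps of class two and three\<close>

definition C2_on ::
  "'e::locally_convex_space set \<Rightarrow> ('e \<Rightarrow> 'f::locally_convex_space) \<Rightarrow> bool" where
  "C2_on U f \<longleftrightarrow> C1_on U f \<and> C1_on (U \<times> UNIV) (dd f)"

definition C3_on ::
  "'e::locally_convex_space set \<Rightarrow> ('e \<Rightarrow> 'f::locally_convex_space) \<Rightarrow> bool" where
  "C3_on U f \<longleftrightarrow> C1_on U f \<and> C2_on (U \<times> UNIV) (dd f)"

lemma C2_on_C1: "C2_on U f \<Longrightarrow> C1_on U f"
  and C3_on_C2: "C3_on U f \<Longrightarrow> C2_on U f"
  and C3_on_C1: "C3_on U f \<Longrightarrow> C1_on U f"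
  and C2_on_dd: "C2_on U f \<Longrightarrow> C1_on (U \<times> UNIV) (dd f)"
  and C3_on_dd: "C3_on U f \<Longrightarrow> C2_on (U \<times> UNIV) (dd f)"
  unfolding C2_on_def C3_on_def by auto

lemma C2_on_cong:
  assumes "\<And>y. y \<in> U \<Longrightarrow> f y = g y" "C2_on U f"
  shows "C2_on U g"
proof -
  have "open U" using assms by (auto simp: C2_on_def C1_on_def)
  then have "dd f z = dd g z" if "z \<in> U \<times> UNIV" for z
    using that dd_cong[of U _ f g] assms(1) by auto
  then show ?thesis
    using assms C1_on_cong[of U f g] C1_on_cong[of "U \<times> UNIV" "dd f" "dd g"] by (simp add: C2_on_def)
qed

lemma C3_on_cong:
  assumes "\<And>y. y \<in> U \<Longrightarrow> f y = g y" "C3_on U f"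
  shows "C3_on U g"
proof -
  have "open U" using assms by (auto simp: C3_on_def C1_on_def)
  then have "dd f z = dd g z" if "z \<in> U \<times> UNIV" for z
    using that dd_cong[of U _ f g] assms(1) by auto
  then show ?thesis
    using assms C1_on_cong[of U f g] C2_on_cong[of "U \<times> UNIV" "dd f" "dd g"] by (simp add: C3_on_def)
qed

lemma C2_on_subset: "C2_on U f \<Longrightarrow> open V \<Longrightarrow> V \<subseteq> U \<Longrightarrow> C2_on V f"
  unfolding C2_on_def by (auto intro: C1_on_subset open_Times)

lemma C3_on_subset: "C3_on U f \<Longrightarrow> open V \<Longrightarrow> V \<subseteq> U \<Longrightarrow> C3_on V f"
  unfolding C3_on_def by (auto intro: C1_on_subset C2_on_subset open_Times)

lemma C2_on_locally:
  assumes "open U" "\<And>x. x \<in> U \<Longrightarrow> \<exists>V. x \<in> V \<and> C2_on V f"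
  shows "C2_on U f"
  unfolding C2_on_def
proof
  show "C1_on U f" using assms C2_on_C1 by (meson C1_on_locally)
  show "C1_on (U \<times> UNIV) (dd f)"
  proof (rule C1_on_locally)
    show "\<exists>V. z \<in> V \<and> C1_on V (dd f)" if "z \<in> U \<times> UNIV" for z
      using assms(2)[of "fst z"] that C2_on_dd by (metis SigmaE SigmaI UNIV_I fst_conv)
  qed (simp add: assms open_Times)
qed

lemma C3_on_locally:
  assumes "open U" "\<And>x. x \<in> U \<Longrightarrow> \<exists>V. x \<in> V \<and> C3_on V f"
  shows "C3_on U f"
  unfolding C3_on_def
proof
  show "C1_on U f" using assms C3_on_C1 by (meson C1_on_locally)
  show "C2_on (U \<times> UNIV) (dd f)"
  proof (rule C2_on_locally)
    show "\<exists>V. z \<in> V \<and> C2_on V (dd f)" if "z \<in> U \<times> UNIV" for z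
      using assms(2)[of "fst z"] that C3_on_dd by (metis SigmaE SigmaI UNIV_I fst_conv)
  qed (simp add: assms open_Times)
qed

lemma C1_on_fst: "C1_on U f \<Longrightarrow> C1_on (U \<times> UNIV) (\<lambda>z. f (fst z))"
  by (rule C1_on_compose[of U f])
    (auto intro!: C1_on_linear continuous_linear_fst open_Times dest: C1_on_open)

lemma C2_on_linear:
  fixes L :: "'e::locally_convex_space \<Rightarrow> 'f::locally_convex_space"
  assumes L: "continuous_linear L" and "open U"
  shows "C2_on U L"
proof -
  have *: "continuous_linear (\<lambda>z::'e \<times> 'e. L (snd z))"
    by (rule continuous_linear_compose[OF L continuous_linear_snd])
  have "dd L = (\<lambda>z. L (snd z))"
    using L by (simp add: continuous_linear_def dd_linear_fun)
  then show ?thesis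
    unfolding C2_on_def using C1_on_linear[OF L \<open>open U\<close>] C1_on_linear[OF *]
    by (simp add: open_Times \<open>open U\<close>)
qed

lemma C3_on_linear:
  fixes L :: "'e::locally_convex_space \<Rightarrow> 'f::locally_convex_space"
  assumes L: "continuous_linear L" and "open U"
  shows "C3_on U L"
proof -
  have *: "continuous_linear (\<lambda>z::'e \<times> 'e. L (snd z))"
    by (rule continuous_linear_compose[OF L continuous_linear_snd])
  have "dd L = (\<lambda>z. L (snd z))"
    using L by (simp add: continuous_linear_def dd_linear_fun)
  then show ?thesis
    unfolding C3_on_def using C1_on_linear[OF L \<open>open U\<close>] C2_on_linear[OF *]
    by (simp add: open_Times \<open>open U\<close>)
qed

lemma C2_on_const: "open U \<Longrightarrow> C2_on U (\<lambda>x. c)"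
  unfolding C2_on_def by (simp add: dd_const C1_on_const open_Times)

lemma C3_on_const: "open U \<Longrightarrow> C3_on U (\<lambda>x. c)"
  unfolding C3_on_def by (simp add: dd_const C1_on_const C2_on_const open_Times)

lemma C2_on_Pair:
  assumes "C2_on U f" "C2_on U g"
  shows "C2_on U (\<lambda>x. (f x, g x))"
  unfolding C2_on_def
proof
  show "C1_on U (\<lambda>x. (f x, g x))" using assms by (auto simp: C2_on_def intro: C1_on_Pair)
  show "C1_on (U \<times> UNIV) (dd (\<lambda>x. (f x, g x)))"
    by (rule C1_on_cong[OF _ C1_on_Pair[OF C2_on_dd[OF assms(1)] C2_on_dd[OF assms(2)]]])
      (auto simp: dd_Pair[OF C2_on_C1[OF assms(1)] C2_on_C1[OF assms(2)]])
qed

lemma C3_on_Pair: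
  assumes "C3_on U f" "C3_on U g"
  shows "C3_on U (\<lambda>x. (f x, g x))"
  unfolding C3_on_def
proof
  show "C1_on U (\<lambda>x. (f x, g x))" using assms by (auto simp: C3_on_def intro: C1_on_Pair)
  show "C2_on (U \<times> UNIV) (dd (\<lambda>x. (f x, g x)))"
    by (rule C2_on_cong[OF _ C2_on_Pair[OF C3_on_dd[OF assms(1)] C3_on_dd[OF assms(2)]]])
      (auto simp: dd_Pair[OF C3_on_C1[OF assms(1)] C3_on_C1[OF assms(2)]])
qed

text \<open>The derivative of a composite is \<open>dd g\<close> after the tangent map of
  \<open>f\<close>, hence again a composite, to which the chain rule one order lower
  applies.\<close>

lemma C2_on_compose:
  assumes g: "C2_on V g" and f: "C2_on U f" and sub: "f ` U \<subseteq> V"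
  shows "C2_on U (\<lambda>x. g (f x))"
  unfolding C2_on_def
proof
  note C1 = C2_on_C1[OF g] C2_on_C1[OF f]
  show "C1_on U (\<lambda>x. g (f x))" by (rule C1_on_compose[OF C1 sub])
  have "C1_on (U \<times> UNIV) (\<lambda>z. dd g (f (fst z), dd f z))"
    by (rule C1_on_compose[OF C2_on_dd[OF g] C1_on_Pair[OF C1_on_fst[OF C1(2)] C2_on_dd[OF f]]])
      (use sub in auto)
  then show "C1_on (U \<times> UNIV) (dd (\<lambda>x. g (f x)))"
    by (rule C1_on_cong[rotated]) (use sub in \<open>auto simp: dd_compose[OF C1]\<close>)
qed

lemma C2_on_fst: "C2_on U f \<Longrightarrow> C2_on (U \<times> UNIV) (\<lambda>z. f (fst z))"
  by (rule C2_on_compose[of U f])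
    (auto intro!: C2_on_linear continuous_linear_fst open_Times dest: C2_on_C1 C1_on_open)

lemma C3_on_compose:
  assumes g: "C3_on V g" and f: "C3_on U f" and sub: "f ` U \<subseteq> V"
  shows "C3_on U (\<lambda>x. g (f x))"
  unfolding C3_on_def
proof
  note C1 = C3_on_C1[OF g] C3_on_C1[OF f]
  show "C1_on U (\<lambda>x. g (f x))" by (rule C1_on_compose[OF C1 sub])
  have "C2_on (U \<times> UNIV) (\<lambda>z. dd g (f (fst z), dd f z))"
    by (rule C2_on_compose[OF C3_on_dd[OF g] C2_on_Pair[OF C2_on_fst[OF C3_on_C2[OF f]] C3_on_dd[OF f]]])
      (use sub in auto)
  then show "C2_on (U \<times> UNIV) (dd (\<lambda>x. g (f x)))"
    by (rule C2_on_cong[rotated]) (use sub in \<open>auto simp: dd_compose[OF C1]\<close>)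
qed

text \<open>Both mixed derivatives are the limit of the symmetric second difference quotient.\<close>

lemma second_difference_tendsto:
  fixes f :: "'e::locally_convex_space \<Rightarrow> 'f::locally_convex_space"
  assumes f: "C2_on U f" and x: "x \<in> U"
  shows "((\<lambda>s::real. ((f (x + s *\<^sub>R v + s *\<^sub>R w) - f (x + s *\<^sub>R v)) /\<^sub>R s - (f (x + s *\<^sub>R w) - f x) /\<^sub>R s) /\<^sub>R s)
    \<longlongrightarrow> dd (dd f) ((x, v), (w, 0))) (at 0)"
proof (rule topological_tendstoI)
  note f1 = C2_on_C1[OF f] and f2 = C2_on_dd[OF f]
  let ?H = "\<lambda>y. dd (dd f) ((y, v), (w, 0))"
  fix S assume "open S" "?H x \<in> S"
  then obtain V where V: "open V" "?H x \<in> V" "V \<subseteq> S" "convex V"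
    by (rule convex_nhd)
  have U: "open U" using f1 by (rule C1_on_open)
  have "continuous_on U ?H"
    by (rule continuous_on_compose2[OF C1_on_cont[OF f2]])
      (auto intro!: continuous_on_Pair continuous_on_id continuous_on_const)
  then have "open (U \<inter> ?H -` V)" using continuous_open_preimage U V by blast
  then obtain A where A: "open A" "x \<in> A" "A \<subseteq> U \<inter> ?H -` V" "convex A"
    using convex_nhd[of "U \<inter> ?H -` V" x] V x by blast
  have "\<forall>\<^sub>F s in at (0::real). x + s *\<^sub>R v \<in> A" "\<forall>\<^sub>F s in at (0::real). x + s *\<^sub>R w \<in> A"
    "\<forall>\<^sub>F s in at (0::real). x + s *\<^sub>R (v + w) \<in> A"
    by (intro eventually_line_in_open A)+
  moreover have "\<forall>\<^sub>F s in at (0::real). s \<noteq> 0" by (simp add: eventually_at_filter)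
  ultimately show "\<forall>\<^sub>F s in at (0::real).
      ((f (x + s *\<^sub>R v + s *\<^sub>R w) - f (x + s *\<^sub>R v)) /\<^sub>R s - (f (x + s *\<^sub>R w) - f x) /\<^sub>R s) /\<^sub>R s \<in> S"
  proof eventually_elim
    fix s :: real
    assume s: "x + s *\<^sub>R v \<in> A" "x + s *\<^sub>R w \<in> A" "x + s *\<^sub>R (v + w) \<in> A" "s \<noteq> 0"
    have seg: "p + \<tau> *\<^sub>R (q - p) \<in> A" if "p \<in> A" "q \<in> A" "\<tau> \<in> {0..1}" for p q and \<tau> :: real
    proof -
      have "(1 - \<tau>) *\<^sub>R p + \<tau> *\<^sub>R q \<in> A" using A that by (intro convexD) auto
      then show ?thesis by (simp add: algebra_simps)
    qed
    \<comment> \<open>The parallelogram spanned by the two steps stays in \<open>A\<close>: two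
      opposite sides do by convexity, and every other point lies on a segment between them.\<close>
    have a1: "x + (\<tau> * s) *\<^sub>R v \<in> A" if "\<tau> \<in> {0..1}" for \<tau>
      using seg[OF A(2) s(1) that] by simp
    have a2: "x + (\<tau> * s) *\<^sub>R v + s *\<^sub>R w \<in> A" if "\<tau> \<in> {0..1}" for \<tau>
      using seg[OF s(2,3) that] by (simp add: algebra_simps)
    have a3: "x + (\<tau> * s) *\<^sub>R v + (\<sigma> * s) *\<^sub>R w \<in> A" if "\<tau> \<in> {0..1}" "\<sigma> \<in> {0..1}" for \<tau> \<sigma>
      using seg[OF a1[OF that(1)] a2[OF that(1)] that(2)] by simp
    \<comment> \<open>\<open>F\<close> is the difference quotient in direction \<open>w\<close>. The
      mean value theorem is applied to it in direction \<open>v\<close>, and to the derivative that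
      arises once more in direction \<open>w\<close>.\<close>
    define F where "F y = (f (y + s *\<^sub>R w) - f y) /\<^sub>R s" for y
    have inner: "(dd f (y + s *\<^sub>R w, v) - dd f (y, v)) /\<^sub>R s \<in> V"
      if y: "\<And>\<sigma>. \<sigma> \<in> {0..1} \<Longrightarrow> y + (\<sigma> * s) *\<^sub>R w \<in> A" for y
    proof -
      have "(dd f (y + (1 * s) *\<^sub>R w, v) /\<^sub>R s - dd f (y + (0 * s) *\<^sub>R w, v) /\<^sub>R s) /\<^sub>R (1 - 0) \<in> V"
      proof (rule mean_value_convex[where c = "\<lambda>\<sigma>. dd f (y + (\<sigma> * s) *\<^sub>R w, v) /\<^sub>R s"
            and c' = "\<lambda>\<sigma>. ?H (y + (\<sigma> * s) *\<^sub>R w)"])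
        fix \<sigma> :: real assume "\<sigma> \<in> {0..1}"
        from y[OF this] have yA: "y + (\<sigma> * s) *\<^sub>R w \<in> A" .
        then show "?H (y + (\<sigma> * s) *\<^sub>R w) \<in> V" using A by auto
        have "has_dir_deriv (\<lambda>y. dd f (y, v)) (?H z) z w" if "z \<in> U" for z
          using that by (intro C1_on_partial1[OF f2]) simp
        then show "has_curve_deriv (\<lambda>\<sigma>. dd f (y + (\<sigma> * s) *\<^sub>R w, v) /\<^sub>R s)
            (?H (y + (\<sigma> * s) *\<^sub>R w)) \<sigma> {0..1}"
          using yA A(3) s(4) by (intro has_curve_deriv_along_line) auto
      qed (use V in auto)
      then show ?thesis by (simp add: scaleR_right_diff_distrib)
    qed
    have "(F (x + (1 * s) *\<^sub>R v) /\<^sub>R s - F (x + (0 * s) *\<^sub>R v) /\<^sub>R s) /\<^sub>R (1 - 0) \<in> V"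
    proof (rule mean_value_convex[where c = "\<lambda>\<tau>. F (x + (\<tau> * s) *\<^sub>R v) /\<^sub>R s"
          and c' = "\<lambda>\<tau>. (dd f (x + (\<tau> * s) *\<^sub>R v + s *\<^sub>R w, v) - dd f (x + (\<tau> * s) *\<^sub>R v, v)) /\<^sub>R s"])
      fix \<tau> :: real assume t: "\<tau> \<in> {0..1}"
      show "(dd f (x + (\<tau> * s) *\<^sub>R v + s *\<^sub>R w, v) - dd f (x + (\<tau> * s) *\<^sub>R v, v)) /\<^sub>R s \<in> V"
        by (rule inner) (rule a3[OF t])
      have "has_dir_deriv F ((dd f (z + s *\<^sub>R w, v) - dd f (z, v)) /\<^sub>R s) z v"
        if "z \<in> A" "z + s *\<^sub>R w \<in> A" for z
        unfolding F_def using that A(3)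
        by (intro has_dir_deriv_scaleR has_dir_deriv_diff)
          (auto simp: has_dir_deriv_shift intro!: C1_on_deriv[OF f1])
      then show "has_curve_deriv (\<lambda>\<tau>. F (x + (\<tau> * s) *\<^sub>R v) /\<^sub>R s)
          ((dd f (x + (\<tau> * s) *\<^sub>R v + s *\<^sub>R w, v) - dd f (x + (\<tau> * s) *\<^sub>R v, v)) /\<^sub>R s) \<tau> {0..1}"
        using a1[OF t] a2[OF t] s(4) by (intro has_curve_deriv_along_line) auto
    qed (use V in auto)
    then have "(F (x + s *\<^sub>R v) - F x) /\<^sub>R s \<in> V"
      by (simp add: scaleR_right_diff_distrib)
    then show "((f (x + s *\<^sub>R v + s *\<^sub>R w) - f (x + s *\<^sub>R v)) /\<^sub>R s - (f (x + s *\<^sub>R w) - f x) /\<^sub>R s) /\<^sub>R s \<in> S"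
      unfolding F_def using V(3) by auto
  qed
qed

lemma second_derivative_symmetric:
  assumes f: "C2_on U f" and x: "x \<in> U"
  shows "dd (dd f) ((x, v), (w, 0)) = dd (dd f) ((x, w), (v, 0))"
proof (rule tendsto_unique[OF _ second_difference_tendsto[OF f x, of v w]])
  have "((f (x + s *\<^sub>R w + s *\<^sub>R v) - f (x + s *\<^sub>R w)) /\<^sub>R s - (f (x + s *\<^sub>R v) - f x) /\<^sub>R s) /\<^sub>R s
      = ((f (x + s *\<^sub>R v + s *\<^sub>R w) - f (x + s *\<^sub>R v)) /\<^sub>R s - (f (x + s *\<^sub>R w) - f x) /\<^sub>R s) /\<^sub>R s" for s
    by (simp add: algebra_simps)
  with second_difference_tendsto[OF f x, of w v]
  show "((\<lambda>s::real. ((f (x + s *\<^sub>R v + s *\<^sub>R w) - f (x + s *\<^sub>R v)) /\<^sub>R s - (f (x + s *\<^sub>R w) - f x) /\<^sub>R s) /\<^sub>R s)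
    \<longlongrightarrow> dd (dd f) ((x, w), (v, 0))) (at 0)" by simp
qed simp

section \<open>Smooth maps are of class three\<close>

lemma iter_deriv_append:
  "iter_deriv f (vs @ ws) = iter_deriv (iter_deriv f ws) vs"
proof (induction vs)
  case Nil
  show ?case by (intro ext) simp
next
  case (Cons v vs)
  show ?case by (intro ext) (simp add: Cons)
qed

lemma iter_deriv_Nil: "iter_deriv f [] = f"
  by (rule ext) simp

lemma iter_deriv_single: "iter_deriv f [v] = (\<lambda>x. dir_deriv f x v)"
  by (rule ext) (simp add: iter_deriv_Nil)

lemma smooth_on_continuous_iter:
  assumes f: "smooth_on U f"
    and p: "continuous_on S p" "p ` S \<subseteq> U" and \<phi>: "\<And>i. continuous_on S (\<lambda>z. \<phi> z i)"
  shows "continuous_on S (\<lambda>z. iter_deriv f (map (\<phi> z) [0..<n]) (p z))"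
proof -
  have "continuous_on (U \<times> UNIV) (\<lambda>(x, v). iter_deriv f (map v [0..<n]) x)"
    using f unfolding smooth_on_def by blast
  moreover have "continuous_on S (\<lambda>z. (p z, \<phi> z))"
    by (intro continuous_on_Pair p continuous_on_coordinatewise_then_product \<phi>)
  ultimately have "continuous_on S (\<lambda>z. (\<lambda>(x, v). iter_deriv f (map v [0..<n]) x) (p z, \<phi> z))"
    by (rule continuous_on_compose2) (use p in auto)
  then show ?thesis by simp
qed

lemma smooth_on_dir_deriv:
  assumes f: "smooth_on U f"
  shows "smooth_on U (\<lambda>x. dir_deriv f x v)"
proof -
  \<comment> \<open>\<open>iter_deriv\<close> applies the last list entry first, so the extra
    direction goes to the end of the list; in the coding by sequences it becomes entry
    \<open>n\<close>.\<close>
  have *: "iter_deriv (\<lambda>x. dir_deriv f x v) vs = iter_deriv f (vs @ [v])" for vs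
    unfolding iter_deriv_append iter_deriv_single ..
  have "continuous_on (U \<times> UNIV) (\<lambda>z. iter_deriv f (map ((snd z)(n := v)) [0..<Suc n]) (fst z))" for n
  proof (rule smooth_on_continuous_iter[OF f])
    show "continuous_on (U \<times> UNIV) (\<lambda>z. ((snd z)(n := v)) i)" for i
      by (cases "i = n") (auto intro!: continuous_on_compose2[of UNIV "\<lambda>h. h i" _ snd] continuous_on_product_coordinates
        continuous_on_snd continuous_on_id)
  qed (auto intro!: continuous_on_fst continuous_on_id)
  moreover have "map (u(n := v)) [0..<Suc n] = map u [0..<n] @ [v]" for u :: "nat \<Rightarrow> 'a" and n
    by auto
  ultimately have "continuous_on (U \<times> UNIV) (\<lambda>(x, u). iter_deriv f (map u [0..<n] @ [v]) x)" for n
    by (simp add: case_prod_beta)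
  then show ?thesis
    using f unfolding smooth_on_def * by blast
qed

lemma smooth_on_C1_on:
  assumes f: "smooth_on U f"
  shows "C1_on U f"
proof (rule C1_onI[where f' = "dd f"])
  show "open U" using f unfolding smooth_on_def by blast
  have "\<exists>D. has_dir_deriv (iter_deriv f []) D x v" if "x \<in> U" for x v
    using that f unfolding smooth_on_def by blast
  then show "has_dir_deriv f (dd f (x, v)) x v" if "x \<in> U" for x v
    using that dd_eq iter_deriv_Nil by metis
  have "continuous_on (U \<times> UNIV) (\<lambda>z. iter_deriv f (map (\<lambda>i. snd z) [0..<1]) (fst z))"
    by (rule smooth_on_continuous_iter[OF f])
      (auto intro!: continuous_on_fst continuous_on_snd continuous_on_id)
  moreover have "iter_deriv f (map (\<lambda>i. snd z) [0..<1]) (fst z) = dd f z" for z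
    by (simp add: dd_def case_prod_beta iter_deriv_single)
  ultimately show "continuous_on (U \<times> UNIV) (dd f)" by simp
qed

text \<open>By linearity in the second slot, the difference quotient along \<open>(y, w)\<close> is
  the one along \<open>y\<close> at fixed \<open>v\<close>, plus the map at the moved point applied
  to \<open>w\<close>. Continuity in the point for each fixed vector then gives the limit.\<close>

lemma has_dir_deriv_partial_linear:
  assumes U: "open U" "x \<in> U" and lin: "\<And>x. x \<in> U \<Longrightarrow> linear (F x)"
    and D: "has_dir_deriv (\<lambda>x. F x v) D x y" and cont: "continuous_on U (\<lambda>x. F x w)"
  shows "has_dir_deriv (\<lambda>(x, v). F x v) (D + F x w) (x, v) (y, w)"
proof -
  have "((\<lambda>s. x + s *\<^sub>R y) \<longlongrightarrow> x + 0 *\<^sub>R y) (at (0::real))"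
    by (intro tendsto_add_lcs tendsto_scaleR_lcs tendsto_const tendsto_ident_at)
  moreover have "isCont (\<lambda>x. F x w) x"
    using cont U by (simp add: continuous_on_eq_continuous_at)
  ultimately have "((\<lambda>s. F (x + s *\<^sub>R y) w) \<longlongrightarrow> F x w) (at 0)"
    by (auto intro: isCont_tendsto_compose)
  from tendsto_add_lcs[OF D[unfolded has_dir_deriv_def] this]
  have "((\<lambda>s. (F (x + s *\<^sub>R y) v - F x v) /\<^sub>R s + F (x + s *\<^sub>R y) w) \<longlongrightarrow> D + F x w) (at 0)" .
  moreover have "\<forall>\<^sub>F s in at 0. (F (x + s *\<^sub>R y) v - F x v) /\<^sub>R s + F (x + s *\<^sub>R y) w =
      (F (x + s *\<^sub>R y) (v + s *\<^sub>R w) - F x v) /\<^sub>R s"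
  proof -
    have "\<forall>\<^sub>F s in at (0::real). s \<noteq> 0" by (simp add: eventually_at_filter)
    with eventually_line_in_open[OF U] show ?thesis
    proof eventually_elim
      fix s :: real assume "x + s *\<^sub>R y \<in> U" "s \<noteq> 0"
      then show "(F (x + s *\<^sub>R y) v - F x v) /\<^sub>R s + F (x + s *\<^sub>R y) w =
          (F (x + s *\<^sub>R y) (v + s *\<^sub>R w) - F x v) /\<^sub>R s"
        using lin[of "x + s *\<^sub>R y"] by (simp add: linear_add linear_scale algebra_simps)
    qed
  qed
  ultimately show ?thesis
    unfolding has_dir_deriv_def by (simp add: Lim_transform_eventually)
qed

text \<open>\<open>smooth_on\<close> differentiates in fixed directions, whereas
  \<open>dd (dd f)\<close> and its derivative also vary the direction slots. These slots are linear,
  so differentiating in them only produces iterated derivatives of lower order.\<close>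

lemma smooth_on_C3_on:
  fixes f :: "'e::locally_convex_space \<Rightarrow> 'f::locally_convex_space"
  assumes f: "smooth_on U f"
  shows "C3_on U f"
proof -
  note f1 = smooth_on_C1_on[OF f]
  define f2 where "f2 v y x = dir_deriv (\<lambda>x. dir_deriv f x v) x y" for v y x
  define f3 where "f3 v y a x = dir_deriv (f2 v y) x a" for v y a x
  have U: "open U" using f1 by (rule C1_on_open)
  have s1: "smooth_on U (\<lambda>x. dir_deriv f x v)" for v by (rule smooth_on_dir_deriv[OF f])
  have s2: "smooth_on U (f2 v y)" for v y unfolding f2_def by (rule smooth_on_dir_deriv[OF s1])
  have d1: "has_dir_deriv (\<lambda>x. dir_deriv f x v) (f2 v y x) x y" if "x \<in> U" for v y x
    using C1_on_deriv[OF smooth_on_C1_on[OF s1] that] by (simp add: f2_def dd_def)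
  have d2: "has_dir_deriv (f2 v y) (f3 v y a x) x a" if "x \<in> U" for v y a x
    using C1_on_deriv[OF smooth_on_C1_on[OF s2] that] by (simp add: f3_def dd_def)
  have l1: "linear (\<lambda>v. dir_deriv f x v)" if "x \<in> U" for x
    using C1_on_dd_linear[OF f1 that] by (simp add: dd_def)
  have l2: "linear (\<lambda>y. f2 v y x)" if "x \<in> U" for x v
    using C1_on_dd_linear[OF smooth_on_C1_on[OF s1] that] by (simp add: dd_def f2_def)
  \<comment> \<open>Linearity in the earlier direction \<open>v\<close> comes from differentiating
    the linearity of the first derivative.\<close>
  have l2': "linear (\<lambda>v. f2 v y x)" if x: "x \<in> U" for x y
  proof (rule linearI)
    show "f2 (v + w) y x = f2 v y x + f2 w y x" for v w
    proof (rule has_dir_deriv_unique[OF d1[OF x]])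
      show "has_dir_deriv (\<lambda>x. dir_deriv f x (v + w)) (f2 v y x + f2 w y x) x y"
        using has_dir_deriv_add[OF d1[OF x] d1[OF x]]
        by (rule has_dir_deriv_cong[OF U x, THEN iffD1, rotated]) (simp add: l1 linear_add)
    qed
    show "f2 (r *\<^sub>R v) y x = r *\<^sub>R f2 v y x" for r v
    proof (rule has_dir_deriv_unique[OF d1[OF x]])
      show "has_dir_deriv (\<lambda>x. dir_deriv f x (r *\<^sub>R v)) (r *\<^sub>R f2 v y x) x y"
        using has_dir_deriv_scaleR[OF d1[OF x]]
        by (rule has_dir_deriv_cong[OF U x, THEN iffD1, rotated]) (simp add: l1 linear_scale)
    qed
  qed
  have c1: "continuous_on S (\<lambda>z. dir_deriv f (p z) (v z))"
    if "continuous_on S p" "p ` S \<subseteq> U" "continuous_on S v" for S :: "'z::topological_space set" and p v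
    using smooth_on_continuous_iter[OF f that(1,2), of "\<lambda>z i. v z" 1] that
    by (simp add: iter_deriv_Nil)
  have c2: "continuous_on S (\<lambda>z. f2 (v z) (y z) (p z))"
    if "continuous_on S p" "p ` S \<subseteq> U" "continuous_on S v" "continuous_on S y"
    for S :: "'z::topological_space set" and p v y
  proof -
    let ?\<phi> = "\<lambda>z i. if i = (0::nat) then y z else v z"
    have "continuous_on S (\<lambda>z. iter_deriv f (map (?\<phi> z) [0..<2]) (p z))"
    proof (rule smooth_on_continuous_iter[OF f that(1,2)])
      show "continuous_on S (\<lambda>z. ?\<phi> z i)" for i using that by (cases "i = 0") auto
    qed
    moreover have "map (?\<phi> z) [0..<2] = [y z, v z]" for z
      by (simp add: numeral_2_eq_2 upt_rec)
    ultimately show ?thesis by (simp add: f2_def iter_deriv_single)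
  qed
  have c3: "continuous_on S (\<lambda>z. f3 (v z) (y z) (a z) (p z))"
    if "continuous_on S p" "p ` S \<subseteq> U" "continuous_on S v" "continuous_on S y" "continuous_on S a"
    for S :: "'z::topological_space set" and p v y a
  proof -
    let ?\<phi> = "\<lambda>z i. if i = (0::nat) then a z else if i = 1 then y z else v z"
    have *: "continuous_on S (\<lambda>z. iter_deriv f (map (?\<phi> z) [0..<3]) (p z))"
    proof (rule smooth_on_continuous_iter[OF f that(1,2)])
      show "continuous_on S (\<lambda>z. ?\<phi> z i)" for i using that by (cases "i = 0"; cases "i = 1") auto
    qed
    have "map (?\<phi> z) [0..<3] = [a z] @ [y z] @ [v z]" for z
      by (simp add: numeral_3_eq_3 upt_rec)
    moreover have "iter_deriv f ([a z] @ [y z] @ [v z]) = f3 (v z) (y z) (a z)" for z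
      unfolding iter_deriv_append iter_deriv_single f3_def f2_def ..
    ultimately show ?thesis using * by simp
  qed
  have dd_apply: "dd f (x, v) = dir_deriv f x v" for x v by (simp add: dd_def)
  note cont = continuous_on_fst continuous_on_snd continuous_on_id continuous_on_add_lcs
  have dd_eq_f1: "dd f = (\<lambda>(x, v). dir_deriv f x v)" by (simp add: dd_def)
  have D1: "has_dir_deriv (dd f) (f2 v y x + dir_deriv f x w) (x, v) (y, w)" if "x \<in> U" for x v y w
    unfolding dd_eq_f1
    by (rule has_dir_deriv_partial_linear[OF U that l1 d1[OF that]])
      (auto intro!: c1 cont continuous_on_const)
  have C1: "C1_on (U \<times> UNIV) (dd f)"
  proof (rule C1_onI[where f' = "\<lambda>z. f2 (snd (fst z)) (fst (snd z)) (fst (fst z)) + dir_deriv f (fst (fst z)) (snd (snd z))"])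
    show "continuous_on ((U \<times> UNIV) \<times> UNIV)
        (\<lambda>z. f2 (snd (fst z)) (fst (snd z)) (fst (fst z)) + dir_deriv f (fst (fst z)) (snd (snd z)))"
      by (intro cont c1 c2) auto
  qed (use D1 U in \<open>auto simp: open_Times\<close>)
  \<comment> \<open>\<open>?Q\<close> is the genuine second derivative; the rest of
    \<open>dd (dd f)\<close> is \<open>dd f\<close> composed with a linear map.\<close>
  let ?Q = "\<lambda>((x, v), y). f2 v y x"
  have D2: "has_dir_deriv (\<lambda>(x, v). f2 v y x) (f3 v y a x + f2 b y x) (x, v) (a, b)" if "x \<in> U" for x v y a b
    by (rule has_dir_deriv_partial_linear[OF U that l2' d2[OF that]])
      (auto intro!: c2 cont continuous_on_const)
  have D3: "has_dir_deriv ?Q (f3 v y a x + f2 b y x + f2 v c x) ((x, v), y) ((a, b), c)" if "x \<in> U" for x v y a b c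
  proof -
    have "has_dir_deriv (\<lambda>(z, y). f2 (snd z) y (fst z)) (f3 v y a x + f2 b y x + f2 (snd (x, v)) c (fst (x, v)))
        ((x, v), y) ((a, b), c)"
    proof (rule has_dir_deriv_partial_linear[of "U \<times> UNIV"])
      show "has_dir_deriv (\<lambda>z. f2 (snd z) y (fst z)) (f3 v y a x + f2 b y x) (x, v) (a, b)"
        using D2[OF that, of y v a b] by (simp add: case_prod_unfold)
      show "continuous_on (U \<times> UNIV) (\<lambda>z. f2 (snd z) c (fst z))"
        by (intro c2 cont continuous_on_const) auto
    qed (use that U l2 in \<open>auto simp: open_Times\<close>)
    then show ?thesis by (simp add: case_prod_unfold)
  qed
  have C2: "C1_on ((U \<times> UNIV) \<times> UNIV) ?Q"
  proof (rule C1_onI[where f' = "\<lambda>z. f3 (snd (fst (fst z))) (snd (fst z)) (fst (fst (snd z))) (fst (fst (fst z))) +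
        f2 (snd (fst (snd z))) (snd (fst z)) (fst (fst (fst z))) + f2 (snd (fst (fst z))) (snd (snd z)) (fst (fst (fst z)))"])
    show "continuous_on (((U \<times> UNIV) \<times> UNIV) \<times> UNIV)
      (\<lambda>z. f3 (snd (fst (fst z))) (snd (fst z)) (fst (fst (snd z))) (fst (fst (fst z))) +
        f2 (snd (fst (snd z))) (snd (fst z)) (fst (fst (fst z))) + f2 (snd (fst (fst z))) (snd (snd z)) (fst (fst (fst z))))"
      by (intro cont c2 c3) auto
  qed (use D3 U in \<open>auto simp: open_Times\<close>)
  have "C1_on ((U \<times> UNIV) \<times> UNIV) (\<lambda>z. ?Q (fst z, fst (snd z)) + dd f (fst (fst z), snd (snd z)))"
    by (intro C1_on_add C1_on_compose[OF C2] C1_on_compose[OF C1] C1_on_linear continuous_linear_intros)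
      (auto simp: open_Times U)
  then have "C1_on ((U \<times> UNIV) \<times> UNIV) (dd (dd f))"
    by (rule C1_on_cong[rotated]) (auto simp: dd_eq[OF D1] dd_apply)
  then show ?thesis using f1 C1 by (simp add: C3_on_def C2_on_def)
qed

section \<open>Bounded inner products along differentiable maps\<close>

lemma eventually_absorbed:
  fixes V :: "'e::locally_convex_space set"
  assumes "open V" "0 \<in> V"
  shows "\<forall>\<^sub>F r in at_top. x /\<^sub>R (r::real) \<in> V"
proof -
  have "((\<lambda>r::real. x /\<^sub>R r) \<longlongrightarrow> 0 *\<^sub>R x) at_top"
    by (intro tendsto_scaleR_lcs tendsto_const tendsto_inverse_0_at_top filterlim_ident)
  then show ?thesis using assms by (auto dest: topological_tendstoD)
qed

lemma absorbed_mono: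
  fixes V :: "'e::real_vector set"
  assumes "convex V" "0 \<in> V" "x /\<^sub>R r \<in> V" "0 < r" "r \<le> r'"
  shows "x /\<^sub>R r' \<in> V"
proof -
  have "(r / r') *\<^sub>R (x /\<^sub>R r) + (1 - r / r') *\<^sub>R 0 \<in> V"
    using assms by (intro convexD[OF assms(1)]) auto
  then show ?thesis using assms by (simp add: field_simps)
qed

text \<open>Boundedness is restated as an eventual property of the scaling factor, so that finitely
  many conditions combine by conjunction. Convex neighbourhoods make absorption monotone in the
  factor, see \<open>absorbed_mono\<close>.\<close>

lemma vn_boundedI:
  assumes "\<And>V. open V \<Longrightarrow> 0 \<in> V \<Longrightarrow> convex V \<Longrightarrow> \<forall>\<^sub>F r in at_top. \<forall>x\<in>A. x /\<^sub>R (r::real) \<in> V"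
  shows "vn_bounded A"
  unfolding vn_bounded_def
proof (intro allI impI)
  fix V :: "'a set" assume "open V \<and> 0 \<in> V"
  then obtain V' where V': "open V'" "0 \<in> V'" "V' \<subseteq> V" "convex V'" using convex_nhd by blast
  have "\<forall>\<^sub>F r in at_top. (r::real) > 0" by (rule eventually_gt_at_top)
  then have "\<forall>\<^sub>F r in at_top. r > 0 \<and> (\<forall>x\<in>A. x /\<^sub>R (r::real) \<in> V')"
    using assms[OF V'(1,2,4)] by (rule eventually_conj)
  then obtain r :: real where r: "r > 0" "\<forall>x\<in>A. x /\<^sub>R r \<in> V'"
    by (auto dest!: eventually_happens)
  have "x \<in> (\<lambda>x. r *\<^sub>R x) ` V" if "x \<in> A" for x
    using r that V'(3) by (intro image_eqI[of _ _ "x /\<^sub>R r"]) auto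
  then show "\<exists>r>0. A \<subseteq> (\<lambda>x. r *\<^sub>R x) ` V" using r by blast
qed

lemma vn_bounded_eventually:
  assumes "vn_bounded A" "open V" "0 \<in> V" "convex V"
  shows "\<forall>\<^sub>F r in at_top. \<forall>x\<in>A. x /\<^sub>R (r::real) \<in> V"
proof -
  obtain r where r: "r > 0" "A \<subseteq> (\<lambda>x. r *\<^sub>R x) ` V"
    using assms unfolding vn_bounded_def by blast
  then have "x /\<^sub>R r \<in> V" if "x \<in> A" for x using that by auto
  then show ?thesis
    using absorbed_mono[OF assms(4,3)] r(1) by (auto intro!: eventually_mono[OF eventually_ge_at_top[of r]])
qed

lemma vn_bounded_insert: "vn_bounded A \<Longrightarrow> vn_bounded (insert x A)"
  by (rule vn_boundedI) (simp add: eventually_conj eventually_absorbed vn_bounded_eventually)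

text \<open>It suffices to absorb a tail of the sequence, as the finitely many remaining terms are
  absorbed one by one.\<close>

lemma vn_bounded_range:
  assumes "\<And>V. open V \<Longrightarrow> 0 \<in> V \<Longrightarrow> convex V \<Longrightarrow> \<exists>r>0. \<forall>\<^sub>F n in sequentially. X n /\<^sub>R (r::real) \<in> V"
  shows "vn_bounded (range X)"
proof (rule vn_boundedI)
  fix V :: "'a set" assume V: "open V" "0 \<in> V" "convex V"
  obtain r N where r: "r > 0" "\<And>n. n \<ge> N \<Longrightarrow> X n /\<^sub>R r \<in> V"
    using assms[OF V] unfolding eventually_sequentially by blast
  have "\<forall>\<^sub>F r' in at_top. \<forall>n\<in>{..<N}. X n /\<^sub>R (r'::real) \<in> V"
    by (rule eventually_ball_finite) (auto intro: eventually_absorbed V)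
  then show "\<forall>\<^sub>F r' in at_top. \<forall>x\<in>range X. x /\<^sub>R (r'::real) \<in> V"
    using eventually_ge_at_top[of r]
  proof eventually_elim
    fix r' assume "\<forall>n\<in>{..<N}. X n /\<^sub>R r' \<in> V" "r \<le> r'"
    then have "X n /\<^sub>R r' \<in> V" for n
      using absorbed_mono[OF V(3,2) r(2) r(1)] by (cases "n < N") auto
    then show "\<forall>x\<in>range X. x /\<^sub>R r' \<in> V" by auto
  qed
qed

section \<open>Mackey convergence of difference quotients\<close>

lemma has_curve_deriv_scaleR:
  assumes "has_curve_deriv c D t I"
  shows "has_curve_deriv (\<lambda>s. r *\<^sub>R c s) (r *\<^sub>R D) t I"
proof -
  have "(r *\<^sub>R c s - r *\<^sub>R c t) /\<^sub>R (s - t) = r *\<^sub>R ((c s - c t) /\<^sub>R (s - t))" for s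
    by (simp add: scaleR_right_diff_distrib[symmetric] mult.commute)
  then show ?thesis
    using tendsto_scaleR_lcs[OF tendsto_const assms[unfolded has_curve_deriv_def]]
    by (simp add: has_curve_deriv_def)
qed

lemma has_curve_deriv_diff:
  assumes "has_curve_deriv c D t I" "has_curve_deriv d E t I"
  shows "has_curve_deriv (\<lambda>s. c s - d s) (D - E) t I"
proof -
  have "(c s - d s - (c t - d t)) /\<^sub>R (s - t) = (c s - c t) /\<^sub>R (s - t) - (d s - d t) /\<^sub>R (s - t)" for s
    by (simp add: algebra_simps)
  then show ?thesis
    using tendsto_diff_lcs[OF assms[unfolded has_curve_deriv_def]]
    by (simp add: has_curve_deriv_def)
qed

lemma has_curve_deriv_line: "has_curve_deriv (\<lambda>s. s *\<^sub>R v) v t I"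
proof -
  have "\<forall>\<^sub>F s in at t within I. v = (s *\<^sub>R v - t *\<^sub>R v) /\<^sub>R (s - t)"
    by (simp add: eventually_at_filter scaleR_left_diff_distrib[symmetric])
  then show ?thesis
    unfolding has_curve_deriv_def by (rule Lim_transform_eventually[OF tendsto_const])
qed

text \<open>The difference quotients of a \<open>C\<^sup>2\<close> map converge in the sense of Mackey, which is what makes bounded
  (possibly discontinuous) bilinear forms differentiable along it.\<close>

lemma taylor_remainder_bounded:
  assumes F: "C2_on W F" and p: "p \<in> W" and s: "s \<longlonglongrightarrow> 0" "\<And>n. s n \<noteq> (0::real)"
  shows "vn_bounded (range (\<lambda>n. ((F (p + s n *\<^sub>R v) - F p) /\<^sub>R s n - dd F (p, v)) /\<^sub>R s n))"
proof (rule vn_bounded_range)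
  note F1 = C2_on_C1[OF F]
  fix V :: "'b set" assume V: "open V" "0 \<in> V" "convex V"
  \<comment> \<open>The remainder is controlled by the second derivative along \<open>v\<close>: a
    factor \<open>r\<close> that brings \<open>L\<close> into the open set \<open>V\<close> does the
    same for all nearby difference quotients of the first derivative.\<close>
  define L where "L = dd (dd F) ((p, v), (v, 0))"
  have L: "has_dir_deriv (\<lambda>q. dd F (q, v)) L p v"
    unfolding L_def using p by (intro C1_on_partial1[OF C2_on_dd[OF F]]) simp
  obtain r :: real where r: "r > 0" "L /\<^sub>R r \<in> V"
    using eventually_happens[OF eventually_conj[OF eventually_gt_at_top[of 0] eventually_absorbed[OF V(1,2)]]]
    by auto
  have "((\<lambda>\<sigma>. ((dd F (p + \<sigma> *\<^sub>R v, v) - dd F (p, v)) /\<^sub>R \<sigma>) /\<^sub>R r) \<longlongrightarrow> L /\<^sub>R r) (at 0)"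
    using tendsto_scaleR_lcs[OF tendsto_const L[unfolded has_dir_deriv_def], of "inverse r"] .
  then have "\<forall>\<^sub>F \<sigma> in at 0. ((dd F (p + \<sigma> *\<^sub>R v, v) - dd F (p, v)) /\<^sub>R \<sigma>) /\<^sub>R r \<in> V"
    using V r by (auto dest: topological_tendstoD)
  moreover have "\<forall>\<^sub>F \<sigma> in at (0::real). p + \<sigma> *\<^sub>R v \<in> W"
    by (rule eventually_line_in_open[OF C1_on_open[OF F1] p])
  ultimately have "\<forall>\<^sub>F \<sigma> in at 0. p + \<sigma> *\<^sub>R v \<in> W \<and> ((dd F (p + \<sigma> *\<^sub>R v, v) - dd F (p, v)) /\<^sub>R \<sigma>) /\<^sub>R r \<in> V"
    by (rule eventually_conj[rotated])
  then obtain e where e: "e > 0" "\<And>\<sigma>. \<sigma> \<noteq> 0 \<Longrightarrow> \<bar>\<sigma>\<bar> < e \<Longrightarrow> p + \<sigma> *\<^sub>R v \<in> W"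
    "\<And>\<sigma>. \<sigma> \<noteq> 0 \<Longrightarrow> \<bar>\<sigma>\<bar> < e \<Longrightarrow> ((dd F (p + \<sigma> *\<^sub>R v, v) - dd F (p, v)) /\<^sub>R \<sigma>) /\<^sub>R r \<in> V"
    unfolding eventually_at by (auto simp: dist_real_def)
  have "((F (p + \<sigma> *\<^sub>R v) - F p) /\<^sub>R \<sigma> - dd F (p, v)) /\<^sub>R \<sigma> /\<^sub>R r \<in> V" if \<sigma>: "\<sigma> \<noteq> 0" "\<bar>\<sigma>\<bar> < e" for \<sigma>
  proof -
    \<comment> \<open>The increment of \<open>?c\<close> over \<open>{0..1}\<close> is the remainder
      divided by \<open>r\<close>, and \<open>?c'\<close> at \<open>\<tau>\<close> is
      \<open>\<tau>\<close> times an element of \<open>V\<close>, hence in \<open>V\<close> because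
      \<open>0\<close> is.\<close>
    let ?c = "\<lambda>\<tau>. inverse (\<sigma> * r) *\<^sub>R (F (p + (\<tau> * \<sigma>) *\<^sub>R v) /\<^sub>R \<sigma> - \<tau> *\<^sub>R dd F (p, v))"
    let ?c' = "\<lambda>\<tau>. inverse (\<sigma> * r) *\<^sub>R (dd F (p + (\<tau> * \<sigma>) *\<^sub>R v, v) - dd F (p, v))"
    have "(?c 1 - ?c 0) /\<^sub>R (1 - 0) \<in> V"
    proof (rule mean_value_convex)
      fix \<tau> :: real assume \<tau>: "\<tau> \<in> {0..1}"
      have "\<bar>\<tau>\<bar> * \<bar>\<sigma>\<bar> \<le> 1 * \<bar>\<sigma>\<bar>" using \<tau> by (intro mult_right_mono) auto
      also have "\<dots> < e" using \<sigma> by simp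
      finally have small: "\<bar>\<tau> * \<sigma>\<bar> < e" by (simp add: abs_mult)
      have inW: "p + (\<tau> * \<sigma>) *\<^sub>R v \<in> W" using e(2)[OF _ small] p by (cases "\<tau> * \<sigma> = 0") auto
      show "has_curve_deriv ?c (?c' \<tau>) \<tau> {0..1}"
        by (intro has_curve_deriv_scaleR has_curve_deriv_diff has_curve_deriv_along_line
            has_curve_deriv_line C1_on_deriv[OF F1] inW \<sigma>)
      show "?c' \<tau> \<in> V"
      proof (cases "\<tau> = 0")
        case True
        then show ?thesis using V by simp
      next
        case False
        then have "((dd F (p + (\<tau> * \<sigma>) *\<^sub>R v, v) - dd F (p, v)) /\<^sub>R (\<tau> * \<sigma>)) /\<^sub>R r \<in> V"
          using e(3)[OF _ small] \<sigma> by simp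
        then have "\<tau> *\<^sub>R (((dd F (p + (\<tau> * \<sigma>) *\<^sub>R v, v) - dd F (p, v)) /\<^sub>R (\<tau> * \<sigma>)) /\<^sub>R r) + (1 - \<tau>) *\<^sub>R 0 \<in> V"
          using \<tau> V by (intro convexD[OF V(3)]) auto
        moreover have "\<tau> * (inverse r * inverse (\<tau> * \<sigma>)) = inverse (\<sigma> * r)"
          using False by (simp add: field_simps)
        ultimately show ?thesis by (simp only: scaleR_scaleR scaleR_zero_right add_0_right)
      qed
    qed (use V in auto)
    then show ?thesis using \<sigma> r by (simp add: algebra_simps)
  qed
  moreover have "\<forall>\<^sub>F n in sequentially. \<bar>s n\<bar> < e"
    using s(1) e(1) unfolding tendsto_iff by (auto simp: dist_real_def)
  ultimately show "\<exists>r>0. \<forall>\<^sub>F n in sequentially.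
      ((F (p + s n *\<^sub>R v) - F p) /\<^sub>R s n - dd F (p, v)) /\<^sub>R s n /\<^sub>R r \<in> V"
    using r(1) s(2) by (auto elim!: eventually_mono)
qed

text \<open>The limit at \<open>0\<close> is tested on null sequences. Along each of them the second
  order remainders of \<open>F\<close> and \<open>G\<close> form bounded sets, on which
  \<open>ip\<close> has a bound \<open>M\<close>, and expanding the product leaves an error
  proportional to the step.\<close>

lemma bounded_inner_product_has_dir_deriv:
  assumes ip: "bounded_inner_product ip" and F: "C2_on W F" and G: "C2_on W G" and p: "p \<in> W"
  shows "has_dir_deriv (\<lambda>q. ip (F q) (G q)) (ip (dd F (p, v)) (G p) + ip (F p) (dd G (p, v))) p v"
  unfolding has_dir_deriv_def tendsto_at_iff_sequentially
proof (intro allI impI)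
  fix s :: "nat \<Rightarrow> real" assume s: "\<forall>n. s n \<in> UNIV - {0}" "s \<longlonglongrightarrow> 0"
  then have s0: "s n \<noteq> 0" for n by auto
  define a where "a n = ((F (p + s n *\<^sub>R v) - F p) /\<^sub>R s n - dd F (p, v)) /\<^sub>R s n" for n
  define b where "b n = ((G (p + s n *\<^sub>R v) - G p) /\<^sub>R s n - dd G (p, v)) /\<^sub>R s n" for n
  define A where "A = insert (F p) (insert (dd F (p, v)) (range a))"
  define B where "B = insert (G p) (insert (dd G (p, v)) (range b))"
  have "vn_bounded A" "vn_bounded B"
    unfolding A_def B_def a_def b_def
    by (intro vn_bounded_insert taylor_remainder_bounded[OF F p s(2) s0] taylor_remainder_bounded[OF G p s(2) s0])+
  then have "bounded ((\<lambda>(a, b). ip a b) ` (A \<times> B))"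
    using ip unfolding bounded_inner_product_def by blast
  then obtain M where M: "\<And>x y. x \<in> A \<Longrightarrow> y \<in> B \<Longrightarrow> \<bar>ip x y\<bar> \<le> M"
    unfolding bounded_iff by auto
  have bil: "bilinear ip" using ip unfolding bounded_inner_product_def inner_product_def by blast
  have Fs: "F (p + s n *\<^sub>R v) = F p + s n *\<^sub>R dd F (p, v) + (s n * s n) *\<^sub>R a n" for n
    using s0[of n] by (simp add: a_def algebra_simps)
  have Gs: "G (p + s n *\<^sub>R v) = G p + s n *\<^sub>R dd G (p, v) + (s n * s n) *\<^sub>R b n" for n
    using s0[of n] by (simp add: b_def algebra_simps)
  let ?D = "ip (dd F (p, v)) (G p) + ip (F p) (dd G (p, v))"
  let ?q = "\<lambda>n. (ip (F (p + s n *\<^sub>R v)) (G (p + s n *\<^sub>R v)) - ip (F p) (G p)) /\<^sub>R s n"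
  have q: "?q n - ?D = s n * (ip (F p) (b n) + ip (a n) (G p) + ip (dd F (p, v)) (dd G (p, v)) +
      s n * (ip (dd F (p, v)) (b n) + ip (a n) (dd G (p, v))) + s n * s n * ip (a n) (b n))" for n
    unfolding Fs Gs using s0[of n]
    by (simp add: bilinear_ladd[OF bil] bilinear_radd[OF bil] bilinear_lmul[OF bil] bilinear_rmul[OF bil] field_simps)
  have "\<forall>\<^sub>F n in sequentially. \<bar>s n\<bar> < 1"
    using s(2) unfolding tendsto_iff by (auto simp: dist_real_def dest: spec[of _ 1])
  \<comment> \<open>Six values of \<open>ip\<close> occur in the error, each at most
    \<open>M\<close> in absolute value, and the remaining powers of \<open>s n\<close> are at most
    one.\<close>
  then have "\<forall>\<^sub>F n in sequentially. norm (?q n - ?D) \<le> \<bar>s n\<bar> * (6 * M)"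
  proof eventually_elim
    fix n assume s1: "\<bar>s n\<bar> < 1"
    have m: "\<bar>ip (F p) (b n)\<bar> \<le> M" "\<bar>ip (a n) (G p)\<bar> \<le> M" "\<bar>ip (dd F (p, v)) (dd G (p, v))\<bar> \<le> M"
      "\<bar>ip (dd F (p, v)) (b n)\<bar> \<le> M" "\<bar>ip (a n) (dd G (p, v))\<bar> \<le> M" "\<bar>ip (a n) (b n)\<bar> \<le> M"
      by (auto intro!: M simp: A_def B_def)
    have sm: "\<bar>r * x\<bar> \<le> K" if "\<bar>r\<bar> \<le> 1" "\<bar>x\<bar> \<le> K" for r x K :: real
      using mult_mono[OF that] that by (simp add: abs_mult)
    have "\<bar>s n * (ip (dd F (p, v)) (b n) + ip (a n) (dd G (p, v)))\<bar> \<le> 2 * M"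
      using m(4,5) s1 by (intro sm) linarith+
    moreover have "\<bar>s n * s n * ip (a n) (b n)\<bar> \<le> M"
      unfolding mult.assoc using m(6) s1 by (intro sm) linarith+
    ultimately have "\<bar>ip (F p) (b n) + ip (a n) (G p) + ip (dd F (p, v)) (dd G (p, v)) +
        s n * (ip (dd F (p, v)) (b n) + ip (a n) (dd G (p, v))) + s n * s n * ip (a n) (b n)\<bar> \<le> 6 * M"
      using m(1-3) by linarith
    then show "norm (?q n - ?D) \<le> \<bar>s n\<bar> * (6 * M)"
      unfolding q real_norm_def abs_mult[of "s n"] by (intro mult_left_mono) auto
  qed
  moreover have "(\<lambda>n. \<bar>s n\<bar> * (6 * M)) \<longlonglongrightarrow> 0"
    using s(2) by (auto intro!: tendsto_eq_intros)
  ultimately have "(\<lambda>n. ?q n - ?D) \<longlonglongrightarrow> 0" by (rule Lim_null_comparison)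
  then show "((\<lambda>s. (ip (F (p + s *\<^sub>R v)) (G (p + s *\<^sub>R v)) - ip (F p) (G p)) /\<^sub>R s) \<circ> s) \<longlonglongrightarrow> ?D"
    by (simp add: o_def LIM_zero_iff)
qed

section \<open>Manifolds of class three\<close>

text \<open>The domain of a coordinate representative is described from the side of the model space,
  through \<open>chart_inv\<close>. With the identity as \<open>f\<close> it is the domain of a
  transition map, so transitions and maps are handled alike.\<close>

definition rep_dom :: "('m, 'e) chart \<Rightarrow> ('n, 'f) chart \<Rightarrow> ('m \<Rightarrow> 'n) \<Rightarrow> 'e set" where
  "rep_dom c d f = {p \<in> chart_image c. f (chart_inv c p) \<in> chart_dom d}"

definition rep :: "('m, 'e) chart \<Rightarrow> ('n, 'f) chart \<Rightarrow> ('m \<Rightarrow> 'n) \<Rightarrow> 'e \<Rightarrow> 'f" where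
  "rep c d f = (\<lambda>p. coord d (f (chart_inv c p)))"

definition C3_manifold :: "('m, 'e::locally_convex_space) manifold \<Rightarrow> bool" where
  "C3_manifold M \<longleftrightarrow>
    (\<Union>c\<in>atlas M. chart_dom c) = points M \<and>
    (\<forall>c\<in>atlas M. inj_on (coord c) (chart_dom c) \<and> open (chart_image c)) \<and>
    (\<forall>c\<in>atlas M. \<forall>d\<in>atlas M. C3_on (rep_dom c d (\<lambda>x. x)) (rep c d (\<lambda>x. x))) \<and>
    (\<forall>x\<in>points M. chart_at M x \<in> atlas M \<and> x \<in> chart_dom (chart_at M x))"

definition C3_map ::
  "('m, 'e::locally_convex_space) manifold \<Rightarrow> ('n, 'f::locally_convex_space) manifold \<Rightarrow>
    ('m \<Rightarrow> 'n) \<Rightarrow> bool" where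
  "C3_map M N f \<longleftrightarrow> f ` points M \<subseteq> points N \<and>
    (\<forall>c\<in>atlas M. \<forall>d\<in>atlas N. C3_on (rep_dom c d f) (rep c d f))"

lemma C3_manifold_inj: "C3_manifold M \<Longrightarrow> c \<in> atlas M \<Longrightarrow> inj_on (coord c) (chart_dom c)"
  and C3_manifold_open: "C3_manifold M \<Longrightarrow> c \<in> atlas M \<Longrightarrow> open (chart_image c)"
  and C3_manifold_dom: "C3_manifold M \<Longrightarrow> c \<in> atlas M \<Longrightarrow> chart_dom c \<subseteq> points M"
  and C3_manifold_chart_at: "C3_manifold M \<Longrightarrow> x \<in> points M \<Longrightarrow> chart_at M x \<in> atlas M"
  and C3_manifold_in_chart_at: "C3_manifold M \<Longrightarrow> x \<in> points M \<Longrightarrow> x \<in> chart_dom (chart_at M x)"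
  and C3_manifold_transition:
    "C3_manifold M \<Longrightarrow> c \<in> atlas M \<Longrightarrow> d \<in> atlas M \<Longrightarrow> C3_on (rep_dom c d (\<lambda>x. x)) (rep c d (\<lambda>x. x))"
  unfolding C3_manifold_def by blast+

lemma C3_on_open: "C3_on U f \<Longrightarrow> open U"
  by (rule C1_on_open[OF C3_on_C1])

lemma chart_inv_coord: "inj_on (coord c) (chart_dom c) \<Longrightarrow> x \<in> chart_dom c \<Longrightarrow> chart_inv c (coord c x) = x"
  unfolding chart_inv_def by (rule inv_into_f_f)

lemma chart_inv_in_dom: "p \<in> chart_image c \<Longrightarrow> chart_inv c p \<in> chart_dom c"
  unfolding chart_inv_def by (rule inv_into_into)

lemma coord_chart_inv: "p \<in> chart_image c \<Longrightarrow> coord c (chart_inv c p) = p"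
  unfolding chart_inv_def by (rule f_inv_into_f)

lemma rep_dom_image:
  assumes "inj_on (coord c) (chart_dom c)"
  shows "coord c ` {x \<in> chart_dom c. f x \<in> chart_dom d} = rep_dom c d f"
  unfolding rep_dom_def using chart_inv_coord[OF assms] by auto

lemma rep_comp: "coord d \<circ> f \<circ> chart_inv c = rep c d f"
  by (auto simp: rep_def)

lemma tangent_map_in_rep: "tangent_map_in c d f x v = dd (rep c d f) (coord c x, v)"
  unfolding tangent_map_in_def rep_comp dd_def by simp

lemma smooth_manifold_C3:
  assumes "smooth_manifold M"
  shows "C3_manifold M"
proof -
  have "C3_on (rep_dom c d (\<lambda>x. x)) (rep c d (\<lambda>x. x))" if "c \<in> atlas M" "d \<in> atlas M" for c d
  proof -
    have "inj_on (coord c) (chart_dom c)"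
      "smooth_on (coord c ` (chart_dom c \<inter> chart_dom d)) (coord d \<circ> chart_inv c)"
      using assms that unfolding smooth_manifold_def by blast+
    then show ?thesis
      using smooth_on_C3_on rep_dom_image[of c "\<lambda>x. x" d]
      by (simp add: rep_def o_def Int_def)
  qed
  then show ?thesis using assms unfolding smooth_manifold_def C3_manifold_def by simp
qed

lemma smooth_map_C3:
  assumes "C3_manifold M" "smooth_map M N f"
  shows "C3_map M N f"
proof -
  have "C3_on (rep_dom c d f) (rep c d f)" if c: "c \<in> atlas M" and d: "d \<in> atlas N" for c d
  proof -
    have "smooth_on (coord c ` {x \<in> chart_dom c. f x \<in> chart_dom d}) (coord d \<circ> f \<circ> chart_inv c)"
      using assms(2) c d unfolding smooth_map_def by simp
    then show ?thesis
      using smooth_on_C3_on unfolding rep_comp rep_dom_image[OF C3_manifold_inj[OF assms(1) c]] by blast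
  qed
  then show ?thesis using assms(2) unfolding C3_map_def smooth_map_def by simp
qed

lemma C3_map_points: "C3_map M N f \<Longrightarrow> x \<in> points M \<Longrightarrow> f x \<in> points N"
  and C3_map_rep: "C3_map M N f \<Longrightarrow> c \<in> atlas M \<Longrightarrow> d \<in> atlas N \<Longrightarrow> C3_on (rep_dom c d f) (rep c d f)"
  unfolding C3_map_def by blast+

lemma C3_map_cong:
  fixes N :: "('c, 'd::locally_convex_space) manifold"
  assumes "C3_manifold M" "C3_map M N f" "\<And>x. x \<in> points M \<Longrightarrow> f x = g x"
  shows "C3_map M N g"
proof -
  have "g (chart_inv c p) = f (chart_inv c p)" if "c \<in> atlas M" "p \<in> chart_image c" for c p
    using assms(3) C3_manifold_dom[OF assms(1) that(1)] chart_inv_in_dom[OF that(2)] by auto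
  then have "rep_dom c d g = rep_dom c d f" "\<And>p. p \<in> rep_dom c d f \<Longrightarrow> rep c d f p = rep c d g p"
    if "c \<in> atlas M" for c and d :: "('c, 'd) chart"
    using \<open>\<And>c p. c \<in> atlas M \<Longrightarrow> p \<in> chart_image c \<Longrightarrow> g (chart_inv c p) = f (chart_inv c p)\<close>[OF that]
    by (simp_all add: rep_dom_def rep_def cong: conj_cong)
  moreover have "C3_on (rep_dom c d f) (rep c d f)" if "c \<in> atlas M" "d \<in> atlas N" for c d
    using assms(2) that unfolding C3_map_def by blast
  ultimately have "C3_on (rep_dom c d g) (rep c d g)" if "c \<in> atlas M" "d \<in> atlas N" for c d
    using that C3_on_cong[of "rep_dom c d f" "rep c d f" "rep c d g"] by simp
  moreover have "g ` points M \<subseteq> points N"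
    using assms(2,3) unfolding C3_map_def by force
  ultimately show ?thesis unfolding C3_map_def by blast
qed

lemma C3_on_local:
  assumes "\<And>x. x \<in> U \<Longrightarrow> \<exists>V. x \<in> V \<and> V \<subseteq> U \<and> C3_on V f"
  shows "C3_on U f"
proof (rule C3_on_locally)
  show "open U" by (subst open_subopen) (meson assms C1_on_open C3_on_C1)
qed (use assms in blast)

lemma rep_compose:
  assumes "p \<in> rep_dom c d f" "inj_on (coord d) (chart_dom d)"
  shows "rep c e (\<lambda>x. g (f x)) p = rep d e g (rep c d f p)"
    and "rep c d f p \<in> rep_dom d e g \<longleftrightarrow> g (f (chart_inv c p)) \<in> chart_dom e"
  using assms by (auto simp: rep_def rep_dom_def chart_inv_coord)

text \<open>The chart in the middle manifold depends on the point, so the representative of the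
  composite is decomposed only near each point, on the open set of points that the first map sends
  into that chart.\<close>

lemma C3_map_compose:
  assumes N: "C3_manifold N" and M: "C3_manifold M"
    and g: "C3_map N L g" and f: "C3_map M N f"
  shows "C3_map M L (\<lambda>x. g (f x))"
  unfolding C3_map_def
proof (intro conjI ballI)
  show "(\<lambda>x. g (f x)) ` points M \<subseteq> points L"
    using f g by (auto simp: C3_map_points)
  fix c e assume c: "c \<in> atlas M" and e: "e \<in> atlas L"
  show "C3_on (rep_dom c e (\<lambda>x. g (f x))) (rep c e (\<lambda>x. g (f x)))"
  proof (rule C3_on_local)
    fix p assume p: "p \<in> rep_dom c e (\<lambda>x. g (f x))"
    let ?x = "chart_inv c p"
    have x: "f ?x \<in> points N"
      using p C3_manifold_dom[OF M c] C3_map_points[OF f] chart_inv_in_dom[of p c] by (auto simp: rep_dom_def)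
    define d where "d = chart_at N (f ?x)"
    have d: "d \<in> atlas N" "f ?x \<in> chart_dom d"
      unfolding d_def using N x by (auto intro: C3_manifold_chart_at C3_manifold_in_chart_at)
    note inj = C3_manifold_inj[OF N d(1)]
    note Cf = C3_map_rep[OF f c d(1)] and Cg = C3_map_rep[OF g d(1) e]
    define V where "V = rep_dom c d f \<inter> rep c d f -` rep_dom d e g"
    have "open V"
      unfolding V_def
      by (rule continuous_open_preimage[OF C1_on_continuous[OF C3_on_C1[OF Cf]]])
        (rule C3_on_open[OF Cf] C3_on_open[OF Cg])+
    have V: "C3_on V (\<lambda>q. rep d e g (rep c d f q))"
      by (rule C3_on_compose[OF Cg C3_on_subset[OF Cf \<open>open V\<close>]]) (auto simp: V_def)
    have "p \<in> V" "V \<subseteq> rep_dom c e (\<lambda>x. g (f x))"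
      using p d rep_compose(2)[OF _ inj, of _ c f e g] by (auto simp: V_def rep_dom_def)
    moreover have "C3_on V (rep c e (\<lambda>x. g (f x)))"
      by (rule C3_on_cong[OF _ V]) (auto simp: V_def rep_compose(1)[OF _ inj])
    ultimately show "\<exists>V. p \<in> V \<and> V \<subseteq> rep_dom c e (\<lambda>x. g (f x)) \<and> C3_on V (rep c e (\<lambda>x. g (f x)))"
      by blast
  qed
qed

lemma dd_rep_compose:
  assumes "C1_on (rep_dom c d f) (rep c d f)" "C1_on (rep_dom d e g) (rep d e g)"
    and inj: "inj_on (coord d) (chart_dom d)"
    and p: "p \<in> rep_dom c d f" "g (f (chart_inv c p)) \<in> chart_dom e"
  shows "dd (rep c e (\<lambda>x. g (f x))) (p, v) = dd (rep d e g) (rep c d f p, dd (rep c d f) (p, v))"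
proof -
  have "has_dir_deriv (\<lambda>q. rep d e g (rep c d f q)) (dd (rep d e g) (rep c d f p, dd (rep c d f) (p, v))) p v"
    using p by (intro C1_on_chain[OF assms(2)] C1_on_deriv[OF assms(1)]) (auto simp: rep_compose(2)[OF p(1) inj])
  then have "has_dir_deriv (rep c e (\<lambda>x. g (f x))) (dd (rep d e g) (rep c d f p, dd (rep c d f) (p, v))) p v"
    by (rule has_dir_deriv_cong[OF C1_on_open[OF assms(1)] p(1), THEN iffD1, rotated])
      (simp add: rep_compose(1)[OF _ inj])
  then show ?thesis by (rule dd_eq)
qed

subsection \<open>Products\<close>

lemma prod_chart_simps:
  "chart_dom (prod_chart c d) = chart_dom c \<times> chart_dom d"
  "coord (prod_chart c d) = map_prod (coord c) (coord d)"
  "chart_image (prod_chart c d) = chart_image c \<times> chart_image d"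
  by (auto simp: prod_chart_def)

lemma chart_inv_prod:
  assumes "inj_on (coord c) (chart_dom c)" "inj_on (coord d) (chart_dom d)"
    and "p \<in> chart_image c" "q \<in> chart_image d"
  shows "chart_inv (prod_chart c d) (p, q) = (chart_inv c p, chart_inv d q)"
proof -
  have "inj_on (coord (prod_chart c d)) (chart_dom (prod_chart c d))"
    using assms by (auto simp: prod_chart_simps inj_on_def)
  moreover have "coord (prod_chart c d) (chart_inv c p, chart_inv d q) = (p, q)"
    using assms by (simp add: prod_chart_simps coord_chart_inv)
  ultimately show ?thesis
    using assms chart_inv_coord[of "prod_chart c d" "(chart_inv c p, chart_inv d q)"]
    by (simp add: prod_chart_simps chart_inv_in_dom)
qed

lemma prod_manifold_simps:
  "points (prod_manifold M N) = points M \<times> points N"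
  "atlas (prod_manifold M N) = (\<lambda>(c, d). prod_chart c d) ` (atlas M \<times> atlas N)"
  "chart_at (prod_manifold M N) (x, y) = prod_chart (chart_at M x) (chart_at N y)"
  by (auto simp: prod_manifold_def)

lemma C3_on_compose_linear:
  assumes "C3_on U f" "continuous_linear L" "open V" "L ` V \<subseteq> U"
  shows "C3_on V (\<lambda>x. f (L x))"
  by (rule C3_on_compose[OF assms(1) C3_on_linear[OF assms(2,3)] assms(4)])

lemma C3_manifold_prod:
  assumes M: "C3_manifold M" and N: "C3_manifold N"
  shows "C3_manifold (prod_manifold M N)"
  unfolding C3_manifold_def
proof (intro conjI ballI)
  show "(\<Union>c\<in>atlas (prod_manifold M N). chart_dom c) = points (prod_manifold M N)"
  proof (intro equalityI subsetI)
    fix x assume "x \<in> (\<Union>c\<in>atlas (prod_manifold M N). chart_dom c)"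
    then obtain a b where "a \<in> atlas M" "b \<in> atlas N" "x \<in> chart_dom a \<times> chart_dom b"
      unfolding prod_manifold_simps by (auto simp: prod_chart_simps)
    then show "x \<in> points (prod_manifold M N)"
      unfolding prod_manifold_simps using C3_manifold_dom[OF M] C3_manifold_dom[OF N] by blast
  next
    fix x assume x: "x \<in> points (prod_manifold M N)"
    then obtain y z where yz: "x = (y, z)" "y \<in> points M" "z \<in> points N"
      unfolding prod_manifold_simps by blast
    let ?c = "prod_chart (chart_at M y) (chart_at N z)"
    have "(chart_at M y, chart_at N z) \<in> atlas M \<times> atlas N"
      using C3_manifold_chart_at[OF M yz(2)] C3_manifold_chart_at[OF N yz(3)] by blast
    then have "?c \<in> atlas (prod_manifold M N)"
      unfolding prod_manifold_simps by (rule image_eqI[rotated]) simp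
    moreover have "x \<in> chart_dom ?c"
      unfolding prod_chart_simps
      using C3_manifold_in_chart_at[OF M yz(2)] C3_manifold_in_chart_at[OF N yz(3)] yz by blast
    ultimately show "x \<in> (\<Union>c\<in>atlas (prod_manifold M N). chart_dom c)" by (rule UN_I)
  qed
next
  fix c assume "c \<in> atlas (prod_manifold M N)"
  then obtain a b where c: "c = prod_chart a b" "a \<in> atlas M" "b \<in> atlas N"
    by (auto simp: prod_manifold_simps)
  show "inj_on (coord c) (chart_dom c)"
    using C3_manifold_inj[OF M c(2)] C3_manifold_inj[OF N c(3)] by (auto simp: c(1) prod_chart_simps inj_on_def)
  show "open (chart_image c)"
    using C3_manifold_open[OF M c(2)] C3_manifold_open[OF N c(3)] unfolding c(1) prod_chart_simps(3) by (rule open_Times)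
  fix d assume "d \<in> atlas (prod_manifold M N)"
  then obtain a' b' where d: "d = prod_chart a' b'" "a' \<in> atlas M" "b' \<in> atlas N"
    by (auto simp: prod_manifold_simps)
  note inj = C3_manifold_inj[OF M c(2)] C3_manifold_inj[OF N c(3)]
  note T = C3_manifold_transition[OF M c(2) d(2)] C3_manifold_transition[OF N c(3) d(3)]
  have dom: "rep_dom c d (\<lambda>x. x) = rep_dom a a' (\<lambda>x. x) \<times> rep_dom b b' (\<lambda>x. x)"
    using chart_inv_prod[OF inj] by (auto simp: rep_dom_def c d prod_chart_simps)
  have op: "open (rep_dom a a' (\<lambda>x. x) \<times> rep_dom b b' (\<lambda>x. x))"
    by (intro open_Times C3_on_open[OF T(1)] C3_on_open[OF T(2)])
  have "C3_on (rep_dom c d (\<lambda>x. x)) (\<lambda>z. (rep a a' (\<lambda>x. x) (fst z), rep b b' (\<lambda>x. x) (snd z)))"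
    unfolding dom by (intro C3_on_Pair C3_on_compose_linear[OF T(1)] C3_on_compose_linear[OF T(2)]
        continuous_linear_intros op) auto
  then show "C3_on (rep_dom c d (\<lambda>x. x)) (rep c d (\<lambda>x. x))"
    by (rule C3_on_cong[rotated])
      (auto simp: dom, auto simp: rep_def rep_dom_def c d prod_chart_simps chart_inv_prod[OF inj])
next
  fix x assume "x \<in> points (prod_manifold M N)"
  then show "chart_at (prod_manifold M N) x \<in> atlas (prod_manifold M N)"
    "x \<in> chart_dom (chart_at (prod_manifold M N) x)"
    using C3_manifold_chart_at[OF M] C3_manifold_chart_at[OF N] C3_manifold_in_chart_at[OF M] C3_manifold_in_chart_at[OF N]
    by (auto simp: prod_manifold_simps prod_chart_simps intro!: image_eqI[of _ _ "(_, _)"])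
qed

lemma C3_map_id: "C3_manifold M \<Longrightarrow> C3_map M M (\<lambda>x. x)"
  unfolding C3_map_def by (auto intro: C3_manifold_transition)

lemma C3_map_const:
  fixes N :: "('n, 'f::locally_convex_space) manifold"
  assumes M: "C3_manifold M" and "y \<in> points N"
  shows "C3_map M N (\<lambda>x. y)"
proof -
  have "C3_on (rep_dom c d (\<lambda>x. y)) (rep c d (\<lambda>x. y))" if c: "c \<in> atlas M" for c and d :: "('n, 'f) chart"
  proof -
    have "rep_dom c d (\<lambda>x. y) = (if y \<in> chart_dom d then chart_image c else {})"
      by (auto simp: rep_dom_def)
    then show ?thesis using C3_manifold_open[OF M c] by (simp add: rep_def C3_on_const)
  qed
  then show ?thesis using assms by (auto simp: C3_map_def)
qed

lemma C3_map_fst: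
  assumes M: "C3_manifold M" and N: "C3_manifold N"
  shows "C3_map (prod_manifold M N) M fst"
  unfolding C3_map_def
proof (intro conjI ballI)
  fix c d assume "c \<in> atlas (prod_manifold M N)" and d: "d \<in> atlas M"
  then obtain a b where c: "c = prod_chart a b" "a \<in> atlas M" "b \<in> atlas N"
    by (auto simp: prod_manifold_simps)
  note inj = C3_manifold_inj[OF M c(2)] C3_manifold_inj[OF N c(3)]
  note T = C3_manifold_transition[OF M c(2) d]
  have dom: "rep_dom c d fst = rep_dom a d (\<lambda>x. x) \<times> chart_image b"
    using chart_inv_prod[OF inj] by (auto simp: rep_dom_def c prod_chart_simps)
  have "C3_on (rep_dom c d fst) (\<lambda>z. rep a d (\<lambda>x. x) (fst z))"
    unfolding dom using C3_manifold_open[OF N c(3)]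
    by (intro C3_on_compose_linear[OF T] continuous_linear_intros)
      (auto intro!: open_Times C3_on_open[OF T])
  then show "C3_on (rep_dom c d fst) (rep c d fst)"
    by (rule C3_on_cong[rotated])
      (auto simp: dom, auto simp: rep_def rep_dom_def c prod_chart_simps chart_inv_prod[OF inj])
qed (auto simp: prod_manifold_simps)

lemma C3_map_snd:
  assumes M: "C3_manifold M" and N: "C3_manifold N"
  shows "C3_map (prod_manifold M N) N snd"
  unfolding C3_map_def
proof (intro conjI ballI)
  fix c d assume "c \<in> atlas (prod_manifold M N)" and d: "d \<in> atlas N"
  then obtain a b where c: "c = prod_chart a b" "a \<in> atlas M" "b \<in> atlas N"
    by (auto simp: prod_manifold_simps)
  note inj = C3_manifold_inj[OF M c(2)] C3_manifold_inj[OF N c(3)]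
  note T = C3_manifold_transition[OF N c(3) d]
  have dom: "rep_dom c d snd = chart_image a \<times> rep_dom b d (\<lambda>x. x)"
    using chart_inv_prod[OF inj] by (auto simp: rep_dom_def c prod_chart_simps)
  have "C3_on (rep_dom c d snd) (\<lambda>z. rep b d (\<lambda>x. x) (snd z))"
    unfolding dom using C3_manifold_open[OF M c(2)]
    by (intro C3_on_compose_linear[OF T] continuous_linear_intros)
      (auto intro!: open_Times C3_on_open[OF T])
  then show "C3_on (rep_dom c d snd) (rep c d snd)"
    by (rule C3_on_cong[rotated])
      (auto simp: dom, auto simp: rep_def rep_dom_def c prod_chart_simps chart_inv_prod[OF inj])
qed (auto simp: prod_manifold_simps)

lemma C3_map_Pair:
  assumes "C3_map L M f" "C3_map L N g"
  shows "C3_map L (prod_manifold M N) (\<lambda>x. (f x, g x))"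
  unfolding C3_map_def
proof (intro conjI ballI)
  show "(\<lambda>x. (f x, g x)) ` points L \<subseteq> points (prod_manifold M N)"
    using assms by (auto simp: prod_manifold_simps C3_map_points)
  fix c d assume c: "c \<in> atlas L" and "d \<in> atlas (prod_manifold M N)"
  then obtain a b where d: "d = prod_chart a b" "a \<in> atlas M" "b \<in> atlas N"
    by (auto simp: prod_manifold_simps)
  note C = C3_map_rep[OF assms(1) c d(2)] C3_map_rep[OF assms(2) c d(3)]
  have dom: "rep_dom c d (\<lambda>x. (f x, g x)) = rep_dom c a f \<inter> rep_dom c b g"
    by (auto simp: rep_dom_def d prod_chart_simps)
  have "open (rep_dom c a f \<inter> rep_dom c b g)"
    by (intro open_Int C3_on_open[OF C(1)] C3_on_open[OF C(2)])
  then have "C3_on (rep_dom c d (\<lambda>x. (f x, g x))) (\<lambda>p. (rep c a f p, rep c b g p))"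
    unfolding dom by (intro C3_on_Pair C3_on_subset[OF C(1)] C3_on_subset[OF C(2)]) auto
  then show "C3_on (rep_dom c d (\<lambda>x. (f x, g x))) (rep c d (\<lambda>x. (f x, g x)))"
    by (simp add: rep_def d prod_chart_simps)
qed

text \<open>Written out on pairs of coordinates, so that partial derivatives can be taken without
  inverting a product chart.\<close>

lemma C3_map_prod_rep:
  assumes M: "C3_manifold M" and N: "C3_manifold N"
    and f: "C3_map (prod_manifold M N) L f"
    and c: "c \<in> atlas M" "d \<in> atlas N" "e \<in> atlas L"
  shows "C3_on {(p, q). p \<in> chart_image c \<and> q \<in> chart_image d \<and> f (chart_inv c p, chart_inv d q) \<in> chart_dom e}
    (\<lambda>(p, q). coord e (f (chart_inv c p, chart_inv d q)))"
proof -
  note inj = chart_inv_prod[OF C3_manifold_inj[OF M c(1)] C3_manifold_inj[OF N c(2)]]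
  have "prod_chart c d \<in> atlas (prod_manifold M N)"
    using c by (auto simp: prod_manifold_simps)
  note C = C3_map_rep[OF f this c(3)]
  have "rep_dom (prod_chart c d) e f =
      {(p, q). p \<in> chart_image c \<and> q \<in> chart_image d \<and> f (chart_inv c p, chart_inv d q) \<in> chart_dom e}"
    by (auto simp: rep_dom_def prod_chart_simps inj)
  then show ?thesis
    using C3_on_cong[OF _ C, of "\<lambda>(p, q). coord e (f (chart_inv c p, chart_inv d q))"]
    by (auto simp: rep_def inj)
qed

section \<open>Lie groups of class three\<close>

locale C3_lie_group = group K for K :: "('k, 'z) monoid_scheme" (structure) +
  fixes P :: "('k, 'e::locally_convex_space) manifold"
  assumes manifold: "C3_manifold P"
    and carrier: "carrier K = points P"
    and mult: "C3_map (prod_manifold P P) P (\<lambda>z. fst z \<otimes> snd z)"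
    and inverse: "C3_map P P (\<lambda>x. inv x)"
begin

abbreviation c0 :: "('k, 'e) chart" where "c0 \<equiv> chart_at P \<one>"
abbreviation e0 :: 'e where "e0 \<equiv> coord c0 \<one>"

lemma c0: "c0 \<in> atlas P" "\<one> \<in> chart_dom c0"
  using C3_manifold_chart_at[OF manifold, of \<one>] C3_manifold_in_chart_at[OF manifold, of \<one>]
  by (auto simp: carrier[symmetric])

lemma e0: "e0 \<in> chart_image c0"
  using c0 by blast

lemma inj: "c \<in> atlas P \<Longrightarrow> inj_on (coord c) (chart_dom c)"
  by (rule C3_manifold_inj[OF manifold])

lemma image_open: "c \<in> atlas P \<Longrightarrow> open (chart_image c)"
  by (rule C3_manifold_open[OF manifold])

lemma chart_carrier: "c \<in> atlas P \<Longrightarrow> x \<in> chart_dom c \<Longrightarrow> x \<in> carrier K"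
  using C3_manifold_dom[OF manifold] carrier by blast

lemma chart_inv_carrier: "c \<in> atlas P \<Longrightarrow> p \<in> chart_image c \<Longrightarrow> chart_inv c p \<in> carrier K"
  by (rule chart_carrier[OF _ chart_inv_in_dom])

lemma chart_inv_e0: "chart_inv c0 e0 = \<one>"
  by (rule chart_inv_coord[OF inj]) (rule c0)+

lemma right_translation_C3: "a \<in> carrier K \<Longrightarrow> C3_map P P (\<lambda>y. y \<otimes> a)"
  using C3_map_compose[OF C3_manifold_prod[OF manifold manifold] manifold mult
      C3_map_Pair[OF C3_map_id[OF manifold] C3_map_const[OF manifold, of a P]]]
  by (simp add: carrier)

lemma right_translation_rep:
  "a \<in> carrier K \<Longrightarrow> c \<in> atlas P \<Longrightarrow> d \<in> atlas P \<Longrightarrow>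
    C3_on (rep_dom c d (\<lambda>y. y \<otimes> a)) (rep c d (\<lambda>y. y \<otimes> a))"
  by (rule C3_map_rep[OF right_translation_C3])

text \<open>\<open>kappa c\<close> is the right Maurer--Cartan form in the chart \<open>c\<close>.\<close>

definition kappa :: "('k, 'e) chart \<Rightarrow> 'e \<times> 'e \<Rightarrow> 'e" where
  "kappa c = (\<lambda>(p, v). dd (rep c c0 (\<lambda>y. y \<otimes> inv (chart_inv c p))) (p, v))"

text \<open>Right division in coordinates. The translation inside \<open>kappa\<close> changes with
  the base point; division is a single map of class three, and \<open>kappa\<close> is its partial
  derivative on the diagonal, which yields regularity jointly in point and vector.\<close>

definition divide_dom :: "('k, 'e) chart \<Rightarrow> ('e \<times> 'e) set" where
  "divide_dom c = {(q, p). q \<in> chart_image c \<and> p \<in> chart_image c \<and>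
    chart_inv c q \<otimes> inv (chart_inv c p) \<in> chart_dom c0}"

definition divide_rep :: "('k, 'e) chart \<Rightarrow> 'e \<times> 'e \<Rightarrow> 'e" where
  "divide_rep c = (\<lambda>(q, p). coord c0 (chart_inv c q \<otimes> inv (chart_inv c p)))"

lemma divide_rep_C3:
  assumes "c \<in> atlas P"
  shows "C3_on (divide_dom c) (divide_rep c)"
proof -
  note PP = C3_manifold_prod[OF manifold manifold]
  have "C3_map (prod_manifold P P) P (\<lambda>z. fst z \<otimes> inv (snd z))"
    using C3_map_compose[OF PP PP mult C3_map_Pair[OF C3_map_fst[OF manifold manifold]
          C3_map_compose[OF manifold PP inverse C3_map_snd[OF manifold manifold]]]] by simp
  from C3_map_prod_rep[OF manifold manifold this assms assms c0(1)] show ?thesis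
    by (simp add: divide_dom_def divide_rep_def)
qed

lemma in_divide_dom: "c \<in> atlas P \<Longrightarrow> p \<in> chart_image c \<Longrightarrow> (p, p) \<in> divide_dom c"
  using c0 by (simp add: divide_dom_def chart_inv_carrier)

lemma kappa_divide_rep:
  assumes c: "c \<in> atlas P" and p: "p \<in> chart_image c"
  shows "kappa c (p, v) = dd (divide_rep c) ((p, p), (v, 0))"
proof -
  have "has_dir_deriv (\<lambda>q. divide_rep c (q, p)) (dd (divide_rep c) ((p, p), (v, 0))) p v"
    by (rule C1_on_partial1[OF C3_on_C1[OF divide_rep_C3[OF c]] in_divide_dom[OF c p]])
  moreover have "(\<lambda>q. divide_rep c (q, p)) = rep c c0 (\<lambda>y. y \<otimes> inv (chart_inv c p))"
    by (simp add: divide_rep_def rep_def)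
  ultimately show ?thesis by (simp add: kappa_def dd_eq)
qed

lemma kappa_C2:
  assumes c: "c \<in> atlas P"
  shows "C2_on (chart_image c \<times> UNIV) (kappa c)"
proof (rule C2_on_cong)
  show "C2_on (chart_image c \<times> UNIV) (\<lambda>z. dd (divide_rep c) ((fst z, fst z), (snd z, 0)))"
    by (rule C2_on_compose[OF C3_on_dd[OF divide_rep_C3[OF c]] C2_on_linear])
      (auto intro!: continuous_linear_intros open_Times image_open c in_divide_dom[OF c, OF imageI])
qed (auto simp: kappa_divide_rep[OF c])

lemmas kappa_C1 = C2_on_C1[OF kappa_C2]

lemma base_in_rep_dom:
  assumes "c \<in> atlas P" "p \<in> chart_image c"
  shows "p \<in> rep_dom c c0 (\<lambda>y. y \<otimes> inv (chart_inv c p))"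
  using assms c0 by (simp add: rep_dom_def chart_inv_carrier)

lemma kappa_linear:
  assumes "c \<in> atlas P" "p \<in> chart_image c"
  shows "linear (\<lambda>v. kappa c (p, v))"
  using C1_on_dd_linear[OF C3_on_C1[OF right_translation_rep[OF inv_closed[OF chart_inv_carrier[OF assms]] assms(1) c0(1)]]
      base_in_rep_dom[OF assms]]
  by (simp add: kappa_def)

text \<open>Translating by \<open>a\<close> and then by the inverse of \<open>?x \<otimes> a\<close>
  is the same as translating by the inverse of \<open>?x\<close>. For \<open>a = \<one>\<close> this
  is the invariance of the form under change of chart.\<close>

lemma kappa_right_translation:
  assumes a: "a \<in> carrier K" and c: "c \<in> atlas P" and d: "d \<in> atlas P"
    and p: "p \<in> rep_dom c d (\<lambda>y. y \<otimes> a)"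
  shows "kappa c (p, v) = kappa d (rep c d (\<lambda>y. y \<otimes> a) p, dd (rep c d (\<lambda>y. y \<otimes> a)) (p, v))"
proof -
  let ?x = "chart_inv c p" and ?\<phi> = "rep c d (\<lambda>y. y \<otimes> a)"
  have pc: "p \<in> chart_image c" and xa: "?x \<otimes> a \<in> chart_dom d" using p by (auto simp: rep_dom_def)
  have x: "?x \<in> carrier K" by (rule chart_inv_carrier[OF c pc])
  have inv_\<phi>: "chart_inv d (?\<phi> p) = ?x \<otimes> a"
    unfolding rep_def by (rule chart_inv_coord[OF inj[OF d] xa])
  let ?b = "inv (?x \<otimes> a)"
  have b: "?b \<in> carrier K" using x a by simp
  have eq: "y \<otimes> inv ?x = (y \<otimes> a) \<otimes> ?b" if "y \<in> carrier K" for y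
    using that x a by (simp add: inv_mult_group m_assoc inv_solve_left) (simp add: m_assoc[symmetric])
  have "kappa c (p, v) = dd (rep c c0 (\<lambda>y. (y \<otimes> a) \<otimes> ?b)) (p, v)"
    unfolding kappa_def prod.case
    by (rule dd_cong[OF image_open[OF c] pc]) (simp add: rep_def eq chart_inv_carrier[OF c])
  also have "\<dots> = dd (rep d c0 (\<lambda>y. y \<otimes> ?b)) (?\<phi> p, dd ?\<phi> (p, v))"
    by (rule dd_rep_compose[OF C3_on_C1[OF right_translation_rep[OF a c d]]
          C3_on_C1[OF right_translation_rep[OF b d c0(1)]] inj[OF d] p])
      (use c0 x a in simp)
  also have "\<dots> = kappa d (?\<phi> p, dd ?\<phi> (p, v))"
    by (simp add: kappa_def inv_\<phi>)
  finally show ?thesis .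
qed

lemma kappa_e0: "kappa c0 (e0, v) = v"
proof -
  have "kappa c0 (e0, v) = dd (\<lambda>x. x) (e0, v)"
    unfolding kappa_def prod.case chart_inv_e0
    by (rule dd_cong[OF image_open[OF c0(1)] e0])
      (simp add: rep_def chart_inv_carrier[OF c0(1)] coord_chart_inv)
  then show ?thesis by (simp add: dd_linear linear_ident)
qed

definition kappa_inv :: "('k, 'e) chart \<Rightarrow> 'e \<Rightarrow> 'e \<Rightarrow> 'e" where
  "kappa_inv c p v = dd (rep c0 c (\<lambda>z. z \<otimes> chart_inv c p)) (e0, v)"

text \<open>Right translations by a group element and by its inverse undo each other, so at every
  point the form is a linear isomorphism onto the Lie algebra.\<close>

lemma kappa_inverse:
  assumes c: "c \<in> atlas P" and p: "p \<in> chart_image c"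
  shows "kappa c (p, kappa_inv c p v) = v" and "kappa_inv c p (kappa c (p, v)) = v"
    and "linear (kappa_inv c p)"
proof -
  let ?x = "chart_inv c p"
  have x: "?x \<in> carrier K" by (rule chart_inv_carrier[OF c p])
  note C = C3_on_C1[OF right_translation_rep[OF x c0(1) c]]
    C3_on_C1[OF right_translation_rep[OF inv_closed[OF x] c c0(1)]]
  have e: "e0 \<in> rep_dom c0 c (\<lambda>z. z \<otimes> ?x)"
    using e0 chart_inv_in_dom[OF p] x by (simp add: rep_dom_def chart_inv_e0)
  have re: "rep c0 c (\<lambda>z. z \<otimes> ?x) e0 = p"
    using x p by (simp add: rep_def chart_inv_e0 coord_chart_inv)
  have rp: "rep c c0 (\<lambda>y. y \<otimes> inv ?x) p = e0"
    using x by (simp add: rep_def)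
  have "dd (rep c0 c0 (\<lambda>z. z \<otimes> ?x \<otimes> inv ?x)) (e0, v) = kappa c (p, kappa_inv c p v)"
    using dd_rep_compose[OF C inj[OF c] e] x c0 by (simp add: chart_inv_e0 re kappa_def kappa_inv_def)
  moreover have "dd (rep c0 c0 (\<lambda>z. z \<otimes> ?x \<otimes> inv ?x)) (e0, v) = dd (\<lambda>x. x) (e0, v)"
    by (rule dd_cong[OF image_open[OF c0(1)] e0])
      (use x in \<open>simp add: rep_def chart_inv_carrier[OF c0(1)] coord_chart_inv m_assoc\<close>)
  ultimately show "kappa c (p, kappa_inv c p v) = v" by (simp add: dd_linear linear_ident)
  have "dd (rep c c (\<lambda>y. y \<otimes> inv ?x \<otimes> ?x)) (p, v) = kappa_inv c p (kappa c (p, v))"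
    using dd_rep_compose[OF C(2,1) inj[OF c0(1)] base_in_rep_dom[OF c p]] x chart_inv_in_dom[OF p]
    by (simp add: rp kappa_def kappa_inv_def)
  moreover have "dd (rep c c (\<lambda>y. y \<otimes> inv ?x \<otimes> ?x)) (p, v) = dd (\<lambda>x. x) (p, v)"
    by (rule dd_cong[OF image_open[OF c] p])
      (use x in \<open>simp add: rep_def chart_inv_carrier[OF c] coord_chart_inv m_assoc\<close>)
  ultimately show "kappa_inv c p (kappa c (p, v)) = v" by (simp add: dd_linear linear_ident)
  show "linear (kappa_inv c p)"
    unfolding kappa_inv_def using C1_on_dd_linear[OF C(1) e] .
qed

subsection \<open>The structure equation\<close>

text \<open>\<open>v\<close> is the direction of differentiation, and \<open>w\<close> is the
  argument of the form, held constant in the chart. The skew part is the exterior derivative; the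
  whole expression depends on the chart.\<close>

definition dkappa :: "('k, 'e) chart \<Rightarrow> 'e \<Rightarrow> 'e \<Rightarrow> 'e \<Rightarrow> 'e" where
  "dkappa c p v w = dd (kappa c) ((p, w), (v, 0))"

lemma dd_kappa:
  assumes c: "c \<in> atlas P" and p: "p \<in> chart_image c"
  shows "dd (kappa c) ((p, w), (v, z)) = dkappa c p v w + kappa c (p, z)"
  unfolding dkappa_def by (rule dd_linear_second[OF kappa_C1[OF c] p kappa_linear[OF c p]])

lemma dkappa_bilinear:
  assumes c: "c \<in> atlas P" and p: "p \<in> chart_image c"
  shows "bilinear (dkappa c p)"
  unfolding bilinear_def
proof (intro conjI allI)
  fix v w
  show "linear (\<lambda>v. dkappa c p v w)"
  proof -
    have "linear (\<lambda>v. dd (kappa c) ((p, w), (v, 0)))"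
      using linear_compose[OF _ C1_on_dd_linear[OF kappa_C1[OF c], of "(p, w)"], of "\<lambda>v. (v, 0)"] p
      by (simp add: o_def linear_iff)
    then show ?thesis by (simp add: dkappa_def)
  qed
  have d: "has_dir_deriv (\<lambda>p. kappa c (p, w)) (dkappa c p v w) p v" for w
    unfolding dkappa_def using p by (intro C1_on_partial1[OF kappa_C1[OF c]]) simp
  note lin = kappa_linear[OF c]
  show "linear (\<lambda>w. dkappa c p v w)"
  proof (rule linearI)
    show "dkappa c p v (w + w') = dkappa c p v w + dkappa c p v w'" for w w'
    proof (rule has_dir_deriv_unique[OF d])
      show "has_dir_deriv (\<lambda>p. kappa c (p, w + w')) (dkappa c p v w + dkappa c p v w') p v"
        by (rule has_dir_deriv_cong[OF image_open[OF c] p, THEN iffD1, OF _ has_dir_deriv_add[OF d d]])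
          (rule linear_add[OF lin, symmetric])
    qed
    show "dkappa c p v (r *\<^sub>R w) = r *\<^sub>R dkappa c p v w" for r w
    proof (rule has_dir_deriv_unique[OF d])
      show "has_dir_deriv (\<lambda>p. kappa c (p, r *\<^sub>R w)) (r *\<^sub>R dkappa c p v w) p v"
        by (rule has_dir_deriv_cong[OF image_open[OF c] p, THEN iffD1, OF _ has_dir_deriv_scaleR[OF d]])
          (rule linear_scale[OF lin, symmetric])
    qed
  qed
qed

text \<open>Obtained by differentiating the invariance of the form. The extra term contains the
  second derivative of the translation. Being symmetric in \<open>v\<close> and \<open>w\<close>, it
  drops out of the structure equation, and it is exactly the inhomogeneous term in the
  transformation law of Christoffel maps.\<close>

lemma dkappa_right_translation:
  assumes a: "a \<in> carrier K" and c: "c \<in> atlas P" and d: "d \<in> atlas P"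
    and p: "p \<in> rep_dom c d (\<lambda>y. y \<otimes> a)"
  defines "\<phi> \<equiv> rep c d (\<lambda>y. y \<otimes> a)"
  shows "dkappa c p v w = dkappa d (\<phi> p) (dd \<phi> (p, v)) (dd \<phi> (p, w)) + kappa d (\<phi> p, dd (dd \<phi>) ((p, w), (v, 0)))"
proof -
  let ?\<Omega> = "rep_dom c d (\<lambda>y. y \<otimes> a)"
  have \<phi>: "C2_on ?\<Omega> \<phi>" unfolding \<phi>_def by (rule C3_on_C2[OF right_translation_rep[OF a c d]])
  note \<phi>1 = C2_on_C1[OF \<phi>] and \<phi>2 = C2_on_dd[OF \<phi>]
  have op: "open (?\<Omega> \<times> UNIV)" by (rule open_Times[OF C1_on_open[OF \<phi>1] open_UNIV])
  have im: "\<phi> q \<in> chart_image d" if "q \<in> ?\<Omega>" for q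
    using that by (auto simp: \<phi>_def rep_def rep_dom_def)
  have "dkappa c p v w = dd (\<lambda>z. kappa d (\<phi> (fst z), dd \<phi> z)) ((p, w), (v, 0))"
    unfolding dkappa_def
  proof (rule dd_cong[OF op])
    show "kappa c z = kappa d (\<phi> (fst z), dd \<phi> z)" if "z \<in> ?\<Omega> \<times> UNIV" for z
      using that kappa_right_translation[OF a c d, of "fst z" "snd z"] by (auto simp: \<phi>_def)
  qed (use p in simp)
  also have "\<dots> = dd (kappa d) ((\<phi> p, dd \<phi> (p, w)), dd (\<lambda>z. (\<phi> (fst z), dd \<phi> z)) ((p, w), (v, 0)))"
    using dd_compose[OF kappa_C1[OF d] C1_on_Pair[OF C1_on_fst[OF \<phi>1] \<phi>2], of "(p, w)" "(v, 0)"] p im[OF p]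
    by simp
  also have "dd (\<lambda>z. (\<phi> (fst z), dd \<phi> z)) ((p, w), (v, 0)) = (dd (\<lambda>z. \<phi> (fst z)) ((p, w), (v, 0)), dd (dd \<phi>) ((p, w), (v, 0)))"
    by (rule dd_Pair[OF C1_on_fst[OF \<phi>1] \<phi>2]) (use p in simp)
  also have "dd (\<lambda>z. \<phi> (fst z)) ((p, w), (v, 0)) = dd \<phi> (p, v)"
    using dd_compose[OF \<phi>1 C1_on_linear[OF continuous_linear_fst op], of "(p, w)" "(v, 0)"] p
    by (simp add: dd_linear linear_fst)
  finally show ?thesis by (simp add: dd_kappa[OF d im[OF p]])
qed

section \<open>The multiplication in coordinates and the bracket\<close>

definition mult_rep :: "'e \<times> 'e \<Rightarrow> 'e" where
  "mult_rep = (\<lambda>(p, q). coord c0 (chart_inv c0 p \<otimes> chart_inv c0 q))"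

definition mult_dom :: "('e \<times> 'e) set" where
  "mult_dom = {(p, q). p \<in> chart_image c0 \<and> q \<in> chart_image c0 \<and> chart_inv c0 p \<otimes> chart_inv c0 q \<in> chart_dom c0}"

lemma mult_rep_C3: "C3_on mult_dom mult_rep"
  using C3_map_prod_rep[OF manifold manifold mult c0(1) c0(1) c0(1)]
  by (simp add: mult_dom_def mult_rep_def)

lemma mult_rep_unit:
  assumes "p \<in> chart_image c0"
  shows "(p, e0) \<in> mult_dom" "(e0, p) \<in> mult_dom" "mult_rep (p, e0) = p" "mult_rep (e0, p) = p"
  using assms e0 chart_inv_in_dom[OF assms]
  by (auto simp: mult_dom_def mult_rep_def chart_inv_e0 chart_inv_carrier[OF c0(1)] coord_chart_inv)

lemma dd_mult_rep_unit:
  assumes "p \<in> chart_image c0"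
  shows "dd mult_rep ((p, e0), (v, 0)) = v" "dd mult_rep ((e0, p), (0, v)) = v"
proof -
  note C = C3_on_C1[OF mult_rep_C3]
  have "has_dir_deriv (\<lambda>q. mult_rep (q, e0)) (dd mult_rep ((p, e0), (v, 0))) p v"
    by (rule C1_on_partial1[OF C mult_rep_unit(1)[OF assms]])
  then show "dd mult_rep ((p, e0), (v, 0)) = v"
    by (rule has_dir_deriv_unique)
      (rule has_dir_deriv_cong[OF image_open[OF c0(1)] assms, THEN iffD1, OF _ has_dir_deriv_linear[OF linear_ident]],
        simp add: mult_rep_unit)
  have "has_dir_deriv (\<lambda>q. mult_rep (e0, q)) (dd mult_rep ((e0, p), (0, v))) p v"
    by (rule C1_on_partial2[OF C mult_rep_unit(2)[OF assms]])
  then show "dd mult_rep ((e0, p), (0, v)) = v"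
    by (rule has_dir_deriv_unique)
      (rule has_dir_deriv_cong[OF image_open[OF c0(1)] assms, THEN iffD1, OF _ has_dir_deriv_linear[OF linear_ident]],
        simp add: mult_rep_unit)
qed

text \<open>The mixed second derivative of the product at the unit, along \<open>v\<close> in the
  left factor and \<open>w\<close> in the right factor. Its antisymmetrisation is the
  bracket.\<close>

definition mixed :: "'e \<Rightarrow> 'e \<Rightarrow> 'e" where
  "mixed v w = dd (dd mult_rep) (((e0, e0), (0, w)), ((v, 0), 0))"

lemma left_invariant_field_rep:
  assumes "p \<in> chart_image c0"
  shows "left_invariant_field K P w p = dd mult_rep ((p, e0), (0, w))"
proof -
  have "has_dir_deriv (\<lambda>q. mult_rep (p, q)) (dd mult_rep ((p, e0), (0, w))) e0 w"
    by (rule C1_on_partial2[OF C3_on_C1[OF mult_rep_C3] mult_rep_unit(1)[OF assms]])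
  moreover have "(\<lambda>q. mult_rep (p, q)) = rep c0 c0 (\<lambda>y. chart_inv c0 p \<otimes> y)"
    by (simp add: mult_rep_def rep_def)
  ultimately show ?thesis
    by (simp add: left_invariant_field_def tangent_map_in_rep dd_eq)
qed

lemma left_invariant_field_deriv:
  "has_dir_deriv (left_invariant_field K P w) (mixed v w) e0 v"
proof (rule has_dir_deriv_cong[OF image_open[OF c0(1)] e0, THEN iffD1])
  have "has_dir_deriv (\<lambda>p. ((p, e0), (0, w))) ((v, 0), 0, 0) e0 v"
    by (intro has_dir_deriv_Pair has_dir_deriv_linear[OF linear_ident, of _ e0] has_dir_deriv_const
        has_dir_deriv_const[of "(0, w)", unfolded zero_prod_def])
  from C1_on_chain[OF C2_on_dd[OF C3_on_C2[OF mult_rep_C3]] _ this]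
  show "has_dir_deriv (\<lambda>p. dd mult_rep ((p, e0), (0, w))) (mixed v w) e0 v"
    using mult_rep_unit[OF e0] by (simp add: mixed_def zero_prod_def)
qed (simp add: left_invariant_field_rep)

text \<open>By the unit law the left invariant field of \<open>w\<close> has value \<open>w\<close>
  at the identity, and its derivative there along \<open>v\<close> is
  \<open>mixed v w\<close>.\<close>

lemma ad_mixed: "ad K P v w = mixed v w - mixed w v"
  unfolding ad_def field_bracket_def
  by (simp add: left_invariant_field_rep[OF e0] dd_mult_rep_unit[OF e0] dir_deriv_eq[OF left_invariant_field_deriv])

lemma mixed_bilinear: "bilinear mixed"
  unfolding bilinear_def
proof (intro conjI allI)
  note C = C2_on_dd[OF C3_on_C2[OF mult_rep_C3]]
  fix v w
  show "linear (\<lambda>v. mixed v w)"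
    unfolding mixed_def
    using linear_compose[OF _ C1_on_dd_linear[OF C, of "((e0, e0), (0, w))"], of "\<lambda>v. ((v, 0), 0)"]
      mult_rep_unit[OF e0] by (simp add: o_def linear_iff)
  \<comment> \<open>Symmetry of second derivatives exchanges direction and argument, which brings
    \<open>w\<close> into a slot already known to be linear.\<close>
  have *: "mixed v w = dd (dd mult_rep) (((e0, e0), (v, 0)), ((0, w), 0))" for w
    unfolding mixed_def using second_derivative_symmetric[OF C3_on_C2[OF mult_rep_C3]] mult_rep_unit[OF e0]
    by (metis zero_prod_def)
  show "linear (\<lambda>w. mixed v w)"
    unfolding *
    using linear_compose[OF _ C1_on_dd_linear[OF C, of "((e0, e0), (v, 0))"], of "\<lambda>w. ((0, w), 0)"]
      mult_rep_unit[OF e0] by (simp add: o_def linear_iff)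
qed

lemma ad_bilinear: "bilinear (ad K P)"
  using mixed_bilinear unfolding bilinear_def ad_mixed
  by (auto intro: linear_compose_sub)

end

context C3_lie_group
begin

lemma divide_rep_diag:
  assumes "c \<in> atlas P" "p \<in> chart_image c"
  shows "divide_rep c (p, p) = e0"
  using assms by (simp add: divide_rep_def chart_inv_carrier)

text \<open>Differentiate \<open>(x \<otimes> inv y) \<otimes> y = x\<close> in \<open>x\<close> on
  the diagonal: the inner factor is right division, whose derivative there is
  \<open>kappa\<close>.\<close>

lemma dd_mult_rep_kappa:
  assumes p: "p \<in> chart_image c0"
  shows "dd mult_rep ((e0, p), (kappa c0 (p, v), 0)) = v"
proof -
  note \<delta> = C3_on_C1[OF divide_rep_C3[OF c0(1)]] and m = C3_on_C1[OF mult_rep_C3]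
  let ?D = "divide_dom c0"
  have ppD: "(p, p) \<in> ?D" by (rule in_divide_dom[OF c0(1) p])
  have D: "(divide_rep c0 z, snd z) \<in> mult_dom \<and> mult_rep (divide_rep c0 z, snd z) = fst z" if "z \<in> ?D" for z
  proof -
    obtain q r where z: "z = (q, r)" by (cases z)
    have qr: "q \<in> chart_image c0" "r \<in> chart_image c0" and d: "chart_inv c0 q \<otimes> inv (chart_inv c0 r) \<in> chart_dom c0"
      using that by (auto simp: divide_dom_def z)
    have "chart_inv c0 (divide_rep c0 z) = chart_inv c0 q \<otimes> inv (chart_inv c0 r)"
      unfolding z divide_rep_def prod.case by (rule chart_inv_coord[OF inj[OF c0(1)] d])
    moreover have "chart_inv c0 q \<otimes> inv (chart_inv c0 r) \<otimes> chart_inv c0 r = chart_inv c0 q"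
      using qr by (simp add: m_assoc chart_inv_carrier[OF c0(1)])
    moreover have "divide_rep c0 z \<in> chart_image c0"
      unfolding z divide_rep_def prod.case using d by (rule imageI)
    ultimately show ?thesis
      using qr by (simp add: z mult_dom_def mult_rep_def chart_inv_in_dom coord_chart_inv)
  qed
  have "has_dir_deriv (\<lambda>z. (divide_rep c0 z, snd z)) (dd (divide_rep c0) ((p, p), (v, 0)), snd (v, 0::'e)) (p, p) (v, 0)"
    by (intro has_dir_deriv_Pair C1_on_deriv[OF \<delta> ppD] has_dir_deriv_linear[OF linear_snd])
  then have "has_dir_deriv (\<lambda>z. (divide_rep c0 z, snd z)) (kappa c0 (p, v), 0) (p, p) (v, 0)"
    by (simp add: kappa_divide_rep[OF c0(1) p])
  from C1_on_chain[OF m _ this]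
  have "has_dir_deriv (\<lambda>z. mult_rep (divide_rep c0 z, snd z)) (dd mult_rep ((e0, p), (kappa c0 (p, v), 0))) (p, p) (v, 0)"
    using D[OF ppD] by (simp add: divide_rep_diag[OF c0(1) p])
  moreover have "has_dir_deriv (\<lambda>z. mult_rep (divide_rep c0 z, snd z)) (fst (v, 0::'e)) (p, p) (v, 0)"
    by (rule has_dir_deriv_cong[OF C1_on_open[OF \<delta>] ppD, THEN iffD1, OF _ has_dir_deriv_linear[OF linear_fst]])
      (simp add: D)
  ultimately show ?thesis using has_dir_deriv_unique by fastforce
qed

text \<open>Differentiate \<open>dd_mult_rep_kappa\<close>, i.e. the inverse relation of the form and right translation, at the identity.\<close>

lemma dkappa_e0: "dkappa c0 e0 v w = - mixed w v"
proof -
  note m1 = C3_on_C1[OF mult_rep_C3] and m2 = C2_on_dd[OF C3_on_C2[OF mult_rep_C3]]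
  note ee = mult_rep_unit(1)[OF e0]
  let ?Z = "dkappa c0 e0 v w"
  have "has_dir_deriv (\<lambda>p. kappa c0 (p, w)) ?Z e0 v"
    unfolding dkappa_def using e0 by (intro C1_on_partial1[OF kappa_C1[OF c0(1)]]) simp
  then have "has_dir_deriv (\<lambda>p. ((e0, p), (kappa c0 (p, w), 0))) ((0, v), (?Z, 0)) e0 v"
    by (intro has_dir_deriv_Pair has_dir_deriv_const has_dir_deriv_linear[OF linear_ident])
  from C1_on_chain[OF m2 _ this]
  have "has_dir_deriv (\<lambda>p. dd mult_rep ((e0, p), (kappa c0 (p, w), 0)))
      (dd (dd mult_rep) (((e0, e0), (w, 0)), ((0, v), (?Z, 0)))) e0 v"
    using ee by (simp add: kappa_e0)
  \<comment> \<open>The function is constant by \<open>dd_mult_rep_kappa\<close>. Its vanishing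
    derivative splits below into a mixed derivative and, by linearity in the vector slot and the
    unit law, \<open>?Z\<close> itself.\<close>
  moreover have "has_dir_deriv (\<lambda>p. dd mult_rep ((e0, p), (kappa c0 (p, w), 0))) 0 e0 v"
    by (rule has_dir_deriv_cong[OF image_open[OF c0(1)] e0, THEN iffD1, OF _ has_dir_deriv_const[of w]])
      (simp add: dd_mult_rep_kappa)
  ultimately have "dd (dd mult_rep) (((e0, e0), (w, 0)), ((0, v), (?Z, 0))) = 0"
    by (rule has_dir_deriv_unique)
  moreover have "dd (dd mult_rep) (((e0, e0), (w, 0)), ((0, v), (?Z, 0)))
      = dd (dd mult_rep) (((e0, e0), (w, 0)), ((0, v), 0)) + dd mult_rep ((e0, e0), (?Z, 0))"
    by (rule dd_linear_second[OF m2 ee C1_on_dd_linear[OF m1 ee]])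
  moreover have "dd (dd mult_rep) (((e0, e0), (w, 0)), ((0, v), 0)) = mixed w v"
    unfolding mixed_def by (rule second_derivative_symmetric[OF C3_on_C2[OF mult_rep_C3] ee])
  ultimately show ?thesis
    by (simp add: dd_mult_rep_unit[OF e0] eq_neg_iff_add_eq_0 add.commute)
qed

text \<open>Right translation moves the point to the identity. The second derivative of the
  translation cancels by symmetry, and \<open>dkappa_e0\<close> gives the rest. The plus sign is
  that of the right form paired with the bracket of left invariant fields.\<close>

lemma structure_equation:
  assumes c: "c \<in> atlas P" and p: "p \<in> chart_image c"
  shows "dkappa c p v w - dkappa c p w v = ad K P (kappa c (p, v)) (kappa c (p, w))"
proof -
  let ?\<phi> = "rep c c0 (\<lambda>y. y \<otimes> inv (chart_inv c p))"
  have a: "inv (chart_inv c p) \<in> carrier K" using chart_inv_carrier[OF c p] by simp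
  note pd = base_in_rep_dom[OF c p]
  have e: "?\<phi> p = e0" using chart_inv_carrier[OF c p] by (simp add: rep_def)
  have d: "dd ?\<phi> (p, v) = kappa c (p, v)" for v by (simp add: kappa_def)
  have sym: "dd (dd ?\<phi>) ((p, w), (v, 0)) = dd (dd ?\<phi>) ((p, v), (w, 0))"
    by (rule second_derivative_symmetric[OF C3_on_C2[OF right_translation_rep[OF a c c0(1)]] pd])
  show ?thesis
    by (simp add: dkappa_right_translation[OF a c c0(1) pd] e d sym dkappa_e0 ad_mixed)
qed

text \<open>Computes the form at \<open>x\<close> through another chart \<open>d\<close>. This
  reconciles \<open>kappa\<close> with tangent maps, which are taken in the preferred
  charts.\<close>

lemma kappa_transition:
  assumes c: "c \<in> atlas P" and d: "d \<in> atlas P" and x: "x \<in> chart_dom c" "x \<in> chart_dom d"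
  shows "dd (rep d c0 (\<lambda>y. y \<otimes> inv x)) (coord d x, dd (rep c d (\<lambda>x. x)) (coord c x, v)) = kappa c (coord c x, v)"
proof -
  have xk: "inv x \<in> carrier K" using chart_carrier[OF c x(1)] by simp
  have ci: "chart_inv c (coord c x) = x" by (rule chart_inv_coord[OF inj[OF c] x(1)])
  have "coord c x \<in> rep_dom c d (\<lambda>x. x)" using x by (auto simp: rep_dom_def ci)
  from dd_rep_compose[OF C3_on_C1[OF C3_manifold_transition[OF manifold c d]]
      C3_on_C1[OF right_translation_rep[OF xk d c0(1)]] inj[OF d] this, of v]
  show ?thesis using c0 chart_carrier[OF c x(1)] by (simp add: ci kappa_def rep_def)
qed

end

section \<open>Constant maps as smooth vector fields\<close>

lemma iter_deriv_const: "iter_deriv (\<lambda>x. a) vs = (if vs = [] then (\<lambda>x. a) else (\<lambda>x. 0))"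
proof (induction vs)
  case Nil
  show ?case by (simp add: iter_deriv_Nil)
next
  case (Cons v vs)
  show ?case by (rule ext) (simp add: Cons dir_deriv_eq[OF has_dir_deriv_const])
qed

lemma smooth_on_const: "open U \<Longrightarrow> smooth_on U (\<lambda>x. a)"
proof -
  have "(\<lambda>(x, v::nat \<Rightarrow> 'a). iter_deriv (\<lambda>x. a) (map v [0..<n]) x) = (\<lambda>z. if n = 0 then a else 0)" for n
    by (auto simp: iter_deriv_const)
  moreover have "\<exists>D. has_dir_deriv (iter_deriv (\<lambda>x. a) vs) D x v" for vs and x v :: 'a
    using has_dir_deriv_const by (auto simp: iter_deriv_const)
  ultimately show "open U \<Longrightarrow> smooth_on U (\<lambda>x. a)" unfolding smooth_on_def by simp
qed

section \<open>Levi-Civita covariant derivative of a right invariant metric\<close>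

lemma levi_civita_torsion:
  assumes "levi_civita M g \<Gamma>" "c \<in> atlas M" "W \<subseteq> chart_image c" "smooth_on W X" "smooth_on W Y" "p \<in> W"
  shows "nabla \<Gamma> c X Y p - nabla \<Gamma> c Y X p = field_bracket X Y p"
  using assms(1)[unfolded levi_civita_def, THEN conjunct2, THEN conjunct1, rule_format,
      OF assms(2,3) conjI[OF assms(4,5)] assms(6)] .

lemma levi_civita_metric:
  assumes "levi_civita M g \<Gamma>" "c \<in> atlas M" "W \<subseteq> chart_image c" "smooth_on W X" "smooth_on W Y" "smooth_on W Z"
    "p \<in> W"
  shows "has_dir_deriv (\<lambda>q. metric_in M g c q (Y q) (Z q))
    (metric_in M g c p (nabla \<Gamma> c X Y p) (Z p) + metric_in M g c p (Y p) (nabla \<Gamma> c X Z p)) p (X p)"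
  using assms(1)[unfolded levi_civita_def, THEN conjunct2, THEN conjunct2, rule_format,
      OF assms(2,3) conjI[OF assms(4) conjI[OF assms(5,6)]] assms(7)] .

text \<open>The Koszul formula in difference form: the difference of two Levi-Civita derivatives is symmetric in the
  first two and skew in the last two arguments.\<close>

lemma levi_civita_unique:
  assumes \<Gamma>: "levi_civita P g \<Gamma>" and \<Delta>: "levi_civita P g \<Delta>"
    and c: "c \<in> atlas P" "open (chart_image c)" and p: "p \<in> chart_image c"
    and m: "bilinear (metric_in P g c p)" "\<And>v w. metric_in P g c p v w = metric_in P g c p w v"
    and pos: "\<And>v. v \<noteq> 0 \<Longrightarrow> metric_in P g c p v v > 0"
  shows "\<Gamma> c p v w = \<Delta> c p v w"
proof -
  let ?m = "metric_in P g c p"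
  define T where "T v w = \<Gamma> c p v w - \<Delta> c p v w" for v w
  \<comment> \<open>The test fields are constant in the chart: their derivatives and brackets
    vanish, and only the Christoffel maps remain.\<close>
  have nabla_const: "nabla \<Gamma> c (\<lambda>q. v) (\<lambda>q. w) p = \<Gamma> c p v w" for \<Gamma> v w
    by (simp add: nabla_def dir_deriv_eq[OF has_dir_deriv_const])
  note sm = smooth_on_const[OF c(2)]
  have sym: "\<Gamma> c p v w = \<Gamma> c p w v" if "levi_civita P g \<Gamma>" for \<Gamma> v w
  proof -
    have "nabla \<Gamma> c (\<lambda>q. v) (\<lambda>q. w) p - nabla \<Gamma> c (\<lambda>q. w) (\<lambda>q. v) p = field_bracket (\<lambda>q. v) (\<lambda>q. w) p"
      by (rule levi_civita_torsion[OF that c(1) order_refl sm sm p])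
    then show ?thesis
      by (simp add: nabla_const field_bracket_def dir_deriv_eq[OF has_dir_deriv_const])
  qed
  have met: "has_dir_deriv (\<lambda>q. metric_in P g c q w z) (?m (\<Gamma> c p v w) z + ?m w (\<Gamma> c p v z)) p v"
    if "levi_civita P g \<Gamma>" for \<Gamma> v w z
  proof -
    have "has_dir_deriv (\<lambda>q. metric_in P g c q ((\<lambda>q. w) q) ((\<lambda>q. z) q))
        (?m (nabla \<Gamma> c (\<lambda>q. v) (\<lambda>q. w) p) ((\<lambda>q. z) p) + ?m ((\<lambda>q. w) p) (nabla \<Gamma> c (\<lambda>q. v) (\<lambda>q. z) p)) p ((\<lambda>q. v) p)"
      by (rule levi_civita_metric[OF that c(1) order_refl sm sm sm p])
    then show ?thesis by (simp add: nabla_const)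
  qed
  have skew: "?m (T v w) z = - ?m (T v z) w" for v w z
  proof -
    have "?m (\<Gamma> c p v w) z + ?m w (\<Gamma> c p v z) = ?m (\<Delta> c p v w) z + ?m w (\<Delta> c p v z)"
      by (rule has_dir_deriv_unique[OF met[OF \<Gamma>] met[OF \<Delta>]])
    then show ?thesis
      using m(2)[of w] by (simp add: T_def bilinear_lsub[OF m(1)])
  qed
  have Tsym: "T v w = T w v" for v w
    unfolding T_def using sym[OF \<Gamma>] sym[OF \<Delta>] by metis
  \<comment> \<open>Alternating skewness with symmetry, three times each, returns to the same
    expression with the opposite sign.\<close>
  have "?m (T v w) z = 0" for z
  proof -
    have "?m (T v w) z = - ?m (T z v) w" using skew[of v w z] Tsym by metis
    also have "\<dots> = ?m (T w z) v" using skew[of z v w] Tsym by (metis minus_minus)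
    also have "\<dots> = - ?m (T v w) z" using skew[of w z v] Tsym by metis
    finally show ?thesis by simp
  qed
  then have "T v w = 0" using pos by force
  then show ?thesis by (simp add: T_def)
qed

text \<open>\<open>adT\<close> is a parameter described by duality rather than the term
  \<open>transpose_of\<close>, so that the semidirect product can supply its explicit
  formula.\<close>

locale right_invariant_lie_group = C3_lie_group K P
  for K :: "('k, 'z) monoid_scheme" (structure) and P :: "('k, 'e::locally_convex_space) manifold" +
  fixes ip :: "'e \<Rightarrow> 'e \<Rightarrow> real" and adT :: "'e \<Rightarrow> 'e \<Rightarrow> 'e" and g :: "'k \<Rightarrow> 'e \<Rightarrow> 'e \<Rightarrow> real"
  assumes bounded_ip: "bounded_inner_product ip"
    and adT: "ip (adT X Y) Z = ip Y (ad K P X Z)"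
    and right_invariant: "right_invariant_metric K P ip g"
begin

lemma ip: "bilinear ip" "ip v w = ip w v" "v \<noteq> 0 \<Longrightarrow> ip v v > 0"
  using bounded_ip unfolding bounded_inner_product_def inner_product_def by auto

lemma ip_eqI: "(\<And>Z. ip X Z = ip Y Z) \<Longrightarrow> X = Y"
  using ip(3)[of "X - Y"] by (force simp: bilinear_lsub[OF ip(1)])

lemmas ip_simps = bilinear_ladd[OF ip(1)] bilinear_radd[OF ip(1)] bilinear_lmul[OF ip(1)] bilinear_rmul[OF ip(1)]
  bilinear_lsub[OF ip(1)] bilinear_rsub[OF ip(1)]

lemma ad_skew: "ad K P X Y = - ad K P Y X"
  by (simp add: ad_mixed)

lemma adT_bilinear: "bilinear adT"
  unfolding bilinear_def
  by (auto intro!: linearI ip_eqI simp: adT ip_simps bilinear_ladd[OF ad_bilinear] bilinear_lmul[OF ad_bilinear])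

text \<open>Right translation by the inverse carries the point to the unit, where the metric is
  \<open>ip\<close>. The passage to the preferred chart inside \<open>metric_in\<close> is absorbed
  by \<open>kappa_transition\<close>.\<close>

lemma metric_kappa:
  assumes c: "c \<in> atlas P" and p: "p \<in> chart_image c"
  shows "metric_in P g c p v w = ip (kappa c (p, v)) (kappa c (p, w))"
proof -
  let ?x = "chart_inv c p"
  have x: "?x \<in> carrier K" by (rule chart_inv_carrier[OF c p])
  then have xP: "?x \<in> points P" by (simp add: carrier)
  let ?d = "chart_at P ?x"
  have d: "?d \<in> atlas P" "?x \<in> chart_dom ?d"
    using C3_manifold_chart_at[OF manifold xP] C3_manifold_in_chart_at[OF manifold xP] .
  have R: "tangent_map P P (\<lambda>y. y \<otimes> inv ?x) ?x (tangent_map_in c ?d id ?x v) = kappa c (p, v)" for v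
    using kappa_transition[OF c d(1) chart_inv_in_dom[OF p] d(2), of v] x
    by (simp add: tangent_map_def tangent_map_in_rep coord_chart_inv[OF p] id_def)
  have "g (?x \<otimes> inv ?x) (tangent_map P P (\<lambda>y. y \<otimes> inv ?x) ?x v) (tangent_map P P (\<lambda>y. y \<otimes> inv ?x) ?x w) = g ?x v w" for v w
    using right_invariant x unfolding right_invariant_metric_def Let_def by blast
  then have "g ?x v w = ip (tangent_map P P (\<lambda>y. y \<otimes> inv ?x) ?x v) (tangent_map P P (\<lambda>y. y \<otimes> inv ?x) ?x w)" for v w
    using right_invariant x unfolding right_invariant_metric_def by simp
  then show ?thesis by (simp add: metric_in_def R)
qed

definition connection :: "'e \<Rightarrow> 'e \<Rightarrow> 'e" where
  "connection X Y = (1 / 2) *\<^sub>R (adT X Y + adT Y X - ad K P X Y)"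

lemma connection_diag: "connection X X = adT X X"
  by (simp only: connection_def ad_mixed diff_self diff_zero scaleR_half_double)

lemma connection_torsion: "connection X Y - connection Y X = - ad K P X Y"
proof -
  have "connection X Y - connection Y X = (1 / 2) *\<^sub>R (- ad K P X Y + - ad K P X Y)"
    unfolding connection_def ad_skew[of Y X] scaleR_right_diff_distrib[symmetric] by simp
  then show ?thesis by (simp only: scaleR_half_double)
qed

text \<open>Twice the pairing of \<open>connection X Y\<close> with \<open>Z\<close> is <Y,[X,Z]> +
  <X,[Y,Z]> - <[X,Y],Z>, and this is skew in \<open>Y\<close> and \<open>Z\<close>.\<close>

lemma connection_metric: "ip (connection X Y) Z + ip Y (connection X Z) = 0"
proof -
  have *: "ip (connection X Y) Z = (ip Y (ad K P X Z) + ip X (ad K P Y Z) - ip (ad K P X Y) Z) / 2" for Y Z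
    by (simp add: connection_def ip_simps adT)
  have "ip X (ad K P Z Y) = - ip X (ad K P Y Z)"
    using ad_skew[of Z Y] bilinear_rneg[OF ip(1)] by simp
  then show ?thesis
    unfolding ip(2)[of Y "connection X Z"] * ip(2)[of "ad K P X Y" Z] ip(2)[of "ad K P X Z" Y]
    by (simp add: field_simps)
qed

lemma connection_bilinear: "bilinear connection"
  unfolding bilinear_def connection_def
  by (auto intro!: linearI simp: bilinear_ladd[OF ad_bilinear] bilinear_lmul[OF ad_bilinear] bilinear_radd[OF ad_bilinear]
      bilinear_rmul[OF ad_bilinear] bilinear_ladd[OF adT_bilinear] bilinear_lmul[OF adT_bilinear]
      bilinear_radd[OF adT_bilinear] bilinear_rmul[OF adT_bilinear] algebra_simps)

text \<open>By the product rule, d(kappa Y)(X) is \<open>dkappa\<close> on X and Y plus kappa of the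
  derivative of Y along X. The latter is the derivative term of \<open>nabla\<close>; applying the
  inverse of the form to what is left gives this expression.\<close>

definition christoffel :: "('k, 'e) christoffel" where
  "christoffel c p v w = kappa_inv c p (dkappa c p v w + connection (kappa c (p, v)) (kappa c (p, w)))"

lemma kappa_christoffel:
  assumes "c \<in> atlas P" "p \<in> chart_image c"
  shows "kappa c (p, christoffel c p v w) = dkappa c p v w + connection (kappa c (p, v)) (kappa c (p, w))"
  unfolding christoffel_def by (rule kappa_inverse(1)[OF assms])

lemma kappa_eqI:
  assumes "c \<in> atlas P" "p \<in> chart_image c" "kappa c (p, v) = kappa c (p, w)"
  shows "v = w"
  using kappa_inverse(2)[OF assms(1,2)] assms(3) by metis

lemma christoffel_covariant: "covariant_derivative P christoffel"
  unfolding covariant_derivative_def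
proof (intro conjI ballI allI)
  fix c p assume c: "c \<in> atlas P" and p: "p \<in> chart_image c"
  note lin = kappa_linear[OF c p]
  note simps = linear_add[OF lin] linear_scale[OF lin] linear_add[OF kappa_inverse(3)[OF c p]] linear_scale[OF kappa_inverse(3)[OF c p]]
    bilinear_ladd[OF dkappa_bilinear[OF c p]] bilinear_radd[OF dkappa_bilinear[OF c p]]
    bilinear_lmul[OF dkappa_bilinear[OF c p]] bilinear_rmul[OF dkappa_bilinear[OF c p]]
    bilinear_ladd[OF connection_bilinear] bilinear_radd[OF connection_bilinear]
    bilinear_lmul[OF connection_bilinear] bilinear_rmul[OF connection_bilinear]
  show "bilinear (christoffel c p)"
    unfolding bilinear_def christoffel_def
    by (intro conjI allI linearI) (simp_all add: simps algebra_simps)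
next
  fix c d p v w
  assume c: "c \<in> atlas P" and d: "d \<in> atlas P" and "p \<in> coord c ` (chart_dom c \<inter> chart_dom d)"
  then have p: "p \<in> chart_image c" and xd: "chart_inv c p \<in> chart_dom d"
    using chart_inv_coord[OF inj[OF c]] by auto
  \<comment> \<open>The chart change is written as right translation by the unit, so that the
    transformation rules of \<open>kappa\<close> and \<open>dkappa\<close> apply to it.\<close>
  define \<phi> where "\<phi> = rep c d (\<lambda>y. y \<otimes> \<one>)"
  let ?\<theta> = "coord d \<circ> chart_inv c"
  have pd: "p \<in> rep_dom c d (\<lambda>y. y \<otimes> \<one>)"
    using p xd by (simp add: rep_dom_def chart_inv_carrier[OF c])
  note one = one_closed
  have \<phi>: "C3_on (rep_dom c d (\<lambda>y. y \<otimes> \<one>)) \<phi>"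
    unfolding \<phi>_def by (rule right_translation_rep[OF one c d])
  have eq: "?\<theta> q = \<phi> q" if "q \<in> chart_image c" for q
    using that by (simp add: \<phi>_def rep_def chart_inv_carrier[OF c])
  have d1: "dir_deriv ?\<theta> q w = dd \<phi> (q, w)" if "q \<in> chart_image c" for q w
  proof -
    have "dir_deriv ?\<theta> q w = dir_deriv \<phi> q w"
      by (rule dir_deriv_cong[OF image_open[OF c] that]) (rule eq)
    then show ?thesis by (simp add: dd_def)
  qed
  have d2: "dir_deriv (\<lambda>q. dir_deriv ?\<theta> q w) p v = dd (dd \<phi>) ((p, w), (v, 0))"
  proof -
    have "dir_deriv (\<lambda>q. dir_deriv ?\<theta> q w) p v = dir_deriv (\<lambda>q. dd \<phi> (q, w)) p v"
      by (rule dir_deriv_cong[OF image_open[OF c] p]) (rule d1)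
    also have "\<dots> = dd (dd \<phi>) ((p, w), (v, 0))"
      by (rule dir_deriv_eq, rule C1_on_partial1[OF C2_on_dd[OF C3_on_C2[OF \<phi>]]]) (use pd in simp)
    finally show ?thesis .
  qed
  have \<phi>p: "\<phi> p \<in> chart_image d"
    using pd by (auto simp: \<phi>_def rep_def rep_dom_def)
  have "dd \<phi> (p, christoffel c p v w) = dd (dd \<phi>) ((p, w), (v, 0)) + christoffel d (\<phi> p) (dd \<phi> (p, v)) (dd \<phi> (p, w))"
  proof (rule kappa_eqI[OF d \<phi>p])
    note k = kappa_right_translation[OF one c d pd, folded \<phi>_def]
    show "kappa d (\<phi> p, dd \<phi> (p, christoffel c p v w)) =
        kappa d (\<phi> p, dd (dd \<phi>) ((p, w), (v, 0)) + christoffel d (\<phi> p) (dd \<phi> (p, v)) (dd \<phi> (p, w)))"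
      unfolding k[symmetric] linear_add[OF kappa_linear[OF d \<phi>p]] kappa_christoffel[OF d \<phi>p] kappa_christoffel[OF c p]
      by (simp add: dkappa_right_translation[OF one c d pd, folded \<phi>_def])
  qed
  then show "let \<theta> = ?\<theta> in dir_deriv \<theta> p (christoffel c p v w) =
        dir_deriv (\<lambda>q. dir_deriv \<theta> q w) p v + christoffel d (\<theta> p) (dir_deriv \<theta> p v) (dir_deriv \<theta> p w)"
    unfolding Let_def d2 d1[OF p] eq[OF p] .
qed

text \<open>Under antisymmetrisation \<open>dkappa\<close> contributes the bracket, by the structure
  equation, and \<open>connection\<close> contributes minus the bracket.\<close>

lemma christoffel_symmetric:
  assumes c: "c \<in> atlas P" and p: "p \<in> chart_image c"
  shows "christoffel c p v w = christoffel c p w v"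
proof (rule kappa_eqI[OF c p])
  show "kappa c (p, christoffel c p v w) = kappa c (p, christoffel c p w v)"
    using structure_equation[OF c p, of v w] connection_torsion[of "kappa c (p, v)" "kappa c (p, w)"]
    unfolding kappa_christoffel[OF c p] by (simp add: algebra_simps)
qed

text \<open>Read through \<open>kappa\<close>, the metric is the constant form \<open>ip\<close>.
  Compatibility is then the product rule for \<open>ip\<close> combined with
  \<open>connection_metric\<close>, and the torsion condition is the symmetry of
  \<open>christoffel\<close>.\<close>

lemma levi_civita_christoffel: "levi_civita P g christoffel"
  unfolding levi_civita_def
proof (intro conjI ballI allI impI christoffel_covariant)
  fix c W p and X Y :: "'e \<Rightarrow> 'e"
  assume c: "c \<in> atlas P" and W: "W \<subseteq> chart_image c" and p: "p \<in> W"
  then show "nabla christoffel c X Y p - nabla christoffel c Y X p = field_bracket X Y p"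
    using christoffel_symmetric[OF c, of p "X p" "Y p"] by (auto simp: nabla_def field_bracket_def)
next
  fix c W p and X Y Z :: "'e \<Rightarrow> 'e"
  assume c: "c \<in> atlas P" and W: "W \<subseteq> chart_image c" and p: "p \<in> W"
    and "smooth_on W X \<and> smooth_on W Y \<and> smooth_on W Z"
  then have Y: "C2_on W Y" and Z: "C2_on W Z"
    using smooth_on_C3_on C3_on_C2 by blast+
  have pc: "p \<in> chart_image c" using W p by blast
  have oW: "open W" using C1_on_open[OF C2_on_C1[OF Y]] .
  have F: "C2_on W (\<lambda>q. kappa c (q, Y q))" if "C2_on W Y" for Y
    by (rule C2_on_compose[OF kappa_C2[OF c] C2_on_Pair[OF C2_on_linear[OF continuous_linear_id oW] that]])
      (use W in auto)
  have dF: "dd (\<lambda>q. kappa c (q, Y q)) (p, v) = dkappa c p v (Y p) + kappa c (p, dd Y (p, v))" if "C2_on W Y" for Y v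
  proof -
    have "has_dir_deriv (\<lambda>q. kappa c (q, Y q)) (dd (kappa c) ((p, Y p), (v, dd Y (p, v)))) p v"
      by (rule C1_on_chain[OF kappa_C1[OF c], of "\<lambda>q. (q, Y q)"])
        (use pc p in \<open>auto intro!: has_dir_deriv_Pair has_dir_deriv_linear[OF linear_ident] C1_on_deriv[OF C2_on_C1[OF that]]\<close>)
    then show ?thesis by (simp add: dd_eq dd_kappa[OF c pc])
  qed
  have dd_apply: "dir_deriv Y p v = dd Y (p, v)" for Y :: "'e \<Rightarrow> 'e" and v by (simp add: dd_def)
  have nab: "kappa c (p, nabla christoffel c X Y p) =
      dd (\<lambda>q. kappa c (q, Y q)) (p, X p) + connection (kappa c (p, X p)) (kappa c (p, Y p))" if "C2_on W Y" for Y
    by (simp add: dF[OF that] nabla_def linear_add[OF kappa_linear[OF c pc]] kappa_christoffel[OF c pc] dd_apply)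
  have "has_dir_deriv (\<lambda>q. ip (kappa c (q, Y q)) (kappa c (q, Z q)))
      (ip (dd (\<lambda>q. kappa c (q, Y q)) (p, X p)) (kappa c (p, Z p)) + ip (kappa c (p, Y p)) (dd (\<lambda>q. kappa c (q, Z q)) (p, X p))) p (X p)"
    by (rule bounded_inner_product_has_dir_deriv[OF bounded_ip F[OF Y] F[OF Z] p])
  moreover have "metric_in P g c p (nabla christoffel c X Y p) (Z p) + metric_in P g c p (Y p) (nabla christoffel c X Z p)
      = ip (dd (\<lambda>q. kappa c (q, Y q)) (p, X p)) (kappa c (p, Z p)) + ip (kappa c (p, Y p)) (dd (\<lambda>q. kappa c (q, Z q)) (p, X p))"
    using connection_metric[of "kappa c (p, X p)" "kappa c (p, Y p)" "kappa c (p, Z p)"]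
    by (simp add: metric_kappa[OF c pc] nab[OF Y] nab[OF Z] ip_simps)
  ultimately have "has_dir_deriv (\<lambda>q. ip (kappa c (q, Y q)) (kappa c (q, Z q)))
      (metric_in P g c p (nabla christoffel c X Y p) (Z p) + metric_in P g c p (Y p) (nabla christoffel c X Z p)) p (X p)"
    by simp
  then show "has_dir_deriv (\<lambda>q. metric_in P g c q (Y q) (Z q))
      (metric_in P g c p (nabla christoffel c X Y p) (Z p) + metric_in P g c p (Y p) (nabla christoffel c X Z p)) p (X p)"
    by (rule has_dir_deriv_cong[OF oW p, THEN iffD1, rotated]) (use W in \<open>auto simp: metric_kappa[OF c]\<close>)
qed

lemma levi_civita_eq_christoffel:
  assumes "levi_civita P g \<Gamma>" and c: "c \<in> atlas P" and p: "p \<in> chart_image c"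
  shows "\<Gamma> c p v w = christoffel c p v w"
proof (rule levi_civita_unique[OF assms(1) levi_civita_christoffel c image_open[OF c] p])
  note lin = kappa_linear[OF c p]
  show "bilinear (metric_in P g c p)"
    unfolding bilinear_def
    by (auto intro!: linearI simp: metric_kappa[OF c p] linear_add[OF lin] linear_scale[OF lin] ip_simps)
  show "metric_in P g c p v w = metric_in P g c p w v" for v w
    by (simp add: metric_kappa[OF c p] ip(2))
  show "metric_in P g c p v v > 0" if "v \<noteq> 0" for v
    unfolding metric_kappa[OF c p]
    by (rule ip(3)) (use that kappa_eqI[OF c p, of v 0] linear_0[OF lin] in auto)
qed

end

section \<open>The geodesic equation\<close>

lemma has_curve_deriv_Pair_iff:
  "has_curve_deriv (\<lambda>s. (c s, d s)) (D, E) t I \<longleftrightarrow> has_curve_deriv c D t I \<and> has_curve_deriv d E t I"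
proof
  assume "has_curve_deriv (\<lambda>s. (c s, d s)) (D, E) t I"
  then have *: "((\<lambda>s. ((c s - c t) /\<^sub>R (s - t), (d s - d t) /\<^sub>R (s - t))) \<longlongrightarrow> (D, E)) (at t within I)"
    by (simp add: has_curve_deriv_def scaleR_prod_def)
  show "has_curve_deriv c D t I \<and> has_curve_deriv d E t I"
    using tendsto_fst[OF *] tendsto_snd[OF *] by (simp add: has_curve_deriv_def)
next
  assume "has_curve_deriv c D t I \<and> has_curve_deriv d E t I"
  then show "has_curve_deriv (\<lambda>s. (c s, d s)) (D, E) t I"
    unfolding has_curve_deriv_def by (auto intro: tendsto_Pair simp: scaleR_prod_def)
qed

lemma has_curve_deriv_cong:
  assumes "t \<in> I" "\<And>s. s \<in> I \<Longrightarrow> c s = d s" "has_curve_deriv c D t I"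
  shows "has_curve_deriv d D t I"
  using assms(3) unfolding has_curve_deriv_def
  by (rule Lim_transform_eventually) (use assms(1,2) in \<open>auto simp: eventually_at_filter\<close>)

lemma curve_deriv_eq:
  "has_curve_deriv c D t I \<Longrightarrow> at t within I \<noteq> bot \<Longrightarrow> curve_deriv I c t = D"
  unfolding has_curve_deriv_def curve_deriv_def by (rule tendsto_Lim)

lemma has_curve_deriv_unique:
  "has_curve_deriv c D t I \<Longrightarrow> has_curve_deriv c D' t I \<Longrightarrow> at t within I \<noteq> bot \<Longrightarrow> D = D'"
  unfolding has_curve_deriv_def by (rule tendsto_unique)

text \<open>The times at which a curve lies in a given chart form a relatively open set, so
  derivatives along it agree with those along the whole interval, including one-sided ones at end
  points.\<close>

lemma at_within_openin:
  fixes t :: "'a::topological_space"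
  assumes "openin (top_of_set I) J" "t \<in> J"
  shows "at t within J = at t within I"
proof -
  obtain T where T: "open T" "J = I \<inter> T" using assms(1) by (auto simp: openin_open)
  show ?thesis
    by (rule at_within_nhd[of t T]) (use T assms in auto)
qed

lemma has_curve_deriv_openin:
  assumes "openin (top_of_set I) J" "t \<in> J"
  shows "has_curve_deriv c D t J \<longleftrightarrow> has_curve_deriv c D t I"
  unfolding has_curve_deriv_def at_within_openin[OF assms] ..

lemma smooth_curve_on_derivs:
  assumes "smooth_curve_on J x" "t \<in> J" "at t within J \<noteq> bot"
  shows "has_curve_deriv x (curve_deriv J x t) t J"
    and "has_curve_deriv (curve_deriv J x) (curve_deriv J (curve_deriv J x) t) t J"
proof -
  have *: "\<exists>D. has_curve_deriv ((curve_deriv J ^^ n) x) D t J" for n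
    using assms(1,2) unfolding smooth_curve_on_def by blast
  show "has_curve_deriv x (curve_deriv J x t) t J"
    using *[of 0] curve_deriv_eq[OF _ assms(3)] by fastforce
  show "has_curve_deriv (curve_deriv J x) (curve_deriv J (curve_deriv J x) t) t J"
    using *[of 1] curve_deriv_eq[OF _ assms(3)] by fastforce
qed

context right_invariant_lie_group
begin

text \<open>The velocity is taken in the preferred chart at \<open>k t\<close>, which may change
  with \<open>t\<close>. In one fixed chart \<open>c\<close> the right logarithmic derivative
  becomes a formula that can be differentiated in time.\<close>

lemma right_log_deriv_kappa:
  assumes k: "smooth_curve_in P I k" and t: "t \<in> I" "at t within I \<noteq> bot"
    and c: "c \<in> atlas P" "k t \<in> chart_dom c"
  defines "J \<equiv> {s \<in> I. k s \<in> chart_dom c}"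
  shows "right_log_deriv K P I k t = kappa c (coord c (k t), curve_deriv J (coord c \<circ> k) t)"
proof -
  have J: "openin (top_of_set I) J" and x: "smooth_curve_on J (coord c \<circ> k)" and kP: "k t \<in> points P"
    using k c(1) t(1) unfolding smooth_curve_in_def J_def by auto
  have tJ: "t \<in> J" using t c by (simp add: J_def)
  have nt: "at t within J \<noteq> bot" unfolding at_within_openin[OF J tJ] by (rule t(2))
  let ?d = "chart_at P (k t)" and ?v = "curve_deriv J (coord c \<circ> k) t"
  have d: "?d \<in> atlas P" "k t \<in> chart_dom ?d"
    using C3_manifold_chart_at[OF manifold kP] C3_manifold_in_chart_at[OF manifold kP] .
  let ?\<theta> = "rep c ?d (\<lambda>x. x)"
  note \<theta> = C3_on_C1[OF C3_manifold_transition[OF manifold c(1) d(1)]]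
  have ci: "chart_inv c (coord c (k s)) = k s" if "s \<in> J" for s
    using that by (intro chart_inv_coord[OF inj[OF c(1)]]) (simp add: J_def)
  have "coord c (k t) \<in> rep_dom c ?d (\<lambda>x. x)"
    using c d by (auto simp: rep_dom_def ci[OF tJ])
  then have "has_curve_deriv (\<lambda>s. ?\<theta> ((coord c \<circ> k) s)) (dd ?\<theta> ((coord c \<circ> k) t, ?v)) t J"
    by (intro C1_on_curve[OF \<theta>] smooth_curve_on_derivs(1)[OF x tJ nt]) simp
  then have "has_curve_deriv (coord ?d \<circ> k) (dd ?\<theta> ((coord c \<circ> k) t, ?v)) t J"
  proof (rule has_curve_deriv_cong[OF tJ, rotated])
    show "?\<theta> ((coord c \<circ> k) s) = (coord ?d \<circ> k) s" if "s \<in> J" for s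
      using ci[OF that] by (simp add: rep_def)
  qed
  then have "velocity P I k t = dd ?\<theta> (coord c (k t), ?v)"
    unfolding velocity_def has_curve_deriv_openin[OF J tJ] using curve_deriv_eq[OF _ t(2)] by fastforce
  then have "right_log_deriv K P I k t = dd (rep ?d c0 (\<lambda>y. y \<otimes> inv (k t))) (coord ?d (k t), dd ?\<theta> (coord c (k t), ?v))"
    using kP by (simp add: right_log_deriv_def tangent_map_def tangent_map_in_rep carrier[symmetric])
  also have "\<dots> = kappa c (coord c (k t), ?v)"
    by (rule kappa_transition[OF c(1) d(1) c(2) d(2)])
  finally show ?thesis .
qed

text \<open>An identity for every smooth curve. Differentiating \<open>U = kappa c (x, v)\<close>
  gives \<open>dkappa c x v v\<close> plus \<open>kappa\<close> of the second derivative;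
  \<open>kappa_christoffel\<close> and \<open>connection_diag\<close> turn this into
  \<open>kappa\<close> of the covariant acceleration minus \<open>adT U U\<close>.\<close>

lemma right_log_deriv_has_curve_deriv:
  assumes k: "smooth_curve_in P I k" and nontriv: "\<And>t. t \<in> I \<Longrightarrow> at t within I \<noteq> bot"
    and U: "\<And>t. t \<in> I \<Longrightarrow> right_log_deriv K P I k t = U t"
    and t: "t \<in> I" and c: "c \<in> atlas P" "k t \<in> chart_dom c"
  defines "J \<equiv> {s \<in> I. k s \<in> chart_dom c}"
  defines "x \<equiv> coord c \<circ> k"
  defines "v \<equiv> curve_deriv J x"
  shows "has_curve_deriv U
    (kappa c (x t, curve_deriv J v t + christoffel c (x t) (v t) (v t)) - adT (U t) (U t)) t I"
proof -
  have J: "openin (top_of_set I) J" and x: "smooth_curve_on J x"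
    using k c(1) unfolding smooth_curve_in_def J_def x_def by auto
  have tJ: "t \<in> J" using t c by (simp add: J_def)
  have nt: "at t within J \<noteq> bot" unfolding at_within_openin[OF J tJ] by (rule nontriv[OF t])
  have xt: "x t \<in> chart_image c" using c by (simp add: x_def)
  have Us: "U s = kappa c (x s, v s)" if "s \<in> J" for s
    using that right_log_deriv_kappa[OF k _ nontriv c(1), of s] U[of s]
    by (simp add: J_def x_def v_def)
  have "has_curve_deriv (\<lambda>s. (x s, v s)) (v t, curve_deriv J v t) t J"
    unfolding has_curve_deriv_Pair_iff v_def using smooth_curve_on_derivs[OF x tJ nt] by simp
  then have "has_curve_deriv (\<lambda>s. kappa c (x s, v s)) (dd (kappa c) ((x t, v t), (v t, curve_deriv J v t))) t J"
    by (intro C1_on_curve[OF kappa_C1[OF c(1)]]) (use xt in simp)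
  then have "has_curve_deriv U (dd (kappa c) ((x t, v t), (v t, curve_deriv J v t))) t J"
    by (rule has_curve_deriv_cong[OF tJ, rotated]) (simp add: Us)
  moreover have "dd (kappa c) ((x t, v t), (v t, curve_deriv J v t)) =
      kappa c (x t, curve_deriv J v t + christoffel c (x t) (v t) (v t)) - adT (U t) (U t)"
    unfolding linear_add[OF kappa_linear[OF c(1) xt]] kappa_christoffel[OF c(1) xt] Us[OF tJ] connection_diag
      dd_kappa[OF c(1) xt] by simp
  ultimately show ?thesis unfolding has_curve_deriv_openin[OF J tJ] by simp
qed

text \<open>A geodesic may come with any Levi-Civita derivative, and uniqueness identifies it with
  \<open>christoffel\<close>; conversely \<open>christoffel\<close> is the witness. The derivative
  of \<open>U\<close> determines \<open>kappa\<close> of the covariant acceleration, and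
  \<open>kappa\<close> is injective at each point.\<close>

theorem geodesic_iff_right_log_deriv:
  assumes k: "smooth_curve_in P I k" and nontriv: "\<And>t. t \<in> I \<Longrightarrow> at t within I \<noteq> bot"
    and U: "\<And>t. t \<in> I \<Longrightarrow> right_log_deriv K P I k t = U t"
  shows "geodesic P g I k \<longleftrightarrow> (\<forall>t\<in>I. has_curve_deriv U (- adT (U t) (U t)) t I)"
proof
  assume "geodesic P g I k"
  then obtain \<Gamma> where \<Gamma>: "levi_civita P g \<Gamma>"
    and eq: "\<And>c t. c \<in> atlas P \<Longrightarrow> t \<in> I \<Longrightarrow> k t \<in> chart_dom c \<Longrightarrow>
      (let J = {s \<in> I. k s \<in> chart_dom c}; x = coord c \<circ> k; v = curve_deriv J x in
        curve_deriv J v t + \<Gamma> c (x t) (v t) (v t) = 0)"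
    unfolding geodesic_def by blast
  show "\<forall>t\<in>I. has_curve_deriv U (- adT (U t) (U t)) t I"
  proof
    fix t assume t: "t \<in> I"
    then have "k t \<in> points P" using k unfolding smooth_curve_in_def by blast
    then obtain c where c: "c \<in> atlas P" "k t \<in> chart_dom c"
      using C3_manifold_chart_at[OF manifold] C3_manifold_in_chart_at[OF manifold] by blast
    have "coord c (k t) \<in> chart_image c" using c by simp
    then show "has_curve_deriv U (- adT (U t) (U t)) t I"
      using right_log_deriv_has_curve_deriv[OF k nontriv U t c] eq[OF c(1) t c(2)]
        linear_0[OF kappa_linear[OF c(1), of "coord c (k t)"]]
      by (simp add: Let_def levi_civita_eq_christoffel[OF \<Gamma> c(1)])
  qed
next
  assume eq: "\<forall>t\<in>I. has_curve_deriv U (- adT (U t) (U t)) t I"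
  have "let J = {s \<in> I. k s \<in> chart_dom c}; x = coord c \<circ> k; v = curve_deriv J x in
      curve_deriv J v t + christoffel c (x t) (v t) (v t) = 0"
    if c: "c \<in> atlas P" "k t \<in> chart_dom c" and t: "t \<in> I" for c t
    unfolding Let_def
  proof (rule kappa_eqI[OF c(1)])
    show xt: "(coord c \<circ> k) t \<in> chart_image c" using c by simp
    let ?J = "{s \<in> I. k s \<in> chart_dom c}"
    let ?a = "curve_deriv ?J (curve_deriv ?J (coord c \<circ> k)) t +
      christoffel c ((coord c \<circ> k) t) (curve_deriv ?J (coord c \<circ> k) t) (curve_deriv ?J (coord c \<circ> k) t)"
    have "kappa c ((coord c \<circ> k) t, ?a) - adT (U t) (U t) = - adT (U t) (U t)"
      using right_log_deriv_has_curve_deriv[OF k nontriv U t c] eq t nontriv[OF t]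
      by (blast intro: has_curve_deriv_unique)
    then show "kappa c ((coord c \<circ> k) t, ?a) = kappa c ((coord c \<circ> k) t, 0)"
      using linear_0[OF kappa_linear[OF c(1) xt]] by simp
  qed
  then show "geodesic P g I k"
    unfolding geodesic_def using k levi_civita_christoffel by blast
qed

end

section \<open>Semidirect products\<close>

lemma lie_group_C3:
  assumes "lie_group G M"
  shows "C3_lie_group G M"
proof -
  have L: "group G" "smooth_manifold M" "carrier G = points M"
    "smooth_map (prod_manifold M M) M (\<lambda>(x, y). x \<otimes>\<^bsub>G\<^esub> y)" "smooth_map M M (\<lambda>x. inv\<^bsub>G\<^esub> x)"
    using assms unfolding lie_group_def by blast+
  note M = smooth_manifold_C3[OF L(2)]
  show ?thesis
    using smooth_map_C3[OF C3_manifold_prod[OF M M] L(4)] smooth_map_C3[OF M L(5)] L(1,3) M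
    by (simp add: C3_lie_group_def C3_lie_group_axioms_def case_prod_unfold)
qed

locale lie_group_action = G: C3_lie_group G M + H: C3_lie_group H N
  for G :: "'g monoid" and M :: "('g, 'e::locally_convex_space) manifold"
    and H :: "'h monoid" and N :: "('h, 'f::locally_convex_space) manifold" +
  fixes B :: "'g \<Rightarrow> 'h \<Rightarrow> 'h"
  assumes action: "smooth_action_by_homs G M H N B"
begin

abbreviation "SP \<equiv> semidirect G H B"
abbreviation "SM \<equiv> prod_manifold M N"

lemma B_closed: "g \<in> carrier G \<Longrightarrow> x \<in> carrier H \<Longrightarrow> B g x \<in> carrier H"
  and B_mult: "g \<in> carrier G \<Longrightarrow> x \<in> carrier H \<Longrightarrow> y \<in> carrier H \<Longrightarrow> B g (x \<otimes>\<^bsub>H\<^esub> y) = B g x \<otimes>\<^bsub>H\<^esub> B g y"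
  and B_one: "x \<in> carrier H \<Longrightarrow> B \<one>\<^bsub>G\<^esub> x = x"
  and B_comp: "g \<in> carrier G \<Longrightarrow> g' \<in> carrier G \<Longrightarrow> x \<in> carrier H \<Longrightarrow> B (g \<otimes>\<^bsub>G\<^esub> g') x = B g (B g' x)"
  using action unfolding smooth_action_by_homs_def hom_def by auto

lemma B_unit: "g \<in> carrier G \<Longrightarrow> B g \<one>\<^bsub>H\<^esub> = \<one>\<^bsub>H\<^esub>"
proof -
  assume g: "g \<in> carrier G"
  then have "B g \<one>\<^bsub>H\<^esub> \<otimes>\<^bsub>H\<^esub> B g \<one>\<^bsub>H\<^esub> = B g \<one>\<^bsub>H\<^esub>" using B_mult[of g "\<one>\<^bsub>H\<^esub>" "\<one>\<^bsub>H\<^esub>"] by simp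
  then show ?thesis using B_closed[OF g, of "\<one>\<^bsub>H\<^esub>"] by (metis H.one_closed H.l_cancel_one')
qed

lemma B_C3: "C3_map SM N (\<lambda>z. B (fst z) (snd z))"
proof -
  have "smooth_map SM N (\<lambda>z. B (fst z) (snd z))"
    using action by (simp add: smooth_action_by_homs_def case_prod_unfold)
  then show ?thesis by (rule smooth_map_C3[OF C3_manifold_prod[OF G.manifold H.manifold]])
qed

lemma SP_simps:
  "carrier SP = carrier G \<times> carrier H"
  "(g1, h1) \<otimes>\<^bsub>SP\<^esub> (g2, h2) = (g1 \<otimes>\<^bsub>G\<^esub> g2, h1 \<otimes>\<^bsub>H\<^esub> B g1 h2)"
  "\<one>\<^bsub>SP\<^esub> = (\<one>\<^bsub>G\<^esub>, \<one>\<^bsub>H\<^esub>)"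
  by (auto simp: semidirect_def)

lemma SP_l_inv:
  assumes "g \<in> carrier G" "h \<in> carrier H"
  shows "(inv\<^bsub>G\<^esub> g, B (inv\<^bsub>G\<^esub> g) (inv\<^bsub>H\<^esub> h)) \<otimes>\<^bsub>SP\<^esub> (g, h) = \<one>\<^bsub>SP\<^esub>"
  using assms B_mult[of "inv\<^bsub>G\<^esub> g" "inv\<^bsub>H\<^esub> h" h] by (simp add: SP_simps B_unit)

lemma SP_group: "group SP"
proof (rule groupI)
  show "\<And>x. x \<in> carrier SP \<Longrightarrow> \<exists>y\<in>carrier SP. y \<otimes>\<^bsub>SP\<^esub> x = \<one>\<^bsub>SP\<^esub>"
    using SP_l_inv by (force simp: SP_simps(1) B_closed)
qed (auto simp: SP_simps B_closed B_mult B_one B_comp G.m_assoc H.m_assoc)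

lemma SP_inv:
  "g \<in> carrier G \<Longrightarrow> h \<in> carrier H \<Longrightarrow> inv\<^bsub>SP\<^esub> (g, h) = (inv\<^bsub>G\<^esub> g, B (inv\<^bsub>G\<^esub> g) (inv\<^bsub>H\<^esub> h))"
  by (rule group.inv_equality[OF SP_group SP_l_inv]) (auto simp: SP_simps B_closed)

lemma SP_C3_lie_group: "C3_lie_group SP SM"
proof (rule C3_lie_group.intro[OF SP_group], rule C3_lie_group_axioms.intro)
  note MN = G.manifold H.manifold
  show SM: "C3_manifold SM" by (rule C3_manifold_prod[OF MN])
  note PP = C3_manifold_prod[OF SM SM] and MM = C3_manifold_prod[OF G.manifold G.manifold]
    and NN = C3_manifold_prod[OF H.manifold H.manifold]
  show "carrier SP = points SM" by (simp add: SP_simps prod_manifold_simps G.carrier H.carrier)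
  note fst1 = C3_map_fst[OF SM SM] and snd1 = C3_map_snd[OF SM SM]
  note g = C3_map_fst[OF MN] and h = C3_map_snd[OF MN]
  have g1: "C3_map (prod_manifold SM SM) M (\<lambda>z. fst (fst z))" by (rule C3_map_compose[OF SM PP g fst1])
  have g2: "C3_map (prod_manifold SM SM) M (\<lambda>z. fst (snd z))" by (rule C3_map_compose[OF SM PP g snd1])
  have h1: "C3_map (prod_manifold SM SM) N (\<lambda>z. snd (fst z))" by (rule C3_map_compose[OF SM PP h fst1])
  have h2: "C3_map (prod_manifold SM SM) N (\<lambda>z. snd (snd z))" by (rule C3_map_compose[OF SM PP h snd1])
  have "C3_map (prod_manifold SM SM) SM
      (\<lambda>z. (fst (fst z) \<otimes>\<^bsub>G\<^esub> fst (snd z), snd (fst z) \<otimes>\<^bsub>H\<^esub> B (fst (fst z)) (snd (snd z))))"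
    using C3_map_Pair[OF C3_map_compose[OF MM PP G.mult C3_map_Pair[OF g1 g2]]
        C3_map_compose[OF NN PP H.mult C3_map_Pair[OF h1 C3_map_compose[OF SM PP B_C3 C3_map_Pair[OF g1 h2]]]]]
    by simp
  then show "C3_map (prod_manifold SM SM) SM (\<lambda>z. fst z \<otimes>\<^bsub>SP\<^esub> snd z)"
    by (simp add: semidirect_def case_prod_beta)
  note gi = C3_map_compose[OF G.manifold SM G.inverse g] and hi = C3_map_compose[OF H.manifold SM H.inverse h]
  have "C3_map SM SM (\<lambda>z. (inv\<^bsub>G\<^esub> fst z, B (inv\<^bsub>G\<^esub> fst z) (inv\<^bsub>H\<^esub> snd z)))"
    using C3_map_Pair[OF gi C3_map_compose[OF SM SM B_C3 C3_map_Pair[OF gi hi]]] by simp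
  then show "C3_map SM SM (\<lambda>x. inv\<^bsub>SP\<^esub> x)"
    by (rule C3_map_cong[OF SM]) (auto simp: prod_manifold_simps G.carrier[symmetric] H.carrier[symmetric] SP_inv)
qed

end

sublocale lie_group_action \<subseteq> S: C3_lie_group SP SM
  by (rule SP_C3_lie_group)

context lie_group_action
begin

section \<open>The bracket of the semidirect product\<close>

lemma S_c0: "S.c0 = prod_chart G.c0 H.c0"
  by (simp add: SP_simps prod_manifold_simps)

abbreviation "b \<equiv> algebra_action G M H N B"

text \<open>\<open>algebra_action\<close> is defined through a limit, and this shows that the limit
  exists: the tangent map of \<open>B g\<close> at the unit is a partial derivative of the action in
  charts, hence itself differentiable in \<open>g\<close>.\<close>

lemma group_deriv_has_dir_deriv:
  "has_dir_deriv (\<lambda>p. group_deriv H N B (chart_inv G.c0 p) Y) (b X Y) G.e0 X"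
proof -
  let ?O = "{(p, q). p \<in> chart_image G.c0 \<and> q \<in> chart_image H.c0 \<and>
    B (fst (chart_inv G.c0 p, chart_inv H.c0 q)) (snd (chart_inv G.c0 p, chart_inv H.c0 q)) \<in> chart_dom H.c0}"
  let ?f = "\<lambda>(p, q). coord H.c0 (B (fst (chart_inv G.c0 p, chart_inv H.c0 q)) (snd (chart_inv G.c0 p, chart_inv H.c0 q)))"
  have f: "C3_on ?O ?f"
    by (rule C3_map_prod_rep[OF G.manifold H.manifold B_C3 G.c0(1) H.c0(1) H.c0(1)])
  have pO: "(p, H.e0) \<in> ?O" if "p \<in> chart_image G.c0" for p
    using that H.e0 H.c0 by (simp add: H.chart_inv_e0 B_unit G.chart_inv_carrier[OF G.c0(1)])
  have eq: "group_deriv H N B (chart_inv G.c0 p) Y = dd ?f ((p, H.e0), (0, Y))" if p: "p \<in> chart_image G.c0" for p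
  proof -
    have "has_dir_deriv (\<lambda>q. ?f (p, q)) (dd ?f ((p, H.e0), (0, Y))) H.e0 Y"
      by (rule C1_on_partial2[OF C3_on_C1[OF f] pO[OF p]])
    moreover have "(\<lambda>q. ?f (p, q)) = rep H.c0 H.c0 (B (chart_inv G.c0 p))" by (simp add: rep_def)
    ultimately show ?thesis
      by (simp add: group_deriv_def tangent_map_def tangent_map_in_rep B_unit G.chart_inv_carrier[OF G.c0(1) p] dd_eq)
  qed
  have "has_dir_deriv (\<lambda>p. dd ?f ((p, H.e0), (0, Y))) (dd (dd ?f) (((G.e0, H.e0), (0, Y)), ((X, 0), 0))) G.e0 X"
  proof (rule C1_on_chain[OF C2_on_dd[OF C3_on_C2[OF f]], of "\<lambda>p. ((p, H.e0), (0, Y))"])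
    show "has_dir_deriv (\<lambda>p. ((p, H.e0), (0, Y))) ((X, 0), 0) G.e0 X"
      by (intro has_dir_deriv_Pair has_dir_deriv_linear[OF linear_ident] has_dir_deriv_const)
  qed (use pO[OF G.e0] in simp)
  then have "has_dir_deriv (\<lambda>p. group_deriv H N B (chart_inv G.c0 p) Y)
      (dd (dd ?f) (((G.e0, H.e0), (0, Y)), ((X, 0), 0))) G.e0 X"
    by (rule has_dir_deriv_cong[OF G.image_open[OF G.c0(1)] G.e0, THEN iffD1, rotated]) (simp add: eq)
  then show ?thesis by (simp add: algebra_action_def Let_def dir_deriv_eq)
qed

text \<open>In the second component, left translation by \<open>(?x, ?y)\<close> is
  \<open>B ?x\<close> followed by left translation by \<open>?y\<close>. The direction
  \<open>Y\<close> is therefore transformed by \<open>group_deriv\<close> first.\<close>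

lemma left_invariant_field_semidirect:
  assumes p: "p \<in> chart_image G.c0" and q: "q \<in> chart_image H.c0"
  shows "left_invariant_field SP SM (X, Y) (p, q) =
    (left_invariant_field G M X p, dd H.mult_rep ((q, H.e0), (0, group_deriv H N B (chart_inv G.c0 p) Y)))"
proof -
  let ?x = "chart_inv G.c0 p" and ?y = "chart_inv H.c0 q"
  let ?\<beta> = "rep H.c0 H.c0 (B ?x)"
  have x: "?x \<in> carrier G" by (rule G.chart_inv_carrier[OF G.c0(1) p])
  note inj = chart_inv_prod[OF G.inj[OF G.c0(1)] H.inj[OF H.c0(1)]]
  have "C3_map N N (B ?x)"
    using C3_map_compose[OF C3_manifold_prod[OF G.manifold H.manifold] H.manifold B_C3
        C3_map_Pair[OF C3_map_const[OF H.manifold, of ?x M] C3_map_id[OF H.manifold]]] x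
    by (simp add: G.carrier)
  note \<beta> = C3_on_C1[OF C3_map_rep[OF this H.c0(1) H.c0(1)]]
  have e\<beta>: "H.e0 \<in> rep_dom H.c0 H.c0 (B ?x)"
    using H.e0 H.c0 x by (simp add: rep_dom_def H.chart_inv_e0 B_unit)
  have d\<beta>: "dd ?\<beta> (H.e0, Y) = group_deriv H N B ?x Y"
    using x by (simp add: group_deriv_def tangent_map_def tangent_map_in_rep B_unit)
  have \<beta>e: "?\<beta> H.e0 = H.e0" using x by (simp add: rep_def H.chart_inv_e0 B_unit)
  \<comment> \<open>On \<open>?V\<close> the action lands in the chart at the unit of
    \<open>H\<close>, so the two maps can be composed in coordinates.\<close>
  let ?V = "chart_image G.c0 \<times> rep_dom H.c0 H.c0 (B ?x)"
  have V: "open ?V" "(G.e0, H.e0) \<in> ?V"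
    using C1_on_open[OF \<beta>] G.image_open[OF G.c0(1)] G.e0 e\<beta> by (auto intro: open_Times)
  have 1: "has_dir_deriv (\<lambda>z. G.mult_rep (p, fst z)) (dd G.mult_rep ((p, G.e0), (0, X))) (G.e0, H.e0) (X, Y)"
    by (rule C1_on_chain[OF C3_on_C1[OF G.mult_rep_C3], of "\<lambda>z. (p, fst z)" "(G.e0, H.e0)" "(0, X)" "(X, Y)", simplified])
      (use G.mult_rep_unit[OF p] has_dir_deriv_Pair[OF has_dir_deriv_const has_dir_deriv_linear[OF linear_fst]] in fastforce)+
  have "has_dir_deriv (\<lambda>z. ?\<beta> (snd z)) (dd ?\<beta> (H.e0, Y)) (G.e0, H.e0) (X, Y)"
    by (rule C1_on_chain[OF \<beta>, of snd "(G.e0, H.e0)" Y "(X, Y)", simplified])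
      (use e\<beta> has_dir_deriv_linear[OF linear_snd] in fastforce)+
  then have inner: "has_dir_deriv (\<lambda>z. (q, ?\<beta> (snd z))) (0, dd ?\<beta> (H.e0, Y)) (G.e0, H.e0) (X, Y)"
    by (rule has_dir_deriv_Pair[OF has_dir_deriv_const])
  have "has_dir_deriv (\<lambda>z. H.mult_rep (q, ?\<beta> (snd z)))
      (dd H.mult_rep ((q, H.e0), (0, group_deriv H N B ?x Y))) (G.e0, H.e0) (X, Y)"
    using C1_on_chain[OF C3_on_C1[OF H.mult_rep_C3] _ inner] H.mult_rep_unit[OF q]
    by (simp add: \<beta>e d\<beta>)
  from has_dir_deriv_Pair[OF 1 this]
  have "has_dir_deriv (rep S.c0 S.c0 (\<lambda>y. (?x, ?y) \<otimes>\<^bsub>SP\<^esub> y))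
      (dd G.mult_rep ((p, G.e0), (0, X)), dd H.mult_rep ((q, H.e0), (0, group_deriv H N B ?x Y))) (G.e0, H.e0) (X, Y)"
  proof (rule has_dir_deriv_cong[OF V, THEN iffD1, rotated])
    fix z assume "z \<in> ?V"
    then obtain r s where z: "z = (r, s)" "r \<in> chart_image G.c0" "s \<in> chart_image H.c0" "B ?x (chart_inv H.c0 s) \<in> chart_dom H.c0"
      by (auto simp: rep_dom_def)
    then show "(G.mult_rep (p, fst z), H.mult_rep (q, ?\<beta> (snd z))) = rep S.c0 S.c0 (\<lambda>y. (?x, ?y) \<otimes>\<^bsub>SP\<^esub> y) z"
      by (simp add: S_c0 rep_def inj SP_simps(2) prod_chart_simps G.mult_rep_def H.mult_rep_def
          chart_inv_coord[OF H.inj[OF H.c0(1)]])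
  qed
  from dd_eq[OF this] show ?thesis
    by (simp add: left_invariant_field_def[of SP] Let_def tangent_map_in_rep SP_simps(3)
        prod_manifold_simps(3) prod_chart_simps(2)
        inj[OF p q] G.left_invariant_field_rep[OF p])
qed

text \<open>The \<open>H\<close> component of the field depends on the base point in two ways:
  moving the point of \<open>H\<close> gives the mixed derivative of \<open>H\<close>, and moving
  the point of \<open>G\<close> varies \<open>group_deriv\<close> and gives
  \<open>b\<close>.\<close>

lemma mixed_semidirect: "S.mixed (X, Y) (X', Y') = (G.mixed X X', H.mixed Y Y' + b X Y')"
proof -
  let ?\<beta> = "\<lambda>p. group_deriv H N B (chart_inv G.c0 p) Y'"
  note m1 = C3_on_C1[OF H.mult_rep_C3] and m2 = C2_on_dd[OF C3_on_C2[OF H.mult_rep_C3]]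
  note ee = H.mult_rep_unit(1)[OF H.e0]
  have fst: "has_dir_deriv (\<lambda>z. f (fst z)) D (G.e0, H.e0) (X, Y)" if "has_dir_deriv f D G.e0 X"
    for f :: "'e \<Rightarrow> 'x::locally_convex_space" and D
    using that by (simp add: has_dir_deriv_def)
  \<comment> \<open>The unit of \<open>G\<close> acts trivially, so at the base point the direction
    is \<open>Y'\<close> itself.\<close>
  have \<beta>e: "?\<beta> G.e0 = Y'"
  proof -
    have "group_deriv H N B \<one>\<^bsub>G\<^esub> Y' = dd (rep H.c0 H.c0 (B \<one>\<^bsub>G\<^esub>)) (H.e0, Y')"
      by (simp add: group_deriv_def tangent_map_def tangent_map_in_rep B_unit)
    also have "\<dots> = dd (\<lambda>x. x) (H.e0, Y')"
      by (rule dd_cong[OF H.image_open[OF H.c0(1)] H.e0])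
        (simp add: rep_def B_one H.chart_inv_carrier[OF H.c0(1)] coord_chart_inv)
    finally show ?thesis by (simp add: G.chart_inv_e0 dd_linear linear_ident)
  qed
  have "has_dir_deriv (\<lambda>z. ((snd z, H.e0), (0, ?\<beta> (fst z)))) ((snd (X, Y), 0), (0, b X Y')) (G.e0, H.e0) (X, Y)"
    by (intro has_dir_deriv_Pair has_dir_deriv_linear[OF linear_snd] has_dir_deriv_const
        fst[OF group_deriv_has_dir_deriv])
  from C1_on_chain[OF m2 _ this]
  have "has_dir_deriv (\<lambda>z. dd H.mult_rep ((snd z, H.e0), (0, ?\<beta> (fst z))))
      (dd (dd H.mult_rep) (((H.e0, H.e0), (0, Y')), ((Y, 0), (0, b X Y')))) (G.e0, H.e0) (X, Y)"
    using ee by (simp add: \<beta>e)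
  also have "dd (dd H.mult_rep) (((H.e0, H.e0), (0, Y')), ((Y, 0), (0, b X Y'))) = H.mixed Y Y' + b X Y'"
    unfolding dd_linear_second[OF m2 ee C1_on_dd_linear[OF m1 ee], of "(0, Y')" "(Y, 0)" "(0, b X Y')"]
    by (simp add: H.mixed_def H.dd_mult_rep_unit[OF H.e0])
  finally have *: "has_dir_deriv (\<lambda>z. (left_invariant_field G M X' (fst z), dd H.mult_rep ((snd z, H.e0), (0, ?\<beta> (fst z)))))
      (G.mixed X X', H.mixed Y Y' + b X Y') (G.e0, H.e0) (X, Y)"
    by (rule has_dir_deriv_Pair[OF fst[OF G.left_invariant_field_deriv]])
  have "has_dir_deriv (left_invariant_field SP SM (X', Y')) (G.mixed X X', H.mixed Y Y' + b X Y') (G.e0, H.e0) (X, Y)"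
    by (rule has_dir_deriv_cong[THEN iffD1, OF _ _ _ *, of "chart_image G.c0 \<times> chart_image H.c0"])
      (use G.e0 H.e0 in \<open>auto intro!: open_Times G.image_open H.image_open G.c0 H.c0 simp: left_invariant_field_semidirect\<close>)
  then show ?thesis
    using has_dir_deriv_unique[OF S.left_invariant_field_deriv] by (simp add: SP_simps(3) prod_manifold_simps(3) prod_chart_simps(2))
qed

lemma ad_semidirect:
  "ad SP SM (X, Y) (X', Y') = (ad G M X X', ad H N Y Y' + b X Y' - b X' Y)"
  by (simp add: S.ad_mixed G.ad_mixed H.ad_mixed mixed_semidirect algebra_simps)

end

section \<open>Transposes and the inner product on the product algebra\<close>

lemma inner_product_transpose_unique:
  assumes "inner_product ip" "is_transpose ip T S" "is_transpose ip T S'"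
  shows "S = S'"
proof
  fix a
  have "ip (S a - S' a) c = 0" for c
    using assms(2,3) bilinear_lsub[of ip "S a" "S' a" c] assms(1)
    unfolding is_transpose_def inner_product_def by (metis diff_self)
  then show "S a = S' a"
    using assms(1) unfolding inner_product_def by (metis eq_iff_diff_eq_0 less_irrefl)
qed

lemma is_transpose_transpose_of:
  assumes "inner_product ip" "has_transpose ip T"
  shows "is_transpose ip T (transpose_of ip T)"
proof -
  obtain S where S: "is_transpose ip T S" using assms(2) unfolding has_transpose_def ..
  show ?thesis
    unfolding transpose_of_def
    by (rule theI[of _ S], rule S, rule inner_product_transpose_unique[OF assms(1) _ S])
qed

text \<open>Absorption by the cylinders \<open>V \<times> UNIV\<close> and
  \<open>UNIV \<times> V\<close> passes to the projections; boundedness of the sum form is thereby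
  reduced to its two summands.\<close>

lemma vn_bounded_fst: "vn_bounded A \<Longrightarrow> vn_bounded (fst ` A)"
  and vn_bounded_snd: "vn_bounded A \<Longrightarrow> vn_bounded (snd ` A)"
proof -
  show "vn_bounded (fst ` A)" if A: "vn_bounded A"
    unfolding vn_bounded_def
  proof (intro allI impI)
    fix V :: "'a set" assume "open V \<and> 0 \<in> V"
    then have "open (V \<times> (UNIV :: 'b set)) \<and> 0 \<in> V \<times> (UNIV :: 'b set)"
      by (simp add: open_Times zero_prod_def)
    from A[unfolded vn_bounded_def, rule_format, OF this]
    obtain r where r: "r > 0" "A \<subseteq> (\<lambda>x. r *\<^sub>R x) ` (V \<times> UNIV)" by blast
    have "fst ` A \<subseteq> (\<lambda>x. r *\<^sub>R x) ` V"
    proof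
      fix y assume "y \<in> fst ` A"
      then obtain a where a: "y = fst a" "a \<in> A" by (rule imageE)
      from subsetD[OF r(2) a(2)] obtain z where "a = r *\<^sub>R z" "z \<in> V \<times> UNIV" by (rule imageE)
      with a(1) show "y \<in> (\<lambda>x. r *\<^sub>R x) ` V" by (auto simp: mem_Times_iff)
    qed
    then show "\<exists>r>0. fst ` A \<subseteq> (\<lambda>x. r *\<^sub>R x) ` V" using r(1) by blast
  qed
  show "vn_bounded (snd ` A)" if A: "vn_bounded A"
    unfolding vn_bounded_def
  proof (intro allI impI)
    fix V :: "'b set" assume "open V \<and> 0 \<in> V"
    then have "open ((UNIV :: 'a set) \<times> V) \<and> 0 \<in> (UNIV :: 'a set) \<times> V"
      by (simp add: open_Times zero_prod_def)
    from A[unfolded vn_bounded_def, rule_format, OF this]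
    obtain r where r: "r > 0" "A \<subseteq> (\<lambda>x. r *\<^sub>R x) ` (UNIV \<times> V)" by blast
    have "snd ` A \<subseteq> (\<lambda>x. r *\<^sub>R x) ` V"
    proof
      fix y assume "y \<in> snd ` A"
      then obtain a where a: "y = snd a" "a \<in> A" by (rule imageE)
      from subsetD[OF r(2) a(2)] obtain z where "a = r *\<^sub>R z" "z \<in> UNIV \<times> V" by (rule imageE)
      with a(1) show "y \<in> (\<lambda>x. r *\<^sub>R x) ` V" by (auto simp: mem_Times_iff)
    qed
    then show "\<exists>r>0. snd ` A \<subseteq> (\<lambda>x. r *\<^sub>R x) ` V" using r(1) by blast
  qed
qed

lemma bounded_sum_inner_product:
  fixes ipG :: "'e::locally_convex_space \<Rightarrow> 'e \<Rightarrow> real" and ipH :: "'f::locally_convex_space \<Rightarrow> 'f \<Rightarrow> real"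
  assumes G: "bounded_inner_product ipG" and H: "bounded_inner_product ipH"
  shows "bounded_inner_product (sum_inner_product ipG ipH)"
  unfolding bounded_inner_product_def
proof (intro conjI allI impI)
  have g: "bilinear ipG" "\<And>v w. ipG v w = ipG w v" "\<And>v. v \<noteq> 0 \<Longrightarrow> ipG v v > 0"
    and h: "bilinear ipH" "\<And>v w. ipH v w = ipH w v" "\<And>v. v \<noteq> 0 \<Longrightarrow> ipH v v > 0"
    using G H unfolding bounded_inner_product_def inner_product_def by auto
  have nonneg: "ipG v v \<ge> 0" "ipH w w \<ge> 0" for v w
    using g(3)[of v] h(3)[of w] bilinear_lzero[OF g(1)] bilinear_lzero[OF h(1)]
    by (cases "v = 0"; cases "w = 0"; force)+
  have "sum_inner_product ipG ipH v v > 0" if "v \<noteq> 0" for v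
    using that g(3)[of "fst v"] h(3)[of "snd v"] nonneg(1)[of "fst v"] nonneg(2)[of "snd v"]
    by (cases v, cases "fst v = 0") (auto simp: sum_inner_product_def zero_prod_def add_pos_nonneg add_nonneg_pos)
  moreover have "bilinear (sum_inner_product ipG ipH)"
    unfolding bilinear_def sum_inner_product_def
    by (auto intro!: linearI simp: bilinear_ladd[OF g(1)] bilinear_radd[OF g(1)] bilinear_lmul[OF g(1)]
        bilinear_rmul[OF g(1)] bilinear_ladd[OF h(1)] bilinear_radd[OF h(1)] bilinear_lmul[OF h(1)]
        bilinear_rmul[OF h(1)] algebra_simps)
  ultimately show "inner_product (sum_inner_product ipG ipH)"
    unfolding inner_product_def using g(2) h(2) by (auto simp: sum_inner_product_def)
  fix A C :: "('e \<times> 'f) set" assume "vn_bounded A \<and> vn_bounded C"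
  then have "bounded ((\<lambda>(a, b). ipG a b) ` (fst ` A \<times> fst ` C))" "bounded ((\<lambda>(a, b). ipH a b) ` (snd ` A \<times> snd ` C))"
    using G H vn_bounded_fst vn_bounded_snd unfolding bounded_inner_product_def by blast+
  then obtain p q where pq: "\<And>a c. a \<in> A \<Longrightarrow> c \<in> C \<Longrightarrow> \<bar>ipG (fst a) (fst c)\<bar> \<le> p"
    "\<And>a c. a \<in> A \<Longrightarrow> c \<in> C \<Longrightarrow> \<bar>ipH (snd a) (snd c)\<bar> \<le> q"
    unfolding bounded_iff by fastforce
  have "\<bar>sum_inner_product ipG ipH a c\<bar> \<le> p + q" if "a \<in> A" "c \<in> C" for a c
    using pq[OF that] by (simp add: sum_inner_product_def case_prod_beta)
  then show "bounded ((\<lambda>(a, b). sum_inner_product ipG ipH a b) ` (A \<times> C))"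
    unfolding bounded_iff by (intro exI[of _ "p + q"]) auto
qed

text \<open>A connected set with more than one point has no isolated points. Derivatives of curves
  are therefore unique on the whole interval, end points included.\<close>

lemma interval_at_within_nontrivial:
  fixes I :: "real set"
  assumes "is_interval I" "\<exists>s\<in>I. \<exists>t\<in>I. s < t" "t \<in> I"
  shows "at t within I \<noteq> bot"
proof -
  have "connected I" using assms(1) by (rule is_interval_connected)
  moreover have "\<nexists>a. I = {a}" using assms(2) by auto
  ultimately have "t islimpt I" using connected_imp_perfect assms(3) by blast
  then show ?thesis by (simp add: trivial_limit_within)
qed

theorem proposition1:
  fixes G :: "'g monoid" and M :: "('g, 'e::locally_convex_space) manifold"
    and H :: "'h monoid" and N :: "('h, 'f::locally_convex_space) manifold"
    and ipG :: "'e \<Rightarrow> 'e \<Rightarrow> real" and ipH :: "'f \<Rightarrow> 'f \<Rightarrow> real"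
    and B :: "'g \<Rightarrow> 'h \<Rightarrow> 'h" and b :: "'e \<Rightarrow> 'f \<Rightarrow> 'f" and h :: "'f \<Rightarrow> 'f \<Rightarrow> 'e"
    and \<gamma> :: "'g \<times> 'h \<Rightarrow> 'e \<times> 'f \<Rightarrow> 'e \<times> 'f \<Rightarrow> real"
    and I :: "real set" and k :: "real \<Rightarrow> 'g \<times> 'h" and u :: "real \<Rightarrow> 'e" and \<alpha> :: "real \<Rightarrow> 'f"
  assumes "lie_group G M" and "lie_group H N"
    and "bounded_inner_product ipG" and "bounded_inner_product ipH"
    and "smooth_action_by_homs G M H N B"
    and b: "b = algebra_action G M H N B"
    and \<gamma>: "right_invariant_metric (semidirect G H B) (prod_manifold M N)
          (sum_inner_product ipG ipH) \<gamma>"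
    and "\<And>X. has_transpose ipG (ad G M X)"
    and "\<And>Y. has_transpose ipH (ad H N Y)"
    and "\<And>X. has_transpose ipH (b X)"
    and "bilinear h"
    and "\<And>X Y1 Y2. ipH (b X Y1) Y2 = ipG (h Y1 Y2) X"
    and "is_interval I" and "\<exists>s\<in>I. \<exists>t\<in>I. s < t"
    and "smooth_curve_in (prod_manifold M N) I k"
    and "\<And>t. t \<in> I \<Longrightarrow>
          right_log_deriv (semidirect G H B) (prod_manifold M N) I k t = (u t, \<alpha> t)"
  shows "geodesic (prod_manifold M N) \<gamma> I k \<longleftrightarrow>
    (\<forall>t\<in>I.
      has_curve_deriv u
        (- transpose_of ipG (ad G M (u t)) (u t) + h (\<alpha> t) (\<alpha> t)) t I \<and>
      has_curve_deriv \<alpha>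
        (- transpose_of ipH (ad H N (\<alpha> t)) (\<alpha> t) - transpose_of ipH (b (u t)) (\<alpha> t)) t I)"
proof -
  interpret GC: C3_lie_group G M by (rule lie_group_C3) fact
  interpret HC: C3_lie_group H N by (rule lie_group_C3) fact
  interpret A: lie_group_action G M H N B by unfold_locales fact
  define adT where "adT = (\<lambda>(X1, Y1) (X2, Y2).
    (transpose_of ipG (ad G M X1) X2 - h Y1 Y2,
     transpose_of ipH (ad H N Y1) Y2 + transpose_of ipH (b X1) Y2))"
  have ip: "inner_product ipG" "inner_product ipH"
    using assms(3,4) unfolding bounded_inner_product_def by auto
  then have bil: "bilinear ipG" "bilinear ipH" and sym: "\<And>v w. ipG v w = ipG w v" "\<And>v w. ipH v w = ipH w v"
    unfolding inner_product_def by blast+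
  have T: "ipG (transpose_of ipG (ad G M X) V) V' = ipG V (ad G M X V')"
    "ipH (transpose_of ipH (ad H N Y) W) W' = ipH W (ad H N Y W')"
    "ipH (transpose_of ipH (b X) W) W' = ipH W (b X W')" for X Y V V' W W'
    using is_transpose_transpose_of[OF ip(1) assms(8)] is_transpose_transpose_of[OF ip(2) assms(9)]
      is_transpose_transpose_of[OF ip(2) assms(10)] unfolding is_transpose_def by blast+
  have "sum_inner_product ipG ipH (adT X Y) Z = sum_inner_product ipG ipH Y (ad A.SP A.SM X Z)" for X Y Z
  proof (cases X, cases Y, cases Z)
    fix X1 Y1 X2 Y2 X3 Y3 assume [simp]: "X = (X1, Y1)" "Y = (X2, Y2)" "Z = (X3, Y3)"
    \<comment> \<open>The bracket contains \<open>- b X3 Y1\<close>, and \<open>h\<close> dualises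
      it after an exchange of arguments in \<open>ipH\<close>. This is the origin of
      \<open>- h Y1 Y2\<close> in \<open>adT\<close>, and so of the plus sign of \<open>h\<close> in
      the equation for \<open>u\<close>.\<close>
    have "ipH Y2 (b X3 Y1) = ipG (h Y1 Y2) X3" using assms(12)[of X3 Y1 Y2] sym(2) by metis
    then show ?thesis
      by (simp add: adT_def sum_inner_product_def A.ad_semidirect b[symmetric] T bilinear_lsub[OF bil(1)]
          bilinear_ladd[OF bil(2)] bilinear_radd[OF bil(2)] bilinear_rsub[OF bil(2)])
  qed
  then interpret R: right_invariant_lie_group A.SP A.SM "sum_inner_product ipG ipH" adT \<gamma>
    by unfold_locales (use bounded_sum_inner_product[OF assms(3,4)] \<gamma> in auto)
  have eq: "- adT (u t, \<alpha> t) (u t, \<alpha> t) = (- transpose_of ipG (ad G M (u t)) (u t) + h (\<alpha> t) (\<alpha> t),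
      - transpose_of ipH (ad H N (\<alpha> t)) (\<alpha> t) - transpose_of ipH (b (u t)) (\<alpha> t))" for t
    by (simp add: adT_def)
  have "geodesic A.SM \<gamma> I k \<longleftrightarrow>
      (\<forall>t\<in>I. has_curve_deriv (\<lambda>t. (u t, \<alpha> t)) (- adT (u t, \<alpha> t) (u t, \<alpha> t)) t I)"
    by (rule R.geodesic_iff_right_log_deriv) (fact assms(15), fact interval_at_within_nontrivial[OF assms(13,14)], fact assms(16))
  then show ?thesis unfolding eq has_curve_deriv_Pair_iff .
qed

end
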